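(* Fix $r\ge0$ and $n\ge0$. There is a bijection $\mathbf w\mapsto(P(\mathbf w),Q(\mathbf w))$ between colored biwords $\mathbf w$ of length $n$ and pairs $(P,Q)$ of semistandard domino tableaux of the same shape $\lambda\in\mathcal P_r(n)$ such that: (1) $tc(\mathbf w)=sp(P(\mathbf w))+sp(Q(\mathbf w))$; (2) the weight of $P(\mathbf w)$ equals the weight of the lower row of $\mathbf w$ and the weight of $Q(\mathbf w)$ equals the weight of the upper row of $\mathbf w$; (3) $P(\mathbf w)^{st}=P_d^r(\mathbf w^{st})$ and $Q(\mathbf w)^{st}=Q_d^r(\mathbf w^{st})$, where $\mathbf w^{st}$ is regarded as a signed permutation in $B_n$.
   Context: Partitions are identified with Young diagrams in English notation: cell $(k,l)$ lies in row $k$ (from the top) and column $l$ (from the left). A domino is a set of two cells sharing an edge (vertical if in one column). $\delta_r=(r,r-1,\dots,1)$; $\mathcal P_r(n)$ is the set of partitions with 2-core $\delta_r$ and size $|\delta_r|+2n$. A semistandard domino tableau of shape $\lambda\in\mathcal P_r(n)$ is a tiling of $\lambda/\delta_r$ by $n$ dominoes, each containing a positive integer, such that giving each cell the number of its domino, entries weakly increase along rows and strictly increase down columns; its weight is $(\mu_1,\mu_2,\dots)$ with $\mu_i$ the number of dominoes labelled $i$, and its spin $sp$ is half the number of vertical dominoes. It is standard (SDT) if its labels are exactly $1,\dots,n$ (equivalently a chain $\delta_r=\lambda^0\subset\cdots\subset\lambda^n$ with $\lambda^k/\lambda^{k-1}$ the domino labelled $k$). Its standardisation $D^{st}$ replaces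 the dominoes labelled $1$ by $1,\dots,\mu_1$ from left to right, those labelled $2$ by $\mu_1+1,\dots,\mu_1+\mu_2$ from left to right, etc. Letters are positive integers, possibly barred; for a letter $y$, $y^{neg}$ is $y$ if unbarred and $-m$ if $y=\bar m$; $|y|$ is the underlying integer. A biletter is a pair $\binom{x}{y}$ of letters. A doubly colored biword is a finite sequence of biletters in canonical order: $\binom{x}{y}$ precedes $\binom{k}{l}$ iff $|x|<|k|$, or $|x|=|k|$ with $x$ barred and $k$ unbarred, or $x=k$ both unbarred and $y^{neg}<l^{neg}$, or $x=k$ both barred and $l^{neg}<y^{neg}$. A colored biword is a doubly colored biword whose top letters are all unbarred; its length is the number of biletters, $tc(\mathbf w)$ is the number of barred letters, and the weights of its rows are the multiplicities of each integer (bars ignored). Operations: $\mathbf w^{\overline{st}}$ replaces the top letters, read left to right, by $1,2,\dots$ keeping their bars; $\mathbf w^{inv}$ swaps the two letters of each biletter (bars travel with letters) and reorders canonically. The standardisation is $\mathbf w^{st}=(((\mathbf w^{\overline{st}})^{inv})^{\overline{st}})^{inv}$; it has top row $1,2,\dots,n$ and bottom row a word in $B_n$. $B_n$ is the set of words $\pi=\pi_1\cdots\pi_n$ in letters $\{1,\dots,n,\bar1,\dots,\bar n\}$ using each $k\in[n]$ exactly once. For $\pi\in B_n$, growth diagram: $M(i,j)=1$ if $\pi_i=j$, $-1$ if $\pi_i=\bar j$, $0$ otherwise; partitions $\lambda_{(i,j)}$, $1\le i,j\le n+1$, with $\lambda_{(1,j)}=\lambda_{(i,1)}=\delta_r$;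 for $i,j\in[n]$, with $\lambda=\lambda_{(i,j)},\mu=\lambda_{(i+1,j)},\nu=\lambda_{(i,j+1)}$, $\rho=\lambda_{(i+1,j+1)}$ is: (1) if $M(i,j)=1$ (then $\lambda=\mu=\nu$), $\lambda$ with two cells appended to its first row; (2) if $M(i,j)=-1$, $\lambda$ with two cells appended to its first column; (3) if $M(i,j)=0$ and $\lambda=\mu$ or $\lambda=\nu$, the largest of $\lambda,\mu,\nu$; (4) otherwise, with dominoes $\gamma=\nu/\lambda$, $\gamma'=\mu/\lambda$: if disjoint, $\lambda\cup\gamma\cup\gamma'$; if they share exactly the cell $(k,l)$, $\lambda\cup\gamma\cup\gamma'\cup\{(k+1,l+1)\}$; if $\gamma=\gamma'$ vertical in column $l$, $\lambda\cup\gamma$ with two cells appended at the bottom of column $l+1$; if $\gamma=\gamma'$ horizontal in row $k$, $\lambda\cup\gamma$ with two cells appended at the end of row $k+1$. $P_d^r(\pi)$ is the SDT given by $\lambda_{(n+1,1)}\subset\cdots\subset\lambda_{(n+1,n+1)}$ and $Q_d^r(\pi)$ the SDT given by $\lambda_{(1,n+1)}\subset\cdots\subset\lambda_{(n+1,n+1)}$. *)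

theory Defs
  imports Complex_Main "HOL-Library.Multiset"
begin

(* Cells are pairs (row, column), 1-indexed, English notation.
   Letters are pairs (m, barred) with m a positive integer. *)
type_synonym cell = "nat \<times> nat"
type_synonym shape = "cell set"
type_synonym letter = "nat \<times> bool"
type_synonym biletter = "letter \<times> letter"   (* (top, bottom) *)
type_synonym dtab = "(cell set \<times> nat) set"   (* set of (domino, label) *)

definition is_partition :: "shape \<Rightarrow> bool" where
  "is_partition lam \<longleftrightarrow> finite lam \<and>
     (\<forall>(k,l)\<in>lam. 1 \<le> k \<and> 1 \<le> l \<and>
        (\<forall>k' l'. 1 \<le> k' \<and> k' \<le> k \<and> 1 \<le> l' \<and> l' \<le> l \<longrightarrow> (k',l') \<in> lam))"

definition delta :: "nat \<Rightarrow> shape" where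
  "delta r = {(k,l). 1 \<le> k \<and> 1 \<le> l \<and> k + l \<le> r + 1}"

definition vertical :: "cell set \<Rightarrow> bool" where
  "vertical D \<longleftrightarrow> (\<exists>k l. D = {(k,l), (Suc k, l)})"

definition horizontal :: "cell set \<Rightarrow> bool" where
  "horizontal D \<longleftrightarrow> (\<exists>k l. D = {(k,l), (k, Suc l)})"

definition domino :: "cell set \<Rightarrow> bool" where
  "domino D \<longleftrightarrow> vertical D \<or> horizontal D"

definition is_2core :: "shape \<Rightarrow> bool" where
  "is_2core mu \<longleftrightarrow> is_partition mu \<and>
     \<not> (\<exists>D. domino D \<and> D \<subseteq> mu \<and> is_partition (mu - D))"

definition has_2core :: "shape \<Rightarrow> shape \<Rightarrow> bool" where
  "has_2core lam mu \<longleftrightarrow> is_2core mu \<and>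
     (\<exists>m c. c 0 = mu \<and> c m = lam \<and>
        (\<forall>k<m. is_partition (c (Suc k)) \<and> c k \<subseteq> c (Suc k) \<and> domino (c (Suc k) - c k)))"

definition Pr :: "nat \<Rightarrow> nat \<Rightarrow> shape set" where
  "Pr r n = {lam. is_partition lam \<and> has_2core lam (delta r) \<and> card lam = card (delta r) + 2 * n}"

definition ssdt :: "nat \<Rightarrow> shape \<Rightarrow> dtab \<Rightarrow> bool" where
  "ssdt r lam T \<longleftrightarrow> finite T \<and> delta r \<subseteq> lam \<and>
     (\<forall>(D,i)\<in>T. domino D \<and> 1 \<le> i) \<and>
     (\<forall>p\<in>T. \<forall>q\<in>T. p \<noteq> q \<longrightarrow> fst p \<inter> fst q = {}) \<and>
     \<Union>(fst ` T) = lam - delta r \<and>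
     (\<forall>(D,i)\<in>T. \<forall>(D',j)\<in>T. \<forall>c\<in>D. \<forall>c'\<in>D'.
        fst c = fst c' \<and> snd c < snd c' \<longrightarrow> i \<le> j) \<and>
     (\<forall>(D,i)\<in>T. \<forall>(D',j)\<in>T. \<forall>c\<in>D. \<forall>c'\<in>D'.
        D \<noteq> D' \<and> snd c = snd c' \<and> fst c < fst c' \<longrightarrow> i < j)"

definition tab_wt :: "dtab \<Rightarrow> nat \<Rightarrow> nat" where
  "tab_wt T i = card {D. (D,i) \<in> T}"

definition spin :: "dtab \<Rightarrow> rat" where
  "spin T = of_nat (card {p \<in> T. vertical (fst p)}) / 2"

definition mincol :: "cell set \<Rightarrow> nat" where
  "mincol D = Min (snd ` D)"

definition std_label :: "dtab \<Rightarrow> cell set \<Rightarrow> nat \<Rightarrow> nat" where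
  "std_label T D i = card {p \<in> T. snd p < i} +
                     card {p \<in> T. snd p = i \<and> mincol (fst p) \<le> mincol D}"

definition tab_std :: "dtab \<Rightarrow> dtab" where
  "tab_std T = {(D, std_label T D i) | D i. (D,i) \<in> T}"

definition tab_of_chain :: "(nat \<Rightarrow> shape) \<Rightarrow> nat \<Rightarrow> dtab" where
  "tab_of_chain c n = {(c k - c (k - 1), k) | k. k \<in> {1..n}}"

definition rowlen :: "shape \<Rightarrow> nat \<Rightarrow> nat" where
  "rowlen lam k = card {l. (k,l) \<in> lam}"

definition collen :: "shape \<Rightarrow> nat \<Rightarrow> nat" where
  "collen lam l = card {k. (k,l) \<in> lam}"

definition Mval :: "letter list \<Rightarrow> nat \<Rightarrow> nat \<Rightarrow> int" where
  "Mval p i j = (if 1 \<le> i \<and> i \<le> length p then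
       (if p ! (i - 1) = (j, False) then 1 else if p ! (i - 1) = (j, True) then -1 else 0)
     else 0)"

definition local_rule :: "int \<Rightarrow> shape \<Rightarrow> shape \<Rightarrow> shape \<Rightarrow> shape" where
  "local_rule m lam mu nu =
    (if m = 1 then lam \<union> {(1, rowlen lam 1 + 1), (1, rowlen lam 1 + 2)}
     else if m = -1 then lam \<union> {(collen lam 1 + 1, 1), (collen lam 1 + 2, 1)}
     else if lam = mu then nu
     else if lam = nu then mu
     else (let g = nu - lam; g' = mu - lam in
       if g \<inter> g' = {} then lam \<union> g \<union> g'
       else if card (g \<inter> g') = 1 then
         (case the_elem (g \<inter> g') of (k,l) \<Rightarrow> lam \<union> g \<union> g' \<union> {(k+1, l+1)})
       else if g = g' \<and> vertical g then
         (let l = snd (SOME c. c \<in> g); h = collen (lam \<union> g) (l+1)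
          in lam \<union> g \<union> {(h+1, l+1), (h+2, l+1)})
       else if g = g' \<and> horizontal g then
         (let k = fst (SOME c. c \<in> g); h = rowlen (lam \<union> g) (k+1)
          in lam \<union> g \<union> {(k+1, h+1), (k+1, h+2)})
       else lam))"

(* growth r p a b = lambda_{(a+1,b+1)} in the paper's 1-indexed notation *)
fun growth :: "nat \<Rightarrow> letter list \<Rightarrow> nat \<Rightarrow> nat \<Rightarrow> shape" where
  "growth r p 0 j = delta r"
| "growth r p (Suc i) 0 = delta r"
| "growth r p (Suc i) (Suc j) =
     local_rule (Mval p (Suc i) (Suc j)) (growth r p i j) (growth r p (Suc i) j) (growth r p i (Suc j))"

definition Pd :: "nat \<Rightarrow> letter list \<Rightarrow> dtab" where
  "Pd r p = tab_of_chain (\<lambda>k. growth r p (length p) k) (length p)"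

definition Qd :: "nat \<Rightarrow> letter list \<Rightarrow> dtab" where
  "Qd r p = tab_of_chain (\<lambda>k. growth r p k (length p)) (length p)"

definition neg :: "letter \<Rightarrow> int" where
  "neg y = (if snd y then - int (fst y) else int (fst y))"

definition prec :: "biletter \<Rightarrow> biletter \<Rightarrow> bool" where
  "prec a b = (case a of (x,y) \<Rightarrow> case b of (k,l) \<Rightarrow>
      fst x < fst k
    \<or> (fst x = fst k \<and> snd x \<and> \<not> snd k)
    \<or> (x = k \<and> \<not> snd x \<and> neg y < neg l)
    \<or> (x = k \<and> snd x \<and> neg l < neg y))"

definition canonical :: "biletter list \<Rightarrow> bool" where
  "canonical w \<longleftrightarrow> sorted_wrt (\<lambda>a b. a = b \<or> prec a b) w"

definition dcbiword :: "biletter list \<Rightarrow> bool" where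
  "dcbiword w \<longleftrightarrow> (\<forall>(x,y)\<in>set w. 1 \<le> fst x \<and> 1 \<le> fst y) \<and> canonical w"

definition cbiword :: "biletter list \<Rightarrow> bool" where
  "cbiword w \<longleftrightarrow> dcbiword w \<and> (\<forall>(x,y)\<in>set w. \<not> snd x)"

definition tc :: "biletter list \<Rightarrow> nat" where
  "tc w = length (filter (\<lambda>(x,y). snd x) w) + length (filter (\<lambda>(x,y). snd y) w)"

definition wt_top :: "biletter list \<Rightarrow> nat \<Rightarrow> nat" where
  "wt_top w i = count (mset (map (\<lambda>(x,y). fst x) w)) i"

definition wt_bot :: "biletter list \<Rightarrow> nat \<Rightarrow> nat" where
  "wt_bot w i = count (mset (map (\<lambda>(x,y). fst y) w)) i"

definition ostd :: "biletter list \<Rightarrow> biletter list" where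
  "ostd w = [((Suc i, snd (fst (w ! i))), snd (w ! i)). i \<leftarrow> [0..<length w]]"

definition binv :: "biletter list \<Rightarrow> biletter list" where
  "binv w = (THE v. canonical v \<and> mset v = mset (map prod.swap w))"

definition bstd :: "biletter list \<Rightarrow> biletter list" where
  "bstd w = binv (ostd (binv (ostd w)))"

end

theory Submission
  imports Defs "HOL-Library.Product_Lexorder"
begin

text \<open>A partition is encoded by its bead set (Maya diagram): row \<open>k\<close> contributes the bead
  \<open>\<lambda>\<^sub>k + 1 - k\<close>. Adding a domino moves a bead from \<open>x\<close> to the gap \<open>x + 2\<close>; the domino occupies the
  diagonals \<open>x\<close> and \<open>x + 1\<close>, and it is vertical iff \<open>x + 1\<close> is a bead. In this language the local
  rule becomes: two different moves are both performed; if the two moves coincide, the next column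
  to the right (vertical case) or the next row below (horizontal case) is moved instead; and the
  entries \<open>1\<close> and \<open>-1\<close> of the matrix move the topmost bead, respectively fill the lowest gap.
  This rule is invertible, which makes \<open>(P\<^sub>d, Q\<^sub>d)\<close> bijective since a 2-core admits no backward
  moves; it creates two vertical dominoes exactly at the entries \<open>-1\<close>; and it preserves whether two
  consecutive moves \<open>x, x'\<close> satisfy \<open>x < x'\<close>, so that this order is decided by the comparison
  of two adjacent letters of the signed permutation or of its inverse.

  A semistandard tableau is a standard one together with weakly increasing labels such that equal
  consecutive labels force \<open>x < x'\<close>; a colored biword is a signed permutation together with two
  weakly increasing rows such that equal consecutive labels force an ascent of the permutation or of
  its inverse. Hence the standard bijection extends to the semistandard one.\<close>

section \<open>Bead sets and the local rule\<close>

text \<open>Rows and columns of the diagram play the same role: \<open>bead_rule_swap\<close>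
  transfers statements about \<open>Q\<close> to \<open>P\<close>, with the signed permutation
  replaced by its inverse. Every edge of the diagram is trivial or a single bead move, and the edges
  across a row are trivial exactly until the row has met its nonzero entry. This bookkeeping shows
  that the rule applies in every square, and conversely that a diagram rebuilt from its last row and
  column carries a signed permutation. The delicate square is the one whose two edges into the last
  corner are the same move: read backwards, it may come from a bump or from a matrix entry. The
  orientation of the new domino tells in which direction to search for the bumped one, and an entry
  is the case in which the search finds nothing. The comparison \<open>x < x'\<close> is chosen
  because it can be followed through a diagram one square at a time; that it places the second
  domino further right matters only on the boundary, where the tableaux live.\<close>

definition movable :: "int set \<Rightarrow> int \<Rightarrow> bool" where
  "movable A x \<longleftrightarrow> x \<in> A \<and> x + 2 \<notin> A"

definition move :: "int set \<Rightarrow> int \<Rightarrow> int set" where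
  "move A x = insert (x + 2) (A - {x})"

definition step :: "int set \<Rightarrow> int set \<Rightarrow> bool" where
  "step A B \<longleftrightarrow> (\<exists>x. movable A x \<and> B = move A x)"

definition step_eq :: "int set \<Rightarrow> int set \<Rightarrow> bool" where
  "step_eq A B \<longleftrightarrow> A = B \<or> step A B"

definition pos :: "int set \<Rightarrow> int set \<Rightarrow> int" where
  "pos A B = the_elem (A - B)"

definition maya :: "int set \<Rightarrow> bool" where
  "maya A \<longleftrightarrow> (\<exists>N. \<forall>x\<ge>N. x \<notin> A) \<and> (\<exists>N. \<forall>x\<le>N. x \<in> A)"

definition top_bead :: "int set \<Rightarrow> int \<Rightarrow> bool" where
  "top_bead A z \<longleftrightarrow> z \<in> A \<and> (\<forall>w>z. w \<notin> A)"

definition bottom_gap :: "int set \<Rightarrow> int \<Rightarrow> bool" where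
  "bottom_gap A g \<longleftrightarrow> g \<notin> A \<and> (\<forall>w<g. w \<in> A)"

text \<open>If a domino added at \<open>x\<close> is bumped, \<open>z\<close> is the bead that moves instead: in the vertical case
  \<open>z + 2\<close> is the first gap right of \<open>x + 2\<close>, in the horizontal case \<open>z\<close> is the first bead left of \<open>x\<close>.\<close>

definition bump :: "int set \<Rightarrow> int \<Rightarrow> int \<Rightarrow> bool" where
  "bump A x z \<longleftrightarrow>
     (if x + 1 \<in> A then x < z \<and> z + 2 \<notin> A \<and> (\<forall>w. x + 2 < w \<and> w < z + 2 \<longrightarrow> w \<in> A)
      else z < x \<and> z \<in> A \<and> (\<forall>w. z < w \<and> w < x \<longrightarrow> w \<notin> A))"

text \<open>\<open>bead_rule m A B C G\<close>: the local rule with entry \<open>m\<close> turns \<open>\<lambda> = A\<close>, \<open>\<mu> = B\<close>, \<open>\<nu> = C\<close> into \<open>\<rho> = G\<close>.\<close>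

inductive bead_rule :: "int \<Rightarrow> int set \<Rightarrow> int set \<Rightarrow> int set \<Rightarrow> int set \<Rightarrow> bool" where
  bead_rule_top: "top_bead A z \<Longrightarrow> bead_rule 1 A A A (move A z)"
| bead_rule_bot: "bottom_gap A (z + 2) \<Longrightarrow> bead_rule (-1) A A A (move A z)"
| bead_rule_left: "step_eq A C \<Longrightarrow> bead_rule 0 A A C C"
| bead_rule_right: "step_eq A B \<Longrightarrow> bead_rule 0 A B A B"
| bead_rule_two: "movable A x \<Longrightarrow> movable A y \<Longrightarrow> x \<noteq> y \<Longrightarrow>
     bead_rule 0 A (move A x) (move A y) (move (move A x) y)"
| bead_rule_bump: "movable A x \<Longrightarrow> bump A x z \<Longrightarrow> bead_rule 0 A (move A x) (move A x) (move (move A x) z)"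

section \<open>Existence of extremal and bumped beads\<close>

lemma int_least:
  assumes "P q" "a < (q::int)"
  obtains g where "a < g" "P g" "\<And>w. a < w \<Longrightarrow> w < g \<Longrightarrow> \<not> P w"
proof -
  let ?n = "LEAST n. P (a + 1 + int n)"
  have ex: "P (a + 1 + int (nat (q - a - 1)))" using assms by simp
  have 1: "P (a + 1 + int ?n)" by (rule LeastI[of "\<lambda>n. P (a + 1 + int n)", OF ex])
  have 2: "\<not> P w" if w: "a < w" "w < a + 1 + int ?n" for w
  proof -
    have "nat (w - a - 1) < ?n" using w by linarith
    then have "\<not> P (a + 1 + int (nat (w - a - 1)))" by (rule not_less_Least)
    then show ?thesis using w by simp
  qed
  show ?thesis by (rule that[OF _ 1]) (simp, rule 2)
qed

lemma int_greatest:
  assumes "P q" "(q::int) < a"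
  obtains g where "g < a" "P g" "\<And>w. g < w \<Longrightarrow> w < a \<Longrightarrow> \<not> P w"
proof -
  obtain g where g: "- a < g" "P (- g)" "\<And>w. - a < w \<Longrightarrow> w < g \<Longrightarrow> \<not> P (- w)"
    using int_least[of "\<lambda>x. P (- x)" "- q" "- a"] assms by auto
  have "\<not> P w" if "- g < w" "w < a" for w
    using g(3)[of "- w"] that by simp
  then show ?thesis using that[of "- g"] g by simp
qed

lemma mayaE:
  assumes "maya A"
  obtains M N where "\<And>x. x \<ge> N \<Longrightarrow> x \<notin> A" "\<And>x. x \<le> M \<Longrightarrow> x \<in> A"
  using assms unfolding maya_def by blast

lemma maya_move: assumes "maya A" shows "maya (move A x)"
proof -
  obtain M N where MN: "\<And>x. x \<ge> N \<Longrightarrow> x \<notin> A" "\<And>x. x \<le> M \<Longrightarrow> x \<in> A"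
    using mayaE[OF assms] by metis
  have "\<forall>y\<ge>max N (x + 3). y \<notin> move A x" "\<forall>y\<le>min M (x - 1). y \<in> move A x"
    using MN by (auto simp: move_def)
  then show ?thesis unfolding maya_def by blast
qed

lemma maya_step_eq: "maya A \<Longrightarrow> step_eq A B \<Longrightarrow> maya B"
  by (auto simp: step_eq_def step_def maya_move)

lemma maya_top_bead: assumes "maya A" shows "\<exists>z. top_bead A z"
proof -
  obtain M N where MN: "\<And>x. x \<ge> N \<Longrightarrow> x \<notin> A" "\<And>x. x \<le> M \<Longrightarrow> x \<in> A"
    using mayaE[OF assms] by metis
  have "M \<in> A" "M < N" using MN(1)[of M] MN(2)[of M] by force+
  then obtain g where "g < N" "g \<in> A" "\<And>w. g < w \<Longrightarrow> w < N \<Longrightarrow> w \<notin> A"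
    using int_greatest[of "\<lambda>x. x \<in> A" M N] by metis
  then show ?thesis using MN(1) unfolding top_bead_def by (metis not_le)
qed

lemma maya_bottom_gap: assumes "maya A" shows "\<exists>z. bottom_gap A (z + 2)"
proof -
  obtain M N where MN: "\<And>x. x \<ge> N \<Longrightarrow> x \<notin> A" "\<And>x. x \<le> M \<Longrightarrow> x \<in> A"
    using mayaE[OF assms] by metis
  have "N \<notin> A" "M < N" using MN(1)[of M] MN(1)[of N] MN(2)[of M] by force+
  then obtain g where "M < g" "g \<notin> A" "\<And>w. M < w \<Longrightarrow> w < g \<Longrightarrow> w \<in> A"
    using int_least[of "\<lambda>x. x \<notin> A" N M] by metis
  then have "bottom_gap A ((g - 2) + 2)" using MN(2) unfolding bottom_gap_def
    by (metis not_le diff_add_cancel)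
  then show ?thesis by blast
qed

lemma bump_exists: assumes "maya A" "movable A x" shows "\<exists>z. bump A x z"
proof -
  obtain M N where MN: "\<And>x. x \<ge> N \<Longrightarrow> x \<notin> A" "\<And>x. x \<le> M \<Longrightarrow> x \<in> A"
    using mayaE[OF assms(1)] by metis
  show ?thesis
  proof (cases "x + 1 \<in> A")
    case True
    have "max N (x + 3) \<notin> A" using MN(1) by simp
    then obtain g where "x + 2 < g" "g \<notin> A" "\<And>w. x + 2 < w \<Longrightarrow> w < g \<Longrightarrow> w \<in> A"
      by (rule int_least[of "\<lambda>x. x \<notin> A" "max N (x + 3)" "x + 2"]) simp_all
    then show ?thesis using True by (intro exI[of _ "g - 2"]) (auto simp: bump_def)
  next
    case False
    have "min M (x - 1) \<in> A" using MN(2) by simp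
    then obtain g where "g < x" "g \<in> A" "\<And>w. g < w \<Longrightarrow> w < x \<Longrightarrow> w \<notin> A"
      by (rule int_greatest[of "\<lambda>x. x \<in> A" "min M (x - 1)" x]) simp_all
    then show ?thesis using False by (auto simp: bump_def)
  qed
qed

lemma bump_less_iff:
  assumes "bump A x z"
  shows "x < z \<longleftrightarrow> x + 1 \<in> A" "z < x \<longleftrightarrow> x + 1 \<notin> A"
  using assms by (cases "x + 1 \<in> A"; simp add: bump_def)+

text \<open>A bump passes on to the next column or row, so the replacing domino inherits the
  orientation. Both the count of vertical dominoes and the recognition of a bump from its outcome
  rest on the second part.\<close>

lemma bump_movable:
  assumes "movable A x" "bump A x z"
  shows "movable (move A x) z" "z + 1 \<in> move A x \<longleftrightarrow> x + 1 \<in> A"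
proof -
  show "movable (move A x) z"
  proof (cases "x + 1 \<in> A")
    case True
    then have *: "x < z" "z + 2 \<notin> A" "\<And>w. x + 2 < w \<Longrightarrow> w < z + 2 \<Longrightarrow> w \<in> A"
      using assms(2) by (auto simp: bump_def)
    \<comment> \<open>For \<open>z = x + 2\<close> this bead is not one of \<open>A\<close> but the
      one that has just arrived.\<close>
    have "z \<in> move A x" using * True *(3)[of z]
      by (cases "z = x + 1"; cases "z = x + 2") (auto simp: move_def)
    then show ?thesis using * by (auto simp: movable_def move_def)
  next
    case False
    then have *: "z < x" "z \<in> A" "\<And>w. z < w \<Longrightarrow> w < x \<Longrightarrow> w \<notin> A"
      using assms(2) by (auto simp: bump_def)
    consider "z + 2 < x" | "z + 2 = x" | "z + 2 = x + 1" using *(1) by linarith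
    then have "z + 2 \<notin> move A x"
    proof cases
      case 1
      then show ?thesis using *(1) *(3)[of "z + 2"] by (simp add: move_def)
    next
      case 2
      then show ?thesis by (simp add: move_def)
    next
      case 3
      have "z + 2 \<notin> A" unfolding 3 by (rule False)
      then show ?thesis using *(1) by (simp add: move_def)
    qed
    then show ?thesis using * by (auto simp: movable_def move_def)
  qed
  show "z + 1 \<in> move A x \<longleftrightarrow> x + 1 \<in> A"
  proof (cases "x + 1 \<in> A")
    case True
    then have *: "x < z" "z + 2 \<notin> A" "\<And>w. x + 2 < w \<Longrightarrow> w < z + 2 \<Longrightarrow> w \<in> A"
      using assms(2) by (auto simp: bump_def)
    then show ?thesis using True *(3)[of "z + 1"]
      by (cases "z = x + 1") (auto simp: move_def)
  next
    case False
    then have *: "z < x" "z \<in> A" "\<And>w. z < w \<Longrightarrow> w < x \<Longrightarrow> w \<notin> A"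
      using assms(2) by (auto simp: bump_def)
    then show ?thesis using False *(3)[of "z + 1"]
      by (cases "z + 1 = x") (auto simp: move_def)
  qed
qed

lemma move_neq: "movable A x \<Longrightarrow> move A x \<noteq> A" "movable A x \<Longrightarrow> A \<noteq> move A x"
  by (auto simp: move_def movable_def)

lemma pos_move: "movable A x \<Longrightarrow> pos A (move A x) = x"
proof -
  assume "movable A x"
  then have "A - move A x = {x}" by (auto simp: move_def movable_def)
  then show ?thesis by (simp add: pos_def)
qed

lemma move_inject: "movable A x \<Longrightarrow> movable A y \<Longrightarrow> move A x = move A y \<longleftrightarrow> x = y"
  by (metis pos_move)

lemma top_bead_movable: "top_bead A z \<Longrightarrow> movable A z"
  by (auto simp: top_bead_def movable_def)

lemma bottom_gap_movable: "bottom_gap A (z + 2) \<Longrightarrow> movable A z"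
  by (auto simp: bottom_gap_def movable_def)

lemma movable_two: "movable A x \<Longrightarrow> movable A y \<Longrightarrow> x \<noteq> y \<Longrightarrow> movable (move A x) y"
  by (auto simp: movable_def move_def)

lemma move_commute: "movable A x \<Longrightarrow> movable A y \<Longrightarrow> x \<noteq> y \<Longrightarrow> move (move A x) y = move (move A y) x"
  by (auto simp: movable_def move_def)

lemma step_move: "movable A x \<Longrightarrow> step A (move A x)"
  by (auto simp: step_def)

lemma bead_rule_swap: "bead_rule m A B C G \<Longrightarrow> bead_rule m A C B G"
proof (induction rule: bead_rule.induct)
  case (bead_rule_two A x y)
  then show ?case using bead_rule.bead_rule_two[of A y x] by (simp add: move_commute)
qed (auto intro: bead_rule.intros)

lemma bead_rule_step_eq:
  assumes "bead_rule m A B C G"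
  shows "step_eq A B" "step_eq A C" "step_eq B G" "step_eq C G"
proof -
  have *: "step_eq A B \<and> step_eq B G" if "bead_rule m A B C G" for B C
    using that
    by (cases rule: bead_rule.cases)
      (auto simp: step_eq_def intro: step_move movable_two top_bead_movable bottom_gap_movable bump_movable)
  show "step_eq A B" "step_eq B G" using *[OF assms] by auto
  show "step_eq A C" "step_eq C G" using *[OF bead_rule_swap[OF assms]] by auto
qed

lemma bead_rule_exists:
  assumes "maya A" "step_eq A B" "step_eq A C" "m \<in> {0,1,-1}" "m \<noteq> 0 \<Longrightarrow> B = A \<and> C = A"
  shows "\<exists>G. bead_rule m A B C G"
proof -
  consider "m = 1" "B = A" "C = A" | "m = -1" "B = A" "C = A" | "m = 0" "B = A" | "m = 0" "C = A"
    | x y where "m = 0" "movable A x" "B = move A x" "movable A y" "C = move A y"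
    using assms(2-5) unfolding step_eq_def step_def by auto
  then show ?thesis
  proof cases
    case 1 then show ?thesis using maya_top_bead[OF assms(1)] bead_rule_top by blast
  next
    case 2 then show ?thesis using maya_bottom_gap[OF assms(1)] bead_rule_bot by blast
  next
    case 3 then show ?thesis using bead_rule_left assms by blast
  next
    case 4 then show ?thesis using bead_rule_right assms by blast
  next
    case 5 then show ?thesis
      by (cases "x = y") (use bead_rule_two bead_rule_bump bump_exists[OF assms(1)] in blast)+
  qed
qed

text \<open>A nontrivial edge persists into the next column, and a nonzero entry starts one.
  Iterated along a row, this gives \<open>grid_edge\<close>.\<close>

lemma bead_rule_edge: assumes "bead_rule m A B C G" shows "C \<noteq> G \<longleftrightarrow> A \<noteq> B \<or> m \<noteq> 0"
  using assms
proof (cases rule: bead_rule.cases)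
  case (bead_rule_two x y)
  then have "x \<in> C" "x \<notin> G" by (auto simp: move_def movable_def)
  then show ?thesis using bead_rule_two by (auto simp: move_neq)
qed (auto simp: move_neq top_bead_movable bottom_gap_movable bump_movable)

section \<open>Inverting the local rule\<close>

lemma move_back: "u \<notin> G \<Longrightarrow> u + 2 \<in> G \<Longrightarrow> move (insert u (G - {u + 2})) u = G"
  by (auto simp: move_def)

lemma step_back: "step A G \<longleftrightarrow> (\<exists>u. u \<notin> G \<and> u + 2 \<in> G \<and> A = insert u (G - {u + 2}))"
  unfolding step_def
proof (intro iffI; elim exE conjE)
  fix x assume "movable A x" "G = move A x"
  then show "\<exists>u. u \<notin> G \<and> u + 2 \<in> G \<and> A = insert u (G - {u + 2})"
    by (intro exI[of _ x]) (auto simp: movable_def move_def)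
next
  fix u assume "u \<notin> G" "u + 2 \<in> G" "A = insert u (G - {u + 2})"
  then show "\<exists>x. movable A x \<and> G = move A x"
    by (intro exI[of _ u]) (auto simp: movable_def move_def)
qed

lemma maya_step_back: assumes "step A G" "maya G" shows "maya A"
proof -
  obtain u where A: "A = insert u (G - {u + 2})" using assms step_back by blast
  obtain M N where MN: "\<And>x. x \<ge> N \<Longrightarrow> x \<notin> G" "\<And>x. x \<le> M \<Longrightarrow> x \<in> G"
    using mayaE[OF assms(2)] by metis
  have "\<forall>y\<ge>max N (u + 3). y \<notin> A" "\<forall>y\<le>min M (u - 1). y \<in> A"
    using MN by (auto simp: A)
  then show ?thesis unfolding maya_def by blast
qed

text \<open>Reverse bumping. A vertical domino at \<open>z\<close> was bumped from the nearest gap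
  left of \<open>z\<close>, a horizontal one by the bead now nearest to the right of
  \<open>z\<close>. If there is no such gap or bead, then \<open>z + 2\<close> is the lowest gap or
  \<open>z\<close> the topmost bead, and the square contains an entry.\<close>

lemma bead_rule_back_same:
  assumes "maya B" "movable B z"
  shows "\<exists>m A. m \<in> {0,1,-1} \<and> bead_rule m A B B (move B z)"
proof (cases "z + 1 \<in> B")
  case True
  note zB = True
  have z: "z \<in> B" "z + 2 \<notin> B" using assms(2) by (auto simp: movable_def)
  show ?thesis
  proof (cases "\<exists>w<z. w \<notin> B")
    case True
    then obtain w where "w < z" "w \<notin> B" by blast
    then obtain x where x: "x < z" "x \<notin> B" "\<And>w. x < w \<Longrightarrow> w < z \<Longrightarrow> w \<in> B"
      using int_greatest[of "\<lambda>x. x \<notin> B" w z] by metis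
    have x1: "x + 1 \<in> B" using x z by (cases "x + 1 = z") auto
    have x2: "x + 2 \<in> B"
    proof -
      consider "x + 2 < z" | "x + 2 = z" | "x + 1 = z" using x(1) by linarith
      then show ?thesis
      proof cases
        case 3
        then have "x + 2 = z + 1" by simp
        then show ?thesis using zB by metis
      qed (use x z in auto)
    qed
    let ?A = "insert x (B - {x + 2})"
    have mv: "movable ?A x" "move ?A x = B" using x(2) x2 by (auto simp: movable_def move_back)
    have "w \<in> ?A" if w: "x + 2 < w" "w < z + 2" for w
    proof -
      consider "w < z" | "w = z" | "w = z + 1" using w by linarith
      then show ?thesis using w x z zB by cases auto
    qed
    then have "bump ?A x z" using x x1 z by (auto simp: bump_def)
    then have "bead_rule 0 ?A B B (move B z)" using bead_rule_bump[OF mv(1)] mv(2) by metis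
    then show ?thesis by blast
  next
    case False
    have "w \<in> B" if w: "w < z + 2" for w
    proof -
      consider "w < z" | "w = z" | "w = z + 1" using w by linarith
      then show ?thesis using False z zB by cases auto
    qed
    then have "bottom_gap B (z + 2)" using z by (auto simp: bottom_gap_def)
    then show ?thesis using bead_rule_bot by blast
  qed
next
  case False
  note zB = False
  have z: "z \<in> B" "z + 2 \<notin> B" using assms(2) by (auto simp: movable_def)
  show ?thesis
  proof (cases "\<exists>w>z. w \<in> B")
    case True
    then obtain w where "z < w" "w \<in> B" by blast
    then obtain y where y: "z < y" "y \<in> B" "\<And>w. z < w \<Longrightarrow> w < y \<Longrightarrow> w \<notin> B"
      using int_least[of "\<lambda>x. x \<in> B" w z] by metis
    \<comment> \<open>The bead found at \<open>y\<close> has to be the one that the first move put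
      there.\<close>
    define x where "x = y - 2"
    have yx: "y = x + 2" by (simp add: x_def)
    have "y \<noteq> z + 1" "y \<noteq> z + 2" using y(2) z zB by auto
    then have zx: "z < x" using y(1) yx by linarith
    have nx: "x \<notin> B" "x + 1 \<notin> B" using y(3)[of x] y(3)[of "x + 1"] zx yx by auto
    let ?A = "insert x (B - {x + 2})"
    have mv: "movable ?A x" "move ?A x = B" using nx y(2) yx by (auto simp: movable_def move_back)
    have "bump ?A x z" using zx nx z y(3) yx by (auto simp: bump_def)
    then have "bead_rule 0 ?A B B (move B z)" using bead_rule_bump[OF mv(1)] mv(2) by metis
    then show ?thesis by blast
  next
    case False
    then have "top_bead B z" using z by (auto simp: top_bead_def)
    then show ?thesis using bead_rule_top by blast
  qed
qed

lemma bead_rule_back_exists: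
  assumes "maya G" "step_eq B G" "step_eq C G"
  shows "\<exists>m A. m \<in> {0,1,-1} \<and> bead_rule m A B C G \<and> maya A"
proof -
  have "\<exists>m A. m \<in> {0,1,-1} \<and> bead_rule m A B C G"
  proof (cases "B = G \<or> C = G")
    case True
    then show ?thesis using bead_rule_left[of B G] bead_rule_right[of C G] assms(2,3) by blast
  next
    case False
    then have st: "step B G" "step C G" using assms by (auto simp: step_eq_def)
    show ?thesis
    proof (cases "B = C")
      case True
      then show ?thesis
        using st(1) bead_rule_back_same[of B] maya_step_back[OF st(1) assms(1)] unfolding step_def by metis
    next
      case False
      obtain u v where u: "u \<notin> G" "u + 2 \<in> G" "B = insert u (G - {u + 2})"
        and v: "v \<notin> G" "v + 2 \<in> G" "C = insert v (G - {v + 2})"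
        using st step_back by meson
      have uv: "u \<noteq> v" using False u v by auto
      let ?A = "insert u (insert v (G - {u + 2, v + 2}))"
      have m: "movable ?A v" "movable ?A u"
        using u v uv by (auto simp: movable_def)
      have e: "move ?A v = B" "move ?A u = C" "move (move ?A v) u = G"
        using u v uv by (auto simp: move_def)
      show ?thesis using bead_rule_two[OF m uv[symmetric]] e by (metis insertI1)
    qed
  qed
  then obtain m A where *: "m \<in> {0,1,-1}" "bead_rule m A B C G" by blast
  have "maya B" using assms(1,2) maya_step_back by (auto simp: step_eq_def)
  then have "maya A" using bead_rule_step_eq(1)[OF *(2)] maya_step_back by (auto simp: step_eq_def)
  then show ?thesis using * by blast
qed

text \<open>Two origins of the same outcome \<open>z\<close> have the same orientation by
  \<open>bump_movable\<close>. If vertical, the gap \<open>x'\<close> of the common set would lie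
  among the positions between \<open>x + 2\<close> and \<open>z + 2\<close>, which the bump of
  \<open>x\<close> requires to be beads; if horizontal, the bead \<open>x + 2\<close> would lie
  among those between \<open>z\<close> and \<open>x'\<close>, which the bump of \<open>x'\<close>
  requires to be gaps.\<close>

lemma bump_back_not_less:
  assumes "bump A x z" "movable A' x'" "bump A' x' z" "move A x = move A' x'" "movable A x"
  shows "\<not> x < x'"
proof
  assume less: "x < x'"
  let ?B = "move A x"
  have nx: "x' \<notin> ?B" "x + 2 \<in> ?B"
  proof -
    show "x' \<notin> ?B" unfolding assms(4) by (simp add: move_def)
    show "x + 2 \<in> ?B" by (simp add: move_def)
  qed
  show False
  proof (cases "x + 1 \<in> A")
    case True
    then have "x + 1 \<in> ?B" by (simp add: move_def)
    then have "x' \<noteq> x + 1" "x' \<noteq> x + 2" using nx by metis+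
    then have "x + 2 < x'" using less by linarith
    moreover have "x' < z"
    proof -
      have "z + 1 \<in> move A' x'" using True bump_movable(2)[OF assms(5,1)] assms(4) by simp
      then show ?thesis using bump_movable(2)[OF assms(2,3)] bump_less_iff(1)[OF assms(3)] by simp
    qed
    ultimately have "x' \<in> A" using assms(1) True by (simp add: bump_def)
    then show False using nx less by (simp add: move_def)
  next
    case False
    have F': "x' + 1 \<notin> A'"
      using False bump_movable(2)[OF assms(5,1)] bump_movable(2)[OF assms(2,3)] assms(4) by simp
    then have "x' + 1 \<notin> ?B" using assms(4) by (simp add: move_def)
    then have "x + 2 \<noteq> x'" "x + 2 \<noteq> x' + 1" using nx by metis+
    then have l: "x + 2 < x'" using less by linarith
    moreover have "z < x" using False bump_less_iff(2)[OF assms(1)] by simp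
    ultimately have "x + 2 \<notin> A'" using assms(3) F' by (simp add: bump_def)
    moreover have "x + 2 \<in> move A' x'" using nx assms(4) by simp
    ultimately show False using l by (simp add: move_def)
  qed
qed

text \<open>The three origins exclude each other because of position \<open>z + 1\<close>. A bump
  ending at the topmost bead would have to be vertical and so leave a bead at \<open>z + 1\<close>;
  a bump ending at the lowest gap would have to be horizontal and so leave a gap there.\<close>

lemma bead_rule_back_unique_same:
  assumes "bead_rule m A B B G" "bead_rule m' A' B B G" "B \<noteq> G"
  shows "m = m' \<and> A = A'"
proof -
  obtain z where z: "movable B z" "G = move B z"
    using assms bead_rule_step_eq(3)[OF assms(1)] unfolding step_eq_def step_def by auto
  have *: "(m = 1 \<and> A = B \<and> top_bead B z) \<or> (m = -1 \<and> A = B \<and> bottom_gap B (z + 2)) \<or>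
     (m = 0 \<and> (\<exists>x. movable A x \<and> bump A x z \<and> B = move A x))"
    if "bead_rule m A B B G" for m A
    using that
  proof (cases rule: bead_rule.cases)
    case (bead_rule_top z')
    then have "z' = z" using z move_inject top_bead_movable by metis
    then show ?thesis using bead_rule_top by simp
  next
    case (bead_rule_bot z')
    then have "z' = z" using z move_inject bottom_gap_movable by metis
    then show ?thesis using bead_rule_bot by simp
  next
    case (bead_rule_bump x z')
    then have "z' = z" using z bump_movable(1) move_inject by metis
    then show ?thesis using bead_rule_bump by auto
  next
    case (bead_rule_two x y)
    then show ?thesis by (metis move_inject)
  qed (use assms(3) in auto)
  have top: "False" if "top_bead B z" "movable A x" "bump A x z" "B = move A x" for A x
  proof -
    have "x + 2 \<in> B" using that by (auto simp: move_def)
    then have "\<not> z < x + 2" using that(1) unfolding top_bead_def by blast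
    then have "x + 1 \<in> A" using bump_less_iff[OF that(3)] by linarith
    then have "z + 1 \<in> B" using bump_movable(2)[OF that(2,3)] that(4) by simp
    then show False using that(1) by (auto simp: top_bead_def)
  qed
  have bot: "False" if "bottom_gap B (z + 2)" "movable A x" "bump A x z" "B = move A x" for A x
  proof -
    have "x \<notin> B" using that by (auto simp: move_def)
    then have "\<not> x < z + 2" using that(1) unfolding bottom_gap_def by blast
    then have "x + 1 \<notin> A" using bump_less_iff[OF that(3)] by linarith
    then have "z + 1 \<notin> B" using bump_movable(2)[OF that(2,3)] that(4) by simp
    then show False using that(1) by (auto simp: bottom_gap_def)
  qed
  have tb: "False" if "bottom_gap B (z + 2)" "top_bead B z"
  proof -
    have "z + 1 \<in> B" using that(1) by (simp add: bottom_gap_def)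
    then show False using that(2) by (simp add: top_bead_def)
  qed
  have bb: "A = A'" if "movable A x" "bump A x z" "B = move A x"
     "movable A' x'" "bump A' x' z" "B = move A' x'" for A x A' x'
  proof -
    have "x = x'"
      using bump_back_not_less that by (metis linorder_neqE)
    moreover have "A = insert x (move A x - {x + 2})" if "movable A x" for A x
      using that by (auto simp: move_def movable_def)
    ultimately show ?thesis using that by metis
  qed
  show ?thesis using *[OF assms(1)] *[OF assms(2)] top bot tb bb by metis
qed

lemma bead_rule_back_unique:
  assumes "bead_rule m A B C G" "bead_rule m' A' B C G"
  shows "m = m' \<and> A = A'"
proof -
  have 1: "A = C \<and> m = 0" if "bead_rule m A B C G" "B = G" for m A B C
    using that
    by (cases rule: bead_rule.cases)
      (auto simp: move_neq top_bead_movable bottom_gap_movable movable_two bump_movable)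
  \<comment> \<open>\<open>B - G\<close> and \<open>C - G\<close> are the two moved beads at their
    old places, \<open>B \<inter> C\<close> the beads that stay.\<close>
  have 3: "m = 0 \<and> A = (B - G) \<union> (C - G) \<union> (B \<inter> C)" if "bead_rule m A B C G" "B \<noteq> C" "B \<noteq> G" "C \<noteq> G" for m A
    using that
  proof (cases rule: bead_rule.cases)
    case (bead_rule_two x y)
    then show ?thesis by (auto simp: move_def movable_def)
  qed auto
  show ?thesis
  proof (cases "B = G")
    case True
    then show ?thesis using 1 assms by metis
  next
    case bg: False
    show ?thesis
    proof (cases "C = G")
      case True
      then show ?thesis using 1[OF bead_rule_swap[OF assms(1)]] 1[OF bead_rule_swap[OF assms(2)]] by simp
    next
      case False
      then show ?thesis using 3[OF assms(1)] 3[OF assms(2)] bg bead_rule_back_unique_same assms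
        by (cases "B = C") auto
    qed
  qed
qed

section \<open>Vertical dominoes in a square\<close>

definition vert :: "int set \<Rightarrow> int set \<Rightarrow> nat" where
  "vert A B = of_bool (A \<noteq> B \<and> pos A B + 1 \<in> A)"

lemma vert_move: "movable A x \<Longrightarrow> vert A (move A x) = of_bool (x + 1 \<in> A)"
  by (simp add: vert_def move_neq pos_move)

lemma vert_refl [simp]: "vert A A = 0"
  by (simp add: vert_def)

text \<open>Two moves at distance one exchange their orientations, since each one creates or removes
  the bead that decides the other; two distinct moves further apart do not interact, and a bump
  keeps the orientation. The entry \<open>1\<close> creates two horizontal dominoes and
  \<open>-1\<close> two vertical ones.\<close>

lemma bead_rule_vert:
  assumes "bead_rule m A B C G"
  shows "vert B G + vert C G = vert A B + vert A C + (if m = -1 then 2 else 0)"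
  using assms
proof (cases rule: bead_rule.cases)
  case (bead_rule_top z)
  then show ?thesis by (auto simp: vert_move top_bead_movable) (auto simp: top_bead_def)
next
  case (bead_rule_bot z)
  then show ?thesis by (auto simp: vert_move bottom_gap_movable) (auto simp: bottom_gap_def)
next
  case (bead_rule_two x y)
  have m: "movable (move A x) y" "movable (move A y) x" using bead_rule_two movable_two by blast+
  have G: "G = move B y" "G = move C x" using bead_rule_two move_commute by auto
  have "vert B G = of_bool (y + 1 \<in> B)" "vert C G = of_bool (x + 1 \<in> C)"
       "vert A B = of_bool (x + 1 \<in> A)" "vert A C = of_bool (y + 1 \<in> A)"
    using vert_move m G bead_rule_two by metis+
  moreover have "of_bool (y + 1 \<in> B) + of_bool (x + 1 \<in> C) = (of_bool (x + 1 \<in> A) + of_bool (y + 1 \<in> A) :: nat)"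
  proof -
    consider "y = x + 1" | "x = y + 1" | "y \<noteq> x + 1" "x \<noteq> y + 1" by blast
    then show ?thesis
    proof cases
      case 1
      then have "y + 1 = x + 2" by simp
      moreover have "x + 2 \<in> B" "x + 2 \<notin> A" using bead_rule_two by (auto simp: move_def movable_def)
      ultimately have "y + 1 \<in> B" "y + 1 \<notin> A" by metis+
      moreover have "x + 1 \<in> A" "x + 1 \<notin> C" using 1 bead_rule_two by (auto simp: move_def movable_def)
      ultimately show ?thesis by simp
    next
      case 2
      then have "x + 1 = y + 2" by simp
      moreover have "y + 2 \<in> C" "y + 2 \<notin> A" using bead_rule_two by (auto simp: move_def movable_def)
      ultimately have "x + 1 \<in> C" "x + 1 \<notin> A" by metis+
      moreover have "y + 1 \<in> A" "y + 1 \<notin> B" using 2 bead_rule_two by (auto simp: move_def movable_def)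
      ultimately show ?thesis by simp
    next
      case 3
      then have "y + 1 \<in> B \<longleftrightarrow> y + 1 \<in> A" "x + 1 \<in> C \<longleftrightarrow> x + 1 \<in> A"
        using bead_rule_two by (auto simp: move_def)
      then show ?thesis by simp
    qed
  qed
  ultimately show ?thesis using bead_rule_two by simp
next
  case (bead_rule_bump x z)
  then show ?thesis using bump_movable[OF bead_rule_bump(5,6)] by (simp add: vert_move)
qed auto

lemma step_eq_neqE:
  assumes "step_eq A B" "A \<noteq> B"
  obtains "movable A (pos A B)" "B = move A (pos A B)"
  using assms pos_move unfolding step_eq_def step_def by metis

section \<open>Order of two consecutive moves\<close>

lemma bead_rule_pos_cases:
  assumes "bead_rule 0 A B C G" "A \<noteq> B" "A \<noteq> C"
  obtains (two) "pos A B \<noteq> pos A C" "pos C G = pos A B" "pos B G = pos A C"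
  | (bump) "C = B" "bump A (pos A B) (pos B G)"
  using assms(1)
proof (cases rule: bead_rule.cases)
  case (bead_rule_two x y)
  have "G = move C x" using bead_rule_two move_commute by metis
  then have "pos A B = x" "pos A C = y" "pos C G = x" "pos B G = y"
    using bead_rule_two pos_move movable_two by metis+
  then show ?thesis using bead_rule_two two by metis
next
  case (bead_rule_bump x z)
  then have "pos A B = x" "pos B G = z" using pos_move bump_movable(1) by metis+
  then show ?thesis using bead_rule_bump bump by metis
qed (use assms(2,3) in auto)

text \<open>The bump of \<open>y\<close> cannot jump over the move at \<open>x\<close>: a run of
  beads stops at the gap left at \<open>x\<close>, a run of gaps at the bead that arrived at
  \<open>x + 2\<close>.\<close>

lemma move_bump_less_iff:
  assumes "movable A x" "movable A y" "x \<noteq> y" "bump (move A x) y z"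
  shows "x < z \<longleftrightarrow> x < y"
proof (cases "y + 1 \<in> move A x")
  case True
  then have *: "y < z" "\<And>w. y + 2 < w \<Longrightarrow> w < z + 2 \<Longrightarrow> w \<in> move A x"
    using assms(4) by (simp_all add: bump_def)
  have "z < x" if "y < x"
  proof -
    have "x \<noteq> y + 1" using True by (auto simp: move_def)
    moreover have "x \<noteq> y + 2" using assms(1,2) by (auto simp: movable_def)
    ultimately have "y + 2 < x" using that by linarith
    moreover have "x \<notin> move A x" by (simp add: move_def)
    ultimately have "z + 2 \<le> x" using *(2)[of x] by linarith
    then show ?thesis by simp
  qed
  then show ?thesis using *(1) assms(3) by linarith
next
  case False
  then have *: "z < y" "\<And>w. z < w \<Longrightarrow> w < y \<Longrightarrow> w \<notin> move A x"
    using assms(4) by (simp_all add: bump_def)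
  have x2: "x + 2 \<in> move A x" by (simp add: move_def)
  have "x < z" if "x < y"
  proof -
    have "x + 2 \<noteq> y + 1" using False x2 by metis
    moreover have "x + 2 \<noteq> y" using assms(1,2) by (auto simp: movable_def)
    ultimately have "x + 2 < y" using that by linarith
    then have "\<not> z < x + 2" using *(2)[of "x + 2"] x2 by blast
    then show ?thesis by simp
  qed
  then show ?thesis using *(1) assms(3) by linarith
qed

text \<open>No movable \<open>w\<close> lies strictly between \<open>x\<close> and \<open>z\<close>:
  in the vertical case \<open>w + 2\<close> would be a gap inside a run of beads, in the horizontal
  case \<open>w\<close> a bead inside a run of gaps.\<close>

lemma bump_move_less_iff:
  assumes "movable A x" "bump A x z" "movable (move A x) w" "w \<noteq> z"
  shows "z < w \<longleftrightarrow> x < w"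
proof (cases "x + 1 \<in> A")
  case True
  then have *: "x < z" "\<And>w. x + 2 < w \<Longrightarrow> w < z + 2 \<Longrightarrow> w \<in> A"
    using assms(2) by (simp_all add: bump_def)
  have "\<not> w < z" if "x < w"
  proof
    assume "w < z"
    then have "w + 2 \<in> A" using *(2)[of "w + 2"] that by simp
    then show False using assms(3) that by (simp add: movable_def move_def)
  qed
  then show ?thesis using *(1) assms(4) by linarith
next
  case False
  then have *: "z < x" "\<And>w. z < w \<Longrightarrow> w < x \<Longrightarrow> w \<notin> A"
    using assms(2) by (simp_all add: bump_def)
  have "\<not> w < x" if "z < w"
  proof
    assume "w < x"
    then have "w \<notin> A" using *(2)[of "w"] that by simp
    then show False using assms(3) \<open>w < x\<close> by (simp add: movable_def move_def)
  qed
  moreover have "w \<noteq> x" using assms(3) by (auto simp: movable_def move_def)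
  ultimately show ?thesis using *(1) assms(4) by linarith
qed

text \<open>Squares of two consecutive rows, in a column where both rows have already met their
  entry. The one-bump cases are the two preceding lemmas; if both squares bump, each comparison just
  reads the orientation of its domino, and this is preserved.\<close>

lemma bead_rule_pos_less_iff:
  assumes "bead_rule 0 A B A' B'" "bead_rule 0 B C B' C'" "A \<noteq> B" "B \<noteq> C"
  shows "pos A' B' < pos B' C' \<longleftrightarrow> pos A B < pos B C"
proof (cases "A = A'")
  case True
  then have "B' = B" using bead_rule_edge[OF bead_rule_swap[OF assms(1)]] by simp
  then have "C' = C" using bead_rule_edge[OF bead_rule_swap[OF assms(2)]] by simp
  then show ?thesis using True \<open>B' = B\<close> by simp
next
  case AA: False
  then have BB: "B \<noteq> B'" using bead_rule_edge[OF bead_rule_swap[OF assms(1)]] by simp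
  have x1: "movable A (pos A B)" "B = move A (pos A B)"
    and x2: "movable B (pos B C)" "C = move B (pos B C)"
    and y: "movable A (pos A A')"
    and z: "movable B (pos B B')"
    using step_eq_neqE bead_rule_step_eq assms AA BB by metis+
  show ?thesis
  proof (cases rule: bead_rule_pos_cases[OF assms(1,3) AA])
    case 1
    note one = 1
    show ?thesis
    proof (cases rule: bead_rule_pos_cases[OF assms(2,4) BB])
      case 1
      then show ?thesis using one by simp
    next
      case 2
      then show ?thesis using one move_bump_less_iff[OF x1(1) y] x1(2) by metis
    qed
  next
    case 2
    note one = 2
    show ?thesis
    proof (cases rule: bead_rule_pos_cases[OF assms(2,4) BB])
      case 1
      then show ?thesis
        using one bump_move_less_iff[OF x1(1), of "pos B B'" "pos B C"] x1(2) x2(1) by metis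
    next
      case 2
      then show ?thesis
        using one bump_less_iff(1) bump_movable(2)[OF x1(1)] x1(2) by metis
    qed
  qed
qed

text \<open>In the two lemmas below the nonzero entry of the upper (lower) of two consecutive rows
  is met in this column.\<close>

lemma bead_rule_pos_less_upper:
  assumes "bead_rule m A A A B'" "bead_rule 0 A C B' C'" "A \<noteq> C" "m \<noteq> 0"
  shows "pos A B' < pos B' C' \<longleftrightarrow> m < 0"
proof -
  have AB: "A \<noteq> B'" using bead_rule_edge[OF assms(1)] assms(4) by simp
  have z: "movable A (pos A B')" "B' = move A (pos A B')"
    and x: "movable A (pos A C)" "C = move A (pos A C)"
    using step_eq_neqE bead_rule_step_eq(3)[OF assms(1)] bead_rule_step_eq(1)[OF assms(2)] AB assms(3) by metis+
  have m: "(m = 1 \<and> top_bead A (pos A B')) \<or> (m = -1 \<and> bottom_gap A (pos A B' + 2))"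
    using assms(1)
  proof (cases rule: bead_rule.cases)
    case (bead_rule_top z)
    then show ?thesis using pos_move top_bead_movable by metis
  next
    case (bead_rule_bot z)
    then show ?thesis using pos_move bottom_gap_movable by metis
  qed (use assms(4) in auto)
  show ?thesis
  proof (cases rule: bead_rule_pos_cases[OF assms(2,3) AB])
    case 1
    have "pos A C \<le> pos A B'" if "m = 1"
      using m that x(1) by (force simp: top_bead_def movable_def)
    moreover have "\<not> pos A C + 2 < pos A B' + 2" if "m = -1"
      using m that x(1) by (auto simp: bottom_gap_def movable_def)
    ultimately show ?thesis using m 1 by auto
  next
    case 2
    have "pos A B' + 1 \<notin> A" if "m = 1"
      using m that by (simp add: top_bead_def)
    moreover have "pos A B' + 1 \<in> A" if "m = -1"
      using m that by (simp add: bottom_gap_def)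
    ultimately show ?thesis using bump_less_iff(1)[OF 2(2)] 2(1) m by auto
  qed
qed

lemma bead_rule_pos_less_lower:
  assumes "step A B" "bead_rule m B B B C" "m \<noteq> 0"
  shows "pos A B < pos B C \<longleftrightarrow> m > 0"
proof -
  obtain x where x: "movable A x" "B = move A x" using assms(1) step_def by blast
  have b: "x \<notin> B" "x + 2 \<in> B" using x(2) by (auto simp: move_def)
  have p: "pos A B = x" using x pos_move by simp
  show ?thesis
    using assms(2)
  proof (cases rule: bead_rule.cases)
    case (bead_rule_top z)
    then have "pos B C = z" "\<not> z < x + 2"
      using pos_move top_bead_movable b unfolding top_bead_def by metis+
    then show ?thesis using p bead_rule_top by simp
  next
    case (bead_rule_bot z)
    then have "pos B C = z" "\<not> x < z + 2"
      using pos_move bottom_gap_movable b unfolding bottom_gap_def by metis+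
    then show ?thesis using p bead_rule_bot by simp
  qed (use assms(3) in auto)
qed

section \<open>Growth diagrams of bead sets\<close>

definition signed_perm :: "nat \<Rightarrow> (nat \<Rightarrow> nat \<Rightarrow> int) \<Rightarrow> bool" where
  "signed_perm n m \<longleftrightarrow> (\<forall>i<n. \<forall>j<n. m i j \<in> {0,1,-1}) \<and>
     (\<forall>i<n. \<exists>!j. j < n \<and> m i j \<noteq> 0) \<and> (\<forall>j<n. \<exists>!i. i < n \<and> m i j \<noteq> 0)"

text \<open>Indices start at 0: \<open>X i j\<close> is the partition at corner (i + 1, j + 1), and
  \<open>m i j\<close> is the entry of the square having it as first corner.\<close>

definition grid :: "nat \<Rightarrow> (nat \<Rightarrow> nat \<Rightarrow> int) \<Rightarrow> int set \<Rightarrow> (nat \<Rightarrow> nat \<Rightarrow> int set) \<Rightarrow> bool" where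
  "grid n m S X \<longleftrightarrow> (\<forall>j\<le>n. X 0 j = S) \<and> (\<forall>i\<le>n. X i 0 = S) \<and>
     (\<forall>i<n. \<forall>j<n. bead_rule (m i j) (X i j) (X (Suc i) j) (X i (Suc j)) (X (Suc i) (Suc j)))"

lemma signed_perm_swap: "signed_perm n m \<Longrightarrow> signed_perm n (\<lambda>i j. m j i)"
  by (auto simp: signed_perm_def)

lemma grid_swap: "grid n m S X \<Longrightarrow> grid n (\<lambda>i j. m j i) S (\<lambda>i j. X j i)"
  by (auto simp: grid_def intro: bead_rule_swap)

lemma gridD:
  assumes "grid n m S X"
  shows "j \<le> n \<Longrightarrow> X 0 j = S" "i \<le> n \<Longrightarrow> X i 0 = S"
    "i < n \<Longrightarrow> j < n \<Longrightarrow> bead_rule (m i j) (X i j) (X (Suc i) j) (X i (Suc j)) (X (Suc i) (Suc j))"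
  using assms by (auto simp: grid_def)

lemma step_neq: "step A B \<Longrightarrow> A \<noteq> B"
  by (auto simp: step_def move_neq)

lemma bead_rule_values: "bead_rule m A B C G \<Longrightarrow> m \<in> {0,1,-1}"
  by (induction rule: bead_rule.induct) auto

lemma bead_rule_nonzero: "bead_rule m A B C G \<Longrightarrow> m \<noteq> 0 \<Longrightarrow> B = A \<and> C = A"
  by (induction rule: bead_rule.induct) auto

lemma grid_edge:
  assumes "grid n m S X" "i < n" "j \<le> n"
  shows "X i j \<noteq> X (Suc i) j \<longleftrightarrow> (\<exists>j'<j. m i j' \<noteq> 0)"
  using assms(3)
proof (induction j)
  case 0
  then show ?case using gridD(2)[OF assms(1)] assms(2) by simp
next
  case (Suc j)
  then show ?case using bead_rule_edge[OF gridD(3)[OF assms(1,2), of j]] by (auto simp: less_Suc_eq)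
qed

lemma grid_step_eq:
  assumes "grid n m S X" "i < n" "j \<le> n"
  shows "step_eq (X i j) (X (Suc i) j)"
proof (cases j)
  case 0
  then show ?thesis using gridD(2)[OF assms(1)] assms(2) by (simp add: step_eq_def)
next
  case (Suc k)
  then show ?thesis using bead_rule_step_eq(4)[OF gridD(3)[OF assms(1,2), of k]] assms(3) by simp
qed

lemma grid_step:
  assumes "grid n m S X" "signed_perm n m" "i < n"
  shows "step (X i n) (X (Suc i) n)"
  using grid_step_eq[OF assms(1,3) order.refl] grid_edge[OF assms(1,3) order.refl] assms(2,3)
  unfolding step_eq_def signed_perm_def by blast

section \<open>Filling a grid forwards and backwards\<close>

fun fill :: "(nat \<Rightarrow> nat \<Rightarrow> int) \<Rightarrow> int set \<Rightarrow> nat \<Rightarrow> nat \<Rightarrow> int set" where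
  "fill m S 0 j = S"
| "fill m S (Suc i) 0 = S"
| "fill m S (Suc i) (Suc j) =
     (SOME G. bead_rule (m i j) (fill m S i j) (fill m S (Suc i) j) (fill m S i (Suc j)) G)"

lemma fill_0 [simp]: "fill m S i 0 = S"
  by (cases i) auto

text \<open>The rule is solvable at a nonzero entry only if both incoming edges are trivial.
  Nontrivial edges come from earlier nonzero entries in the same row or column, of which a signed
  permutation has none, so every \<open>SOME\<close> in \<open>fill\<close> is a genuine
  choice.\<close>

lemma grid_exists:
  assumes "signed_perm n m" "maya S"
  shows "grid n m S (fill m S)"
proof -
  let ?X = "fill m S"
  let ?Q = "\<lambda>i j. step_eq (?X i j) (?X i (Suc j)) \<and>
     (?X i j \<noteq> ?X i (Suc j) \<longleftrightarrow> (\<exists>i'<i. m i' j \<noteq> 0))"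
  let ?sq = "\<lambda>i j. bead_rule (m i j) (?X i j) (?X (Suc i) j) (?X i (Suc j)) (?X (Suc i) (Suc j))"
  have row: "step_eq (?X i j) (?X (Suc i) j) \<and> (?X i j \<noteq> ?X (Suc i) j \<longleftrightarrow> (\<exists>j'<j. m i j' \<noteq> 0)) \<and>
       (\<forall>j'<j. ?sq i j')"
    if i: "i < n" and Q: "\<forall>j<n. ?Q i j" "\<forall>j\<le>n. maya (?X i j)" and "j \<le> n" for i j
    using \<open>j \<le> n\<close>
  proof (induction j)
    case 0
    then show ?case by (simp add: step_eq_def)
  next
    case (Suc j)
    have one: "?X (Suc i) j = ?X i j \<and> ?X i (Suc j) = ?X i j" if "m i j \<noteq> 0"
    proof -
      have "\<not> (\<exists>j'<j. m i j' \<noteq> 0)"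
        using that assms(1) i Suc.prems unfolding signed_perm_def
        by (metis Suc_le_lessD order.strict_trans order.strict_implies_not_eq)
      moreover have "\<not> (\<exists>i'<i. m i' j \<noteq> 0)"
        using that assms(1) i Suc.prems unfolding signed_perm_def
        by (metis Suc_le_lessD order.strict_trans order.strict_implies_not_eq)
      ultimately show ?thesis using Suc Q by (metis Suc_le_lessD Suc_leD)
    qed
    have "\<exists>G. bead_rule (m i j) (?X i j) (?X (Suc i) j) (?X i (Suc j)) G"
    proof (rule bead_rule_exists)
      show "m i j \<in> {0,1,-1}" using assms(1) i Suc.prems unfolding signed_perm_def by simp
    qed (use Suc Q one in auto)
    then have rule: "?sq i j" by simp (rule someI_ex)
    then show ?case using Suc bead_rule_step_eq(4)[OF rule] bead_rule_edge[OF rule] by (auto simp: less_Suc_eq)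
  qed
  have R: "(\<forall>j<n. ?Q i j) \<and> (\<forall>j\<le>n. maya (?X i j))" if "i \<le> n" for i
    using that
  proof (induction i)
    case 0
    then show ?case by (simp add: step_eq_def assms(2))
  next
    case (Suc i)
    then have r: "step_eq (?X i j) (?X (Suc i) j)" "\<And>j'. j' < j \<Longrightarrow> ?sq i j'" if "j \<le> n" for j
      using row[of i j] that by simp_all
    have "?Q (Suc i) j" if "j < n" for j
    proof -
      have rule: "?sq i j" using r(2)[of "Suc j" j] that by simp
      show ?thesis using bead_rule_step_eq(3)[OF rule] bead_rule_edge[OF bead_rule_swap[OF rule]] Suc that
        by (auto simp: less_Suc_eq simp del: fill.simps)
    qed
    moreover have "maya (?X (Suc i) j)" if "j \<le> n" for j
      using r(1)[OF that] Suc that maya_step_eq by (metis Suc_leD)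
    ultimately show ?case by blast
  qed
  have "?sq i j" if "i < n" "j < n" for i j
    using row[OF that(1), of "Suc j"] R[of i] that by simp
  then show ?thesis unfolding grid_def by (simp del: fill.simps(3))
qed

text \<open>The last row and column hold the two standard tableaux, so this is injectivity of the
  standard correspondence.\<close>

lemma grid_unique:
  assumes X: "grid n m S X" and X': "grid n m' S X'"
    and last: "\<And>k. k \<le> n \<Longrightarrow> X n k = X' n k" "\<And>k. k \<le> n \<Longrightarrow> X k n = X' k n"
  shows "i < n \<Longrightarrow> j < n \<Longrightarrow> m i j = m' i j"
proof -
  have bwd: "m i j = m' i j \<and> X i j = X' i j"
    if "i < n" "j < n" "X (Suc i) j = X' (Suc i) j" "X i (Suc j) = X' i (Suc j)"
      "X (Suc i) (Suc j) = X' (Suc i) (Suc j)" for i j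
    using bead_rule_back_unique gridD(3)[OF X that(1,2)] gridD(3)[OF X' that(1,2)] that(3-5) by metis
  have row: "X i j = X' i j" if "i < n" "j \<le> n" "\<And>j. j \<le> n \<Longrightarrow> X (Suc i) j = X' (Suc i) j" for i j
    using that(2)
  proof (induction rule: inc_induct)
    case base
    then show ?case using last(2) that(1) by simp
  next
    case (step j)
    then show ?case using bwd that by simp
  qed
  have "\<forall>j\<le>n. X i j = X' i j" if "i \<le> n" for i
    using that
  proof (induction rule: inc_induct)
    case base
    then show ?case using last(1) by simp
  next
    case (step i)
    then show ?case using row by simp
  qed
  then show "i < n \<Longrightarrow> j < n \<Longrightarrow> m i j = m' i j" using bwd by simp
qed

text \<open>Arguments are distances from the last corner: \<open>unfill n P Q a b\<close> belongs to
  the grid point \<open>(n - a, n - b)\<close>, which makes the backward recursion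
  structural.\<close>

fun unfill :: "nat \<Rightarrow> (nat \<Rightarrow> int set) \<Rightarrow> (nat \<Rightarrow> int set) \<Rightarrow> nat \<Rightarrow> nat \<Rightarrow> int set" where
  "unfill n P Q 0 b = P (n - b)"
| "unfill n P Q (Suc a) 0 = Q (n - Suc a)"
| "unfill n P Q (Suc a) (Suc b) =
     (SOME A. \<exists>m. bead_rule m A (unfill n P Q a (Suc b)) (unfill n P Q (Suc a) b) (unfill n P Q a b) \<and> maya A)"

text \<open>Surjectivity of the standard correspondence. Nothing prescribes the first row and column
  of the rebuilt grid; they are constant because they lead back from \<open>S\<close> by backward
  moves, and \<open>S\<close> admits none.\<close>

lemma grid_surj:
  assumes P: "P 0 = S" "\<And>k. k < n \<Longrightarrow> step (P k) (P (Suc k))"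
    and Q: "Q 0 = S" "\<And>k. k < n \<Longrightarrow> step (Q k) (Q (Suc k))"
    and PQ: "P n = Q n" and S: "maya S" "\<And>T. \<not> step T S"
  obtains m X where "signed_perm n m" "grid n m S X"
    "\<And>k. k \<le> n \<Longrightarrow> X n k = P k" "\<And>k. k \<le> n \<Longrightarrow> X k n = Q k"
proof -
  let ?U = "unfill n P Q"
  have mP: "maya (P k)" if "k \<le> n" for k
    using that
  proof (induction k)
    case (Suc k)
    then show ?case using P(2)[of k] maya_step_eq unfolding step_eq_def by (metis Suc_leD Suc_le_lessD)
  qed (use P S in simp)
  have mQ: "maya (Q k)" if "k \<le> n" for k
    using that
  proof (induction k)
    case (Suc k)
    then show ?case using Q(2)[of k] maya_step_eq unfolding step_eq_def by (metis Suc_leD Suc_le_lessD)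
  qed (use Q S in simp)
  let ?sq = "\<lambda>a b m. bead_rule m (?U (Suc a) (Suc b)) (?U a (Suc b)) (?U (Suc a) b) (?U a b)"
  have U0: "?U a 0 = Q (n - a)" for a using PQ by (cases a) auto
  have row: "step_eq (?U (Suc a) b) (?U a b) \<and> maya (?U (Suc a) b) \<and> (\<forall>b'<b. \<exists>m. ?sq a b' m)"
    if a: "a < n" and IH: "\<forall>b<n. step_eq (?U a (Suc b)) (?U a b)" "\<forall>b\<le>n. maya (?U a b)"
      and "b \<le> n" for a b
    using \<open>b \<le> n\<close>
  proof (induction b)
    case 0
    have "step (Q (n - Suc a)) (Q (n - a))" using Q(2)[of "n - Suc a"] a by (simp add: Suc_diff_Suc)
    then show ?case using mQ U0 by (simp add: step_eq_def)
  next
    case (Suc b)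
    have "\<exists>A m. bead_rule m A (?U a (Suc b)) (?U (Suc a) b) (?U a b) \<and> maya A"
      using bead_rule_back_exists[of "?U a b" "?U a (Suc b)" "?U (Suc a) b"] Suc IH by auto
    then have "\<exists>m. ?sq a b m \<and> maya (?U (Suc a) (Suc b))" by simp (rule someI_ex)
    then obtain m where m: "?sq a b m" "maya (?U (Suc a) (Suc b))" by blast
    then show ?case using Suc bead_rule_step_eq(1)[OF m(1)] by (auto simp: less_Suc_eq simp del: unfill.simps)
  qed
  have R: "(\<forall>b<n. step_eq (?U a (Suc b)) (?U a b)) \<and> (\<forall>b\<le>n. maya (?U a b))" if "a \<le> n" for a
    using that
  proof (induction a)
    case 0
    have "step (P (n - Suc b)) (P (n - b))" if "b < n" for b
      using P(2)[of "n - Suc b"] that by (simp add: Suc_diff_Suc)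
    then show ?case using mP by (simp add: step_eq_def)
  next
    case (Suc a)
    have r: "maya (?U (Suc a) b)" "\<And>b'. b' < b \<Longrightarrow> \<exists>m. ?sq a b' m" if "b \<le> n" for b
      using row[of a b] Suc that by simp_all
    have "step_eq (?U (Suc a) (Suc b)) (?U (Suc a) b)" if "b < n" for b
    proof -
      obtain m where m: "?sq a b m"
        using r(2)[of "Suc b" b] \<open>b < n\<close> by (auto simp del: unfill.simps)
      show ?thesis by (rule bead_rule_step_eq(2)[OF m])
    qed
    then show ?case using r(1) by blast
  qed
  have sqU: "\<exists>m. ?sq a b m" if "a < n" "b < n" for a b
    using row[of a "Suc b"] R[of a] that by simp
  define X where "X i j = ?U (n - i) (n - j)" for i j
  define m where "m i j = (SOME m. bead_rule m (X i j) (X (Suc i) j) (X i (Suc j)) (X (Suc i) (Suc j)))" for i j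
  have sqX: "bead_rule (m i j) (X i j) (X (Suc i) j) (X i (Suc j)) (X (Suc i) (Suc j))" if "i < n" "j < n" for i j
    unfolding m_def
  proof (rule someI_ex)
    show "\<exists>m. bead_rule m (X i j) (X (Suc i) j) (X i (Suc j)) (X (Suc i) (Suc j))"
      using sqU[of "n - Suc i" "n - Suc j"] that by (simp add: X_def Suc_diff_Suc del: unfill.simps)
  qed
  have last: "X n k = P k" "X k n = Q k" if "k \<le> n" for k
    using that U0 by (auto simp: X_def)
  have X0: "X i 0 = S" if "i \<le> n" for i
    using that
  proof (induction rule: inc_induct)
    case base
    then show ?case using last(1)[of 0] P by simp
  next
    case (step i)
    then have "step_eq (X i 0) (X (Suc i) 0)"
      using row[of "n - Suc i" n] R[of "n - Suc i"] by (simp add: X_def Suc_diff_Suc del: unfill.simps)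
    then show ?case using step S(2) by (simp add: step_eq_def)
  qed
  have X0': "X 0 j = S" if "j \<le> n" for j
    using that
  proof (induction rule: inc_induct)
    case base
    then show ?case using last(2)[of 0] Q by simp
  next
    case (step j)
    have "step_eq (?U n (Suc (n - Suc j))) (?U n (n - Suc j))"
      by (rule R[OF order.refl, THEN conjunct1, rule_format]) (use step(1,2) in linarith)
    then have "step_eq (X 0 j) (X 0 (Suc j))"
      using step by (simp add: X_def Suc_diff_Suc del: unfill.simps)
    then show ?case using step S(2) by (simp add: step_eq_def)
  qed
  have grid: "grid n m S X" using sqX X0 X0' by (simp add: grid_def)
  \<comment> \<open>A proper step at the end of a row needs an entry, and a second entry would need
    a trivial edge where the first has already made it nontrivial. Being stated for all
    \<open>m\<close> and \<open>X\<close>, this also applies to the transposed grid.\<close>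
  have un: "\<exists>!j. j < n \<and> m i j \<noteq> 0"
    if g: "grid n m S X" and i: "i < n" and st: "step (X i n) (X (Suc i) n)" for m X i
  proof -
    have "X i n \<noteq> X (Suc i) n" using step_neq[OF st] .
    then obtain j where j: "j < n" "m i j \<noteq> 0" using grid_edge[OF g i order.refl] by blast
    have lt: "False" if "j < j'" "j' < n" "m i j \<noteq> 0" "m i j' \<noteq> 0" for j j'
      using bead_rule_nonzero[OF gridD(3)[OF g i that(2)] that(4)] grid_edge[OF g i, of j'] that by auto
    show ?thesis using j lt by (metis linorder_neqE_nat)
  qed
  have "signed_perm n m"
    unfolding signed_perm_def
  proof (intro conjI allI impI)
    fix i j assume "i < n" "j < n"
    then show "m i j \<in> {0,1,-1}" using bead_rule_values sqX by blast
  next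
    fix i assume "i < n"
    then show "\<exists>!j. j < n \<and> m i j \<noteq> 0" using un[OF grid] last Q(2)[of i] by simp
  next
    fix j assume "j < n"
    then show "\<exists>!i. i < n \<and> m i j \<noteq> 0" using un[OF grid_swap[OF grid]] last P(2)[of j] by simp
  qed
  then show ?thesis using that grid last by blast
qed

text \<open>\<open>bead_rule_vert\<close> telescopes over all squares, and the constant first row
  and column contribute nothing.\<close>

lemma grid_vert:
  assumes "grid n m S X"
  shows "(\<Sum>k<n. vert (X n k) (X n (Suc k))) + (\<Sum>k<n. vert (X k n) (X (Suc k) n)) =
    (\<Sum>i<n. \<Sum>j<n. if m i j = -1 then 2 else 0)"
proof -
  have row: "(\<Sum>k<b. vert (X (Suc i) k) (X (Suc i) (Suc k))) + vert (X i b) (X (Suc i) b) =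
     (\<Sum>k<b. vert (X i k) (X i (Suc k))) + (\<Sum>j<b. if m i j = -1 then 2 else 0)"
    if "i < n" "b \<le> n" for i b
    using that(2)
  proof (induction b)
    case 0
    then show ?case using gridD(2)[OF assms] that(1) by simp
  next
    case (Suc b)
    then show ?case using bead_rule_vert[OF gridD(3)[OF assms that(1), of b]] by simp
  qed
  have "(\<Sum>k<n. vert (X a k) (X a (Suc k))) + (\<Sum>k<a. vert (X k n) (X (Suc k) n)) =
    (\<Sum>i<a. \<Sum>j<n. if m i j = -1 then 2 else 0)" if "a \<le> n" for a
    using that
  proof (induction a)
    case 0
    then show ?case using gridD(1)[OF assms] by simp
  next
    case (Suc a)
    then show ?case using row[of a n] by simp
  qed
  then show ?thesis by blast
qed

text \<open>The comparison is decided in column \<open>max a b\<close>, where the later of the two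
  rows meets its entry, and stays the same from there on. Correspondingly, the sign of the letter of
  larger absolute value decides the order of two letters.\<close>

lemma grid_descent:
  assumes X: "grid n m S X" and m: "signed_perm n m" and i: "Suc i < n"
    and a: "a < n" "m i a \<noteq> 0" and b: "b < n" "m (Suc i) b \<noteq> 0"
  shows "pos (X i n) (X (Suc i) n) < pos (X (Suc i) n) (X (Suc (Suc i)) n) \<longleftrightarrow>
     m i a * int (Suc a) < m (Suc i) b * int (Suc b)"
proof -
  have uniq: "j = a" if "m i j \<noteq> 0" "j < n" for j
    using m that a i unfolding signed_perm_def by (metis Suc_lessD)
  have uniq': "j = b" if "m (Suc i) j \<noteq> 0" "j < n" for j
    using m that b i unfolding signed_perm_def by metis
  have i': "i < n" using i by simp
  have "\<exists>!k. k < n \<and> m k a \<noteq> 0" using m a(1) by (simp add: signed_perm_def)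
  then have ab: "a \<noteq> b" using a b i i' by (metis n_not_Suc_n)
  have "m i a \<in> {0,1,-1}" "m (Suc i) b \<in> {0,1,-1}"
    using m a(1) b(1) i i' by (simp_all only: signed_perm_def)
  then have val: "m i a = 1 \<or> m i a = -1" "m (Suc i) b = 1 \<or> m (Suc i) b = -1"
    using a(2) b(2) by auto
  have edge: "X i j \<noteq> X (Suc i) j \<longleftrightarrow> a < j" "X (Suc i) j \<noteq> X (Suc (Suc i)) j \<longleftrightarrow> b < j" if "j \<le> n" for j
    using grid_edge[OF X i' that] grid_edge[OF X i that] uniq uniq' a b that
    by (metis order.strict_trans2)+
  let ?c = "max a b"
  have "pos (X i j) (X (Suc i) j) < pos (X (Suc i) j) (X (Suc (Suc i)) j) \<longleftrightarrow>
     m i a * int (Suc a) < m (Suc i) b * int (Suc b)" if "Suc ?c \<le> j" "j \<le> n" for j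
    using that
  proof (induction rule: dec_induct)
    case base
    show ?case
    proof (cases "a < b")
      case True
      have sq1: "bead_rule 0 (X i b) (X (Suc i) b) (X i (Suc b)) (X (Suc i) (Suc b))"
        using gridD(3)[OF X i' b(1)] uniq[of b] ab b(1) by (cases "m i b = 0") auto
      note sq2 = gridD(3)[OF X i b(1)]
      have e: "X (Suc (Suc i)) b = X (Suc i) b" "X (Suc i) (Suc b) = X (Suc i) b"
        using bead_rule_nonzero[OF sq2 b(2)] by auto
      have e': "X i (Suc b) = X i b" using bead_rule_edge[OF bead_rule_swap[OF sq1]] e by auto
      have "step (X i b) (X (Suc i) b)"
        using grid_step_eq[OF X i', of b] edge(1)[of b] True b by (simp add: step_eq_def)
      then have "pos (X i (Suc b)) (X (Suc i) (Suc b)) < pos (X (Suc i) (Suc b)) (X (Suc (Suc i)) (Suc b)) \<longleftrightarrow> m (Suc i) b > 0"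
        using bead_rule_pos_less_lower sq2 b(2) e e' by metis
      then show ?thesis using True val by (auto simp: max_def)
    next
      case False
      then have ba: "b < a" using ab by simp
      note sq1 = gridD(3)[OF X i' a(1)]
      have sq2: "bead_rule 0 (X (Suc i) a) (X (Suc (Suc i)) a) (X (Suc i) (Suc a)) (X (Suc (Suc i)) (Suc a))"
        using gridD(3)[OF X i a(1)] uniq'[of a] ab a(1) by (cases "m (Suc i) a = 0") auto
      have e: "X (Suc i) a = X i a" "X i (Suc a) = X i a"
        using bead_rule_nonzero[OF sq1 a(2)] by auto
      have "X (Suc i) a \<noteq> X (Suc (Suc i)) a" using edge(2)[of a] ba a by simp
      then have "pos (X i (Suc a)) (X (Suc i) (Suc a)) < pos (X (Suc i) (Suc a)) (X (Suc (Suc i)) (Suc a)) \<longleftrightarrow> m i a < 0"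
        using bead_rule_pos_less_upper sq1 sq2 a(2) e by metis
      then show ?thesis using ba val by (auto simp: max_def)
    qed
  next
    case (step j)
    have "bead_rule 0 (X i j) (X (Suc i) j) (X i (Suc j)) (X (Suc i) (Suc j))"
      using gridD(3)[OF X i', of j] uniq[of j] step by (cases "m i j = 0") auto
    moreover have "bead_rule 0 (X (Suc i) j) (X (Suc (Suc i)) j) (X (Suc i) (Suc j)) (X (Suc (Suc i)) (Suc j))"
      using gridD(3)[OF X i, of j] uniq'[of j] step by (cases "m (Suc i) j = 0") auto
    moreover have "X i j \<noteq> X (Suc i) j" "X (Suc i) j \<noteq> X (Suc (Suc i)) j"
      using edge[of j] step by auto
    ultimately show ?case using bead_rule_pos_less_iff step by (metis Suc_leD)
  qed
  then show ?thesis using a b by simp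
qed

section \<open>Bead sets and partitions\<close>

definition beads_above :: "int set \<Rightarrow> int \<Rightarrow> int" where
  "beads_above S x = int (card {w \<in> S. x < w})"

text \<open>Normalises the charge: there are as many beads to the right of 0 as gaps at or left of
  0. This removes the freedom of shifting a bead set and is what makes \<open>shape_of\<close>
  injective.\<close>

definition balanced :: "int set \<Rightarrow> bool" where
  "balanced S \<longleftrightarrow> maya S \<and> (\<exists>N. \<forall>x\<le>N. beads_above S x = - x)"

text \<open>Extend a partition by all cells in rows or columns \<open>\<le> 0\<close>. If \<open>S\<close> is its (balanced) bead set, then
  \<open>beads_above S x\<close> is the last row in which the diagonal \<open>x\<close> is inside.\<close>

definition shape_of :: "int set \<Rightarrow> shape" where
  "shape_of S = {(k,l). 1 \<le> k \<and> 1 \<le> l \<and> int k \<le> beads_above S (int l - int k)}"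

text \<open>The first cell outside the shape on diagonal \<open>x\<close>. For balanced sets both
  arguments of \<open>nat\<close> are positive, by \<open>beads_above_ge\<close>.\<close>

definition new_cell :: "int set \<Rightarrow> int \<Rightarrow> cell" where
  "new_cell S x = (nat (beads_above S x + 1), nat (beads_above S x + 1 + x))"

definition new_domino :: "int set \<Rightarrow> int \<Rightarrow> cell set" where
  "new_domino S x = {new_cell S x, new_cell S (x + 1)}"

definition content :: "cell \<Rightarrow> int" where
  "content c = int (snd c) - int (fst c)"

lemma beads_above_nonneg [simp]: "0 \<le> beads_above S x"
  by (simp add: beads_above_def)

lemma finite_above: assumes "maya S" shows "finite {w \<in> S. x < w}"
proof -
  obtain N where "\<And>x. x \<ge> N \<Longrightarrow> x \<notin> S" using mayaE[OF assms] by metis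
  then have "w < N" if "w \<in> S" for w using that by (metis not_le)
  then have "{w \<in> S. x < w} \<subseteq> {x<..<N}" by auto
  then show ?thesis by (rule finite_subset) simp
qed

lemma beads_above_pred: assumes "maya S" shows "beads_above S (x - 1) = beads_above S x + of_bool (x \<in> S)"
proof -
  have "{w \<in> S. x - 1 < w} = (if x \<in> S then insert x {w \<in> S. x < w} else {w \<in> S. x < w})"
    by auto (metis linorder_neqE not_less zle_diff1_eq)+
  then show ?thesis using finite_above[OF assms] by (simp add: beads_above_def)
qed

lemma beads_above_add1: "maya S \<Longrightarrow> beads_above S x = beads_above S (x + 1) + of_bool (x + 1 \<in> S)"
  using beads_above_pred[of S "x + 1"] by simp

lemma beads_above_add2: "maya S \<Longrightarrow> beads_above S (x + 1) = beads_above S (x + 2) + of_bool (x + 2 \<in> S)"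
  using beads_above_add1[of S "x + 1"] by (simp add: add.assoc)

lemma beads_above_mono: "maya S \<Longrightarrow> x \<le> y \<Longrightarrow> beads_above S y \<le> beads_above S x"
  unfolding beads_above_def by (intro zle_int[THEN iffD2] card_mono finite_above) auto

lemma beads_above_diff_le: assumes "maya S" "x \<le> y" shows "beads_above S x \<le> beads_above S y + (y - x)"
  using assms(2)
proof (induction y rule: int_ge_induct)
  case (step y)
  then show ?case using beads_above_add1[OF assms(1), of y] by (simp add: of_bool_def split: if_splits)
qed simp

lemma beads_above_beads:
  assumes "maya S" "x \<le> y" "\<And>w. x < w \<Longrightarrow> w \<le> y \<Longrightarrow> w \<in> S"
  shows "beads_above S x = beads_above S y + (y - x)"
  using assms(2,3)
proof (induction y rule: int_ge_induct)
  case (step y)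
  then show ?case using beads_above_add1[OF assms(1), of y] by simp
qed simp

lemma beads_above_gaps:
  assumes "x \<le> y" "\<And>w. x < w \<Longrightarrow> w \<le> y \<Longrightarrow> w \<notin> S"
  shows "beads_above S x = beads_above S y"
proof -
  have "{w \<in> S. x < w} = {w \<in> S. y < w}" using assms by force
  then show ?thesis by (simp add: beads_above_def)
qed

lemma beads_above_move:
  assumes "maya S" "movable S x"
  shows "beads_above (move S x) z = beads_above S z + of_bool (z = x \<or> z = x + 1)"
proof -
  note fin = finite_above[OF assms(1), of z]
  have x: "x \<in> S" "x + 2 \<notin> S" using assms(2) by (auto simp: movable_def)
  consider "z < x" | "z = x \<or> z = x + 1" | "x + 2 \<le> z" by linarith
  then show ?thesis
  proof cases
    case 1
    then have "{w \<in> move S x. z < w} = insert (x + 2) ({w \<in> S. z < w} - {x})"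
      by (auto simp: move_def)
    moreover have "card ({w \<in> S. z < w} - {x}) + 1 = card {w \<in> S. z < w}"
      using card.remove[OF fin, of x] 1 x by simp
    ultimately show ?thesis using 1 x fin by (simp add: beads_above_def)
  next
    case 2
    then have "{w \<in> move S x. z < w} = insert (x + 2) {w \<in> S. z < w}"
      by (auto simp: move_def)
    then show ?thesis using 2 x fin by (simp add: beads_above_def)
  next
    case 3
    then have "{w \<in> move S x. z < w} = {w \<in> S. z < w}"
      by (auto simp: move_def)
    then show ?thesis using 3 by (simp add: beads_above_def)
  qed
qed

lemma balanced_maya: "balanced S \<Longrightarrow> maya S"
  by (simp add: balanced_def)

lemma balanced_move: assumes "balanced S" "movable S x" shows "balanced (move S x)"
proof -
  obtain N where N: "\<forall>x\<le>N. beads_above S x = - x" using assms(1) balanced_def by blast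
  have "\<forall>y\<le>min N (x - 1). beads_above (move S x) y = - y"
    using N beads_above_move[OF balanced_maya[OF assms(1)] assms(2)] by simp
  then show ?thesis using maya_move balanced_maya[OF assms(1)] unfolding balanced_def by blast
qed

lemma balanced_step_eq: "balanced A \<Longrightarrow> step_eq A B \<Longrightarrow> balanced B"
  by (auto simp: step_eq_def step_def balanced_move)

lemma beads_above_ge: assumes "balanced S" shows "- x \<le> beads_above S x"
proof -
  obtain N where N: "\<forall>x\<le>N. beads_above S x = - x" using assms(1) balanced_def by blast
  show ?thesis
  proof (cases "x \<le> N")
    case False
    then have "beads_above S N \<le> beads_above S x + (x - N)" using beads_above_diff_le[OF balanced_maya[OF assms]] by simp
    then show ?thesis using N by simp
  qed (use N in simp)
qed

lemma bead_iff: "maya S \<Longrightarrow> x \<in> S \<longleftrightarrow> beads_above S (x - 1) = beads_above S x + 1"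
  using beads_above_pred[of S x] by simp

lemma shape_of_inject:
  assumes "balanced S" "balanced T" "shape_of S = shape_of T"
  shows "S = T"
proof -
  have le: "beads_above T x \<le> beads_above S x" if b: "balanced S" "balanced T" and e: "shape_of S = shape_of T" for S T x
  proof (rule ccontr)
    assume "\<not> ?thesis"
    then have less: "beads_above S x < beads_above T x" by simp
    \<comment> \<open>\<open>(k, l)\<close> is the last cell of \<open>shape_of T\<close> on
      diagonal \<open>x\<close>.\<close>
    define k where "k = nat (beads_above T x)"
    define l where "l = nat (beads_above T x + x)"
    have k: "int k = beads_above T x" by (simp add: k_def)
    have l: "int l = beads_above T x + x" "l \<ge> 1" using less beads_above_ge[OF b(1), of x] by (auto simp: l_def)
    have "k \<ge> 1" using less k beads_above_nonneg[of S x] by linarith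
    then have "(k,l) \<in> shape_of T" "(k,l) \<notin> shape_of S" using k l less by (auto simp: shape_of_def)
    then show False using e by simp
  qed
  have "beads_above S x = beads_above T x" for x
    using le[OF assms, of x] le[OF assms(2,1) assms(3)[symmetric], of x] by (rule antisym[rotated])
  then have "x \<in> S \<longleftrightarrow> x \<in> T" for x
    using bead_iff[of S x] bead_iff[of T x] balanced_maya assms(1,2) by simp
  then show ?thesis by blast
qed

text \<open>\<open>beads_above\<close> decreases along the diagonals, and by at most one per step.
  Passing to a cell further up and left either lowers the diagonal, which only helps, or raises it
  by at most the number of rows gained.\<close>

lemma partition_shape_of: assumes "balanced S" shows "is_partition (shape_of S)"
proof -
  have m: "maya S" by (rule balanced_maya[OF assms])
  obtain N where N: "\<forall>x\<le>N. beads_above S x = - x" using assms(1) balanced_def by blast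
  obtain M where M: "\<And>x. x \<ge> M \<Longrightarrow> x \<notin> S" using mayaE[OF m] by metis
  have M0: "beads_above S x = 0" if "x \<ge> M" for x
  proof -
    have e: "{w \<in> S. x < w} = {}" using M that by (metis (mono_tags, lifting) Collect_empty_eq order.trans order.strict_implies_order)
    show ?thesis by (simp only: beads_above_def e card.empty of_nat_0)
  qed
  have bound: "int k \<le> - N \<and> int l \<le> M - N" if "(k,l) \<in> shape_of S" for k l
  proof -
    have kl: "1 \<le> k" "1 \<le> l" "int k \<le> beads_above S (int l - int k)" using that by (auto simp: shape_of_def)
    have 1: "\<not> int l - int k \<le> N"
    proof
      assume "int l - int k \<le> N"
      then have "beads_above S (int l - int k) = int k - int l" using N by simp
      then show False using kl by linarith
    qed
    have 2: "\<not> int l - int k \<ge> M" using M0 kl by fastforce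
    have "beads_above S (int l - int k) \<le> - N" using beads_above_mono[OF m, of N "int l - int k"] 1 N by simp
    then show ?thesis using kl 2 by linarith
  qed
  have "shape_of S \<subseteq> {..nat (- N)} \<times> {..nat (M - N)}"
    using bound by (force simp: le_nat_iff)
  then have "finite (shape_of S)" by (rule finite_subset) simp
  moreover have "(k', l') \<in> shape_of S"
    if kl: "(k,l) \<in> shape_of S" "1 \<le> k'" "k' \<le> k" "1 \<le> l'" "l' \<le> l" for k l k' l'
  proof (cases "int l' - int k' \<le> int l - int k")
    case True
    then show ?thesis using beads_above_mono[OF m True] kl by (auto simp: shape_of_def)
  next
    case False
    then show ?thesis using beads_above_diff_le[OF m, of "int l - int k" "int l' - int k'"] kl
      by (auto simp: shape_of_def)
  qed
  moreover have "1 \<le> k \<and> 1 \<le> l" if "(k,l) \<in> shape_of S" for k l using that by (simp add: shape_of_def)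
  ultimately show ?thesis unfolding is_partition_def by blast
qed

lemma new_cell_eq_iff: "balanced S \<Longrightarrow> new_cell S x = (k,l) \<longleftrightarrow> int k = beads_above S x + 1 \<and> int l = beads_above S x + 1 + x"
  using beads_above_ge[of S x] beads_above_nonneg[of S x] unfolding new_cell_def by auto

lemma content_new_cell: "balanced S \<Longrightarrow> content (new_cell S x) = x"
  using beads_above_ge[of S x] beads_above_nonneg[of S x] by (simp add: content_def new_cell_def)

section \<open>Dominoes as bead moves\<close>

lemma shape_of_move:
  assumes "balanced S" "movable S x"
  shows "shape_of (move S x) = shape_of S \<union> new_domino S x"
proof -
  have cm: "beads_above (move S x) z = beads_above S z + of_bool (z = x \<or> z = x + 1)" for z
    using beads_above_move[OF balanced_maya[OF assms(1)] assms(2)] .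
  have "(k,l) \<in> shape_of (move S x) \<longleftrightarrow> (k,l) \<in> shape_of S \<or> (k,l) = new_cell S x \<or> (k,l) = new_cell S (x + 1)" for k l
  proof -
    have nc: "(k,l) = new_cell S z \<longleftrightarrow> 1 \<le> k \<and> 1 \<le> l \<and> z = int l - int k \<and> int k = beads_above S z + 1" for z
      unfolding eq_commute[of "(k,l)"] new_cell_eq_iff[OF assms(1)]
      using beads_above_ge[OF assms(1), of z] beads_above_nonneg[of S z]
      by (intro iffI conjI; elim conjE; linarith)
    define z where "z = int l - int k"
    have "int k \<le> beads_above (move S x) z \<longleftrightarrow>
        int k \<le> beads_above S z \<or> (x = z \<and> int k = beads_above S x + 1) \<or> (x + 1 = z \<and> int k = beads_above S (x + 1) + 1)"
    proof -
      consider "z = x" | "z = x + 1" | "z \<noteq> x" "z \<noteq> x + 1" by blast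
      then show ?thesis
      proof cases
        case 1
        then show ?thesis unfolding cm by (simp, linarith)
      next
        case 2
        then show ?thesis unfolding cm by (simp, linarith)
      qed (simp add: cm)
    qed
    then show ?thesis unfolding nc shape_of_def mem_Collect_eq case_prod_conv z_def by blast
  qed
  then show ?thesis unfolding new_domino_def by auto
qed

lemma new_cell_notin: assumes "balanced S" shows "new_cell S x \<notin> shape_of S"
proof -
  obtain k l where kl: "new_cell S x = (k,l)" by fastforce
  then have "int k = beads_above S x + 1" "int l - int k = x" using new_cell_eq_iff[OF assms] by auto
  then show ?thesis unfolding kl by (simp add: shape_of_def)
qed

lemma new_domino_disjoint: "balanced S \<Longrightarrow> shape_of S \<inter> new_domino S x = {}"
  unfolding new_domino_def using new_cell_notin by auto

lemma shape_of_step_diff: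
  assumes "balanced S" "movable S x"
  shows "shape_of (move S x) - shape_of S = new_domino S x"
  using shape_of_move[OF assms] new_domino_disjoint[OF assms(1), of x] by auto

lemma content_new_domino: "balanced S \<Longrightarrow> c \<in> new_domino S x \<Longrightarrow> content c = x \<or> content c = x + 1"
  by (auto simp: new_domino_def content_new_cell)

lemma new_domino_vertical:
  assumes "balanced S" "x + 1 \<in> S"
  obtains k l where "new_domino S x = {(k,l), (Suc k, l)}" "int k = beads_above S x" "int l = beads_above S x + 1 + x"
    "new_cell S x = (Suc k, l)" "new_cell S (x + 1) = (k, l)"
proof -
  obtain k l where kl: "new_cell S (x + 1) = (k,l)" by fastforce
  then have "new_cell S x = (Suc k, l)"
    using assms(2) beads_above_add1[OF balanced_maya[OF assms(1)], of x] by (simp add: new_cell_eq_iff[OF assms(1)])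
  then show ?thesis using that kl by (auto simp: new_domino_def new_cell_eq_iff[OF assms(1)])
qed

lemma new_domino_horizontal:
  assumes "balanced S" "x + 1 \<notin> S"
  obtains k l where "new_domino S x = {(k,l), (k, Suc l)}" "int k = beads_above S x + 1" "int l = beads_above S x + 1 + x"
    "new_cell S x = (k, l)" "new_cell S (x + 1) = (k, Suc l)"
proof -
  obtain k l where kl: "new_cell S x = (k,l)" by fastforce
  then have "new_cell S (x + 1) = (k, Suc l)"
    using assms(2) beads_above_add1[OF balanced_maya[OF assms(1)], of x] by (simp add: new_cell_eq_iff[OF assms(1)])
  then show ?thesis using that kl by (auto simp: new_domino_def new_cell_eq_iff[OF assms(1)])
qed

lemma not_vertical_and_horizontal: "vertical D \<Longrightarrow> horizontal D \<Longrightarrow> False"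
  unfolding vertical_def horizontal_def by (auto simp: doubleton_eq_iff)

lemma vertical_new_domino_iff: assumes "balanced S" shows "vertical (new_domino S x) \<longleftrightarrow> x + 1 \<in> S"
proof (cases "x + 1 \<in> S")
  case True
  then show ?thesis by (rule new_domino_vertical[OF assms]) (auto simp: vertical_def True)
next
  case False
  then have "horizontal (new_domino S x)" by (rule new_domino_horizontal[OF assms]) (auto simp: horizontal_def)
  then show ?thesis using False not_vertical_and_horizontal by blast
qed

lemma horizontal_new_domino_iff: assumes "balanced S" shows "horizontal (new_domino S x) \<longleftrightarrow> x + 1 \<notin> S"
proof (cases "x + 1 \<in> S")
  case False
  then show ?thesis by (rule new_domino_horizontal[OF assms]) (auto simp: horizontal_def False)
next
  case True
  then have "vertical (new_domino S x)" by (rule new_domino_vertical[OF assms]) (auto simp: vertical_def)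
  then show ?thesis using True not_vertical_and_horizontal by blast
qed

lemma domino_new_domino: "balanced S \<Longrightarrow> domino (new_domino S x)"
  unfolding domino_def by (simp add: vertical_new_domino_iff horizontal_new_domino_iff)

lemma partition_closed:
  "is_partition lam \<Longrightarrow> (k,l) \<in> lam \<Longrightarrow> 1 \<le> k' \<Longrightarrow> k' \<le> k \<Longrightarrow> 1 \<le> l' \<Longrightarrow> l' \<le> l \<Longrightarrow> (k',l') \<in> lam"
  unfolding is_partition_def by blast

lemma partition_pos: "is_partition lam \<Longrightarrow> (k,l) \<in> lam \<Longrightarrow> 1 \<le> k \<and> 1 \<le> l"
  unfolding is_partition_def by blast

text \<open>Every domino extension of a shape is a bead move. The cell above the upper right end of
  the domino and the cell left of its lower left end already belong to the shape, unless they fall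
  outside the quadrant; together with the domino being new this pins down \<open>beads_above\<close>
  around it.\<close>

lemma domino_step:
  assumes S: "balanced S" and mu: "is_partition mu" "shape_of S \<subseteq> mu" "domino (mu - shape_of S)"
  obtains x where "movable S x" "mu = shape_of (move S x)"
proof -
  have m: "maya S" by (rule balanced_maya[OF S])
  have fin: "mu = shape_of (move S x)" if "movable S x" "mu - shape_of S = new_domino S x" for x
    using shape_of_move[OF S that(1)] that(2) mu(2) by auto
  from mu(3) consider k l where "mu - shape_of S = {(k,l), (k, Suc l)}" | k l where "mu - shape_of S = {(k,l), (Suc k, l)}"
    unfolding domino_def vertical_def horizontal_def by blast
  then show ?thesis
  proof cases
    case (1 k l)
    then have kl: "(k,l) \<in> mu" "(k,Suc l) \<in> mu" "(k,l) \<notin> shape_of S" by auto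
    then have p: "1 \<le> k" "1 \<le> l" using partition_pos[OF mu(1)] by auto
    define x where "x = int l - int k"
    have c0: "beads_above S x \<le> int k - 1" using kl(3) p by (auto simp: shape_of_def x_def)
    have c2: "int k - 1 \<le> beads_above S (x + 2)"
    proof (cases "k = 1")
      case False
      then have "(k - 1, Suc l) \<in> mu" using partition_closed[OF mu(1) kl(2)] p by simp
      moreover have "(k - 1, Suc l) \<notin> mu - shape_of S" using 1 p by auto
      ultimately have "(k - 1, Suc l) \<in> shape_of S" by blast
      then show ?thesis using p by (simp add: shape_of_def x_def of_nat_diff algebra_simps)
    qed simp
    have c1: "int k \<le> beads_above S (x - 1)"
    proof (cases "l = 1")
      case True
      then show ?thesis using beads_above_ge[OF S, of "x - 1"] by (simp add: x_def)
    next
      case False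
      then have "(k, l - 1) \<in> mu" using partition_closed[OF mu(1) kl(1)] p by simp
      moreover have "(k, l - 1) \<notin> mu - shape_of S" using 1 p by auto
      ultimately have "(k, l - 1) \<in> shape_of S" by blast
      then show ?thesis using p by (simp add: shape_of_def x_def of_nat_diff algebra_simps)
    qed
    have e: "beads_above S x = int k - 1" "beads_above S (x + 1) = int k - 1" "beads_above S (x + 2) = int k - 1"
      using c0 c2 beads_above_mono[OF m, of x "x + 1"] beads_above_mono[OF m, of "x + 1" "x + 2"] by simp_all
    have "x \<in> S" using beads_above_pred[OF m, of x] c1 e by (auto simp: of_bool_def split: if_splits)
    moreover have "x + 2 \<notin> S" using beads_above_add2[OF m, of x] e by (auto simp: of_bool_def split: if_splits)
    ultimately have mv: "movable S x" by (simp add: movable_def)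
    have "new_cell S x = (k,l)" "new_cell S (x + 1) = (k, Suc l)"
      using e by (simp_all add: new_cell_eq_iff[OF S] x_def)
    then show ?thesis using that[OF mv] fin[OF mv] 1 by (simp add: new_domino_def)
  next
    case (2 k l)
    then have kl: "(k,l) \<in> mu" "(Suc k,l) \<in> mu" "(k,l) \<notin> shape_of S" "(Suc k,l) \<notin> shape_of S" by auto
    then have p: "1 \<le> k" "1 \<le> l" using partition_pos[OF mu(1)] by auto
    \<comment> \<open>The smaller diagonal of a vertical domino is that of its lower cell
      \<open>(Suc k, l)\<close>.\<close>
    define x where "x = int l - int k - 1"
    have x1: "int l - int k = x + 1" "int l - int (Suc k) = x" by (auto simp: x_def)
    have c0: "beads_above S (x + 1) \<le> int k - 1" "beads_above S x \<le> int k"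
      using kl(3,4) p x1 by (auto simp: shape_of_def)
    have c2: "int k - 1 \<le> beads_above S (x + 2)"
    proof (cases "k = 1")
      case False
      then have "(k - 1, l) \<in> mu" using partition_closed[OF mu(1) kl(2)] p by simp
      moreover have "(k - 1, l) \<notin> mu - shape_of S" using 2 p by auto
      ultimately have "(k - 1, l) \<in> shape_of S" by blast
      then show ?thesis using p by (simp add: shape_of_def x_def of_nat_diff algebra_simps)
    qed simp
    have c1: "int k + 1 \<le> beads_above S (x - 1)"
    proof (cases "l = 1")
      case True
      then show ?thesis using beads_above_ge[OF S, of "x - 1"] by (simp add: x_def)
    next
      case False
      then have "(Suc k, l - 1) \<in> mu" using partition_closed[OF mu(1) kl(2)] p by simp
      moreover have "(Suc k, l - 1) \<notin> mu - shape_of S" using 2 p by auto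
      ultimately have "(Suc k, l - 1) \<in> shape_of S" by blast
      then show ?thesis using p by (simp add: shape_of_def x_def of_nat_diff algebra_simps)
    qed
    have e: "beads_above S (x + 1) = int k - 1" "beads_above S (x + 2) = int k - 1"
      using c0 c2 beads_above_mono[OF m, of "x + 1" "x + 2"] by simp_all
    have x: "x \<in> S \<and> beads_above S x = int k"
      using beads_above_pred[OF m, of x] c1 c0 by (auto simp: of_bool_def split: if_splits)
    moreover have "x + 2 \<notin> S" using beads_above_add2[OF m, of x] e by (auto simp: of_bool_def split: if_splits)
    ultimately have mv: "movable S x" by (simp add: movable_def)
    have "new_cell S (x + 1) = (k,l)" "new_cell S x = (Suc k, l)"
      using e x by (simp_all add: new_cell_eq_iff[OF S] x_def)
    then show ?thesis using that[OF mv] fin[OF mv] 2 by (simp add: new_domino_def insert_commute)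
  qed
qed

text \<open>The rows r, r - 1, ..., 1 of \<open>delta r\<close> give the beads r, r - 2, ..., 2 - r,
  and the empty rows give all positions up to -r.\<close>

definition core :: "nat \<Rightarrow> int set" where
  "core r = {x. x \<le> - int r \<or> (x \<le> int r \<and> even (x - int r))}"

lemma beads_above_eq_0: assumes "\<And>w. x < w \<Longrightarrow> w \<notin> S" shows "beads_above S x = 0"
proof -
  have "{w \<in> S. x < w} = {}" using assms by blast
  then show ?thesis by (simp only: beads_above_def card.empty of_nat_0)
qed

lemma beads_above_eqI:
  assumes "maya S" "\<And>x. x \<ge> N \<Longrightarrow> x \<notin> S" "\<And>x. x \<ge> N \<Longrightarrow> e x = 0"
    "\<And>x. e (x - 1) = e x + of_bool (x \<in> S)"
  shows "beads_above S x = e x"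
proof (cases "x \<ge> N")
  case True
  then show ?thesis using assms(3) beads_above_eq_0[of x S] assms(2) by simp
next
  case False
  then have "x \<le> N" by simp
  then show ?thesis
  proof (induction x rule: int_le_induct)
    case base
    show ?case using assms(3) beads_above_eq_0[of N S] assms(2) by simp
  next
    case (step x)
    then show ?case using beads_above_pred[OF assms(1), of x] assms(4)[of x] by simp
  qed
qed

lemma maya_core: "maya (core r)"
  unfolding maya_def core_def by (intro conjI exI[of _ "int r + 1"] exI[of _ "- int r"]) auto

lemma beads_above_core:
  "beads_above (core r) x = (if x \<le> - int r then - x else if x \<le> int r then (int r + 1 - x) div 2 else 0)"
proof (rule beads_above_eqI[OF maya_core, of "int r + 1"])
  show "(if x - 1 \<le> - int r then - (x - 1) else if x - 1 \<le> int r then (int r + 1 - (x - 1)) div 2 else 0) =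
    (if x \<le> - int r then - x else if x \<le> int r then (int r + 1 - x) div 2 else 0) + of_bool (x \<in> core r)" for x
  proof -
    consider "x \<le> - int r" | "x = 1 - int r" "- int r < x" | "1 - int r < x" "x \<le> int r" | "int r < x" "1 - int r < x"
      by linarith
    then show ?thesis
    proof cases
      case 2
      then have "x \<in> core r \<longleftrightarrow> False" unfolding core_def by simp
      then show ?thesis using 2 by simp
    next
      case 3
      have "(a + 1) div 2 = a div 2 + of_bool (odd a)" for a :: int
        by (cases "even a") auto
      from this[of "int r + 1 - x"] have "(int r + 1 - (x - 1)) div 2 = (int r + 1 - x) div 2 + of_bool (even (x - int r))"
        by (simp add: algebra_simps)
      then show ?thesis using 3 unfolding core_def by simp
    qed (auto simp: core_def)
  qed
qed (auto simp: core_def)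

lemma balanced_core: "balanced (core r)"
  unfolding balanced_def using maya_core by (auto simp: beads_above_core intro!: exI[of _ "- int r"])

lemma shape_of_core: "shape_of (core r) = delta r"
proof -
  have "(1 \<le> k \<and> 1 \<le> l \<and> int k \<le> beads_above (core r) (int l - int k)) \<longleftrightarrow> (1 \<le> k \<and> 1 \<le> l \<and> k + l \<le> r + 1)" for k l
  proof -
    consider "int l - int k \<le> - int r" | "- int r < int l - int k" "int l - int k \<le> int r" | "int r < int l - int k"
      by linarith
    then show ?thesis
    proof cases
      case 2
      have "int k \<le> a div 2 \<longleftrightarrow> 2 * int k \<le> a" for a by linarith
      then show ?thesis unfolding beads_above_core using 2 by auto
    qed (auto simp: beads_above_core)
  qed
  then show ?thesis unfolding shape_of_def delta_def by simp
qed

text \<open>Every bead of the core has another bead two places to its left, so none can move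
  back.\<close>

lemma no_step_core: "\<not> step T (core r)"
  unfolding step_back by (auto simp: core_def)

lemma is_2core_delta: "is_2core (delta r)"
proof -
  have "\<not> is_partition (delta r - D)" if D: "domino D" "D \<subseteq> delta r" for D
  proof
    assume p: "is_partition (delta r - D)"
    from D(1) consider k l where "D = {(k,l), (k, Suc l)}" | k l where "D = {(k,l), (Suc k, l)}"
      unfolding domino_def vertical_def horizontal_def by blast
    then show False
    proof cases
      case (1 k l)
      then have "(Suc k, l) \<in> delta r - D" "1 \<le> k" "1 \<le> l" using D(2) by (auto simp: delta_def)
      then show ?thesis using partition_closed[OF p, of "Suc k" l k l] 1 by auto
    next
      case (2 k l)
      then have "(k, Suc l) \<in> delta r - D" "1 \<le> k" "1 \<le> l" using D(2) by (auto simp: delta_def)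
      then show ?thesis using partition_closed[OF p, of k "Suc l" k l] 2 by auto
    qed
  qed
  moreover have "is_partition (delta r)" using partition_shape_of[OF balanced_core] shape_of_core by metis
  ultimately show ?thesis unfolding is_2core_def by blast
qed

section \<open>Row and column lengths, and the local rule on shapes\<close>

lemma rowlen_shape_of:
  assumes "balanced S" "x \<in> S"
  shows "rowlen (shape_of S) (nat (beads_above S x + 1)) = nat (x + beads_above S x)"
proof -
  have m: "maya S" by (rule balanced_maya[OF assms(1)])
  let ?k = "nat (beads_above S x + 1)"
  have k: "int ?k = beads_above S x + 1" "1 \<le> ?k" using beads_above_nonneg[of S x] by linarith+
  have p: "beads_above S (x - 1) = beads_above S x + 1" using beads_above_pred[OF m, of x] assms(2) by simp
  have "(?k, l) \<in> shape_of S \<longleftrightarrow> 1 \<le> l \<and> l \<le> nat (x + beads_above S x)" for l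
  proof -
    have "int ?k \<le> beads_above S (int l - int ?k) \<longleftrightarrow> int l - int ?k \<le> x - 1"
    proof (cases "int l - int ?k \<le> x - 1")
      case True
      then show ?thesis using beads_above_mono[OF m True] p k by simp
    next
      case False
      then have "x \<le> int l - int ?k" by simp
      from beads_above_mono[OF m this] show ?thesis using False k by linarith
    qed
    moreover have "int l - int ?k \<le> x - 1 \<longleftrightarrow> l \<le> nat (x + beads_above S x)"
      using k beads_above_ge[OF assms(1), of x] by linarith
    ultimately show ?thesis using k(2) unfolding shape_of_def by simp
  qed
  then have "{l. (?k, l) \<in> shape_of S} = {1..nat (x + beads_above S x)}"
    by (intro set_eqI) (simp only: mem_Collect_eq atLeastAtMost_iff)
  then show ?thesis unfolding rowlen_def by simp
qed

text \<open>Gaps correspond to columns as beads do to rows: column l of length c is the gap l - c,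
  and c is the number of beads to its right.\<close>

lemma collen_shape_of:
  assumes "balanced S" "g \<notin> S"
  shows "collen (shape_of S) (nat (beads_above S g + g)) = nat (beads_above S g)"
proof -
  have m: "maya S" by (rule balanced_maya[OF assms(1)])
  let ?l = "nat (beads_above S g + g)"
  have p: "beads_above S (g - 1) = beads_above S g" using beads_above_pred[OF m, of g] assms(2) by simp
  then have l: "int ?l = beads_above S g + g" "1 \<le> ?l" using beads_above_ge[OF assms(1), of "g - 1"] by linarith+
  have "(k, ?l) \<in> shape_of S \<longleftrightarrow> 1 \<le> k \<and> k \<le> nat (beads_above S g)" for k
  proof -
    have "int k \<le> beads_above S (int ?l - int k) \<longleftrightarrow> int k \<le> beads_above S g"
    proof (cases "int k \<le> beads_above S g")
      case True
      then show ?thesis using beads_above_diff_le[OF m, of g "int ?l - int k"] beads_above_ge[OF assms(1), of "int ?l - int k"] l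
        by linarith
    next
      case False
      then have "int ?l - int k \<le> g - 1" using l by linarith
      from beads_above_diff_le[OF m this] show ?thesis using False p l by linarith
    qed
    then show ?thesis using l(2) unfolding shape_of_def by auto
  qed
  then have "{k. (k, ?l) \<in> shape_of S} = {1..nat (beads_above S g)}"
    by (intro set_eqI) (simp only: mem_Collect_eq atLeastAtMost_iff)
  then show ?thesis unfolding collen_def by simp
qed

text \<open>The dominoes can meet only if \<open>x\<close> and \<open>y\<close> differ by one. Then
  they share the cell on the common diagonal, so the second move finds it taken and uses the next
  cell of that diagonal instead; this is the extra cell \<open>(k+1, l+1)\<close>.\<close>

lemma local_rule_two:
  assumes A: "balanced A" and x: "movable A x" and y: "movable A y" "x \<noteq> y"
  shows "local_rule 0 (shape_of A) (shape_of (move A x)) (shape_of (move A y)) = shape_of (move (move A x) y)"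
proof -
  let ?B = "move A x"
  have m: "maya A" by (rule balanced_maya[OF A])
  have B: "balanced ?B" by (rule balanced_move[OF A x])
  have G: "shape_of (move ?B y) = shape_of A \<union> new_domino A x \<union> new_domino ?B y"
    using shape_of_move[OF A x] shape_of_move[OF B movable_two[OF x y]] by simp
  have ne: "shape_of A \<noteq> shape_of ?B" "shape_of A \<noteq> shape_of (move A y)"
    using shape_of_inject[OF A] balanced_move[OF A] x y move_neq by metis+
  have cB: "beads_above ?B z = beads_above A z + of_bool (z = x \<or> z = x + 1)" for z by (rule beads_above_move[OF m x])
  note d = shape_of_step_diff[OF A x] shape_of_step_diff[OF A y(1)]
  \<comment> \<open>The final branch merely stands for the cases of the definition that do not
    arise, so they need not be spelled out.\<close>
  have rule: "local_rule 0 (shape_of A) (shape_of ?B) (shape_of (move A y)) =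
     (if new_domino A y \<inter> new_domino A x = {} then shape_of A \<union> new_domino A y \<union> new_domino A x
      else if card (new_domino A y \<inter> new_domino A x) = 1 then
         (case the_elem (new_domino A y \<inter> new_domino A x) of (k,l) \<Rightarrow> shape_of A \<union> new_domino A y \<union> new_domino A x \<union> {(k+1, l+1)})
      else local_rule 0 (shape_of A) (shape_of ?B) (shape_of (move A y)))"
    unfolding local_rule_def Let_def d using ne by simp
  consider (far) "y \<noteq> x + 1" "x \<noteq> y + 1" | (right) "y = x + 1" | (left) "x = y + 1" by blast
  then show ?thesis
  proof cases
    case far
    have "new_domino A y \<inter> new_domino A x = {}"
      using content_new_domino[OF A, of _ x] content_new_domino[OF A, of _ y] far y(2) by fastforce
    moreover have "new_domino ?B y = new_domino A y"
      using far y(2) by (simp add: new_domino_def new_cell_def cB)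
    ultimately show ?thesis using rule G by auto
  next
    case right
    have ne': "new_cell A u \<noteq> new_cell A v" if "u \<noteq> v" for u v
      using content_new_cell[OF A] that by metis
    have I: "new_domino A y \<inter> new_domino A x = {new_cell A (x + 1)}"
      unfolding new_domino_def right using ne' by auto
    obtain k l where kl: "new_cell A (x + 1) = (k,l)" by fastforce
    have "new_cell ?B (x + 1) = (k + 1, l + 1)"
      using kl by (simp add: new_cell_eq_iff[OF A] new_cell_eq_iff[OF B] cB)
    moreover have "new_cell ?B (x + 1 + 1) = new_cell A (x + 1 + 1)"
      by (simp add: new_cell_def cB)
    ultimately have "new_domino ?B y \<union> new_domino A x = new_domino A y \<union> new_domino A x \<union> {(k + 1, l + 1)}"
      unfolding new_domino_def right kl by auto
    then show ?thesis using rule G I kl by auto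
  next
    case left
    have ne': "new_cell A u \<noteq> new_cell A v" if "u \<noteq> v" for u v
      using content_new_cell[OF A] that by metis
    have I: "new_domino A y \<inter> new_domino A x = {new_cell A (y + 1)}"
      unfolding new_domino_def left using ne' by auto
    obtain k l where kl: "new_cell A (y + 1) = (k,l)" by fastforce
    have "new_cell ?B (y + 1) = (k + 1, l + 1)"
      using kl left unfolding new_cell_eq_iff[OF A] new_cell_eq_iff[OF B] cB by simp
    moreover have "new_cell ?B y = new_cell A y"
      using left unfolding new_cell_def cB by simp
    ultimately have "new_domino ?B y \<union> new_domino A x = new_domino A y \<union> new_domino A x \<union> {(k + 1, l + 1)}"
      unfolding new_domino_def left kl by auto
    then show ?thesis using rule G I kl by auto
  qed
qed

lemma local_rule_bump:
  assumes A: "balanced A" and x: "movable A x" and z: "bump A x z"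
  shows "local_rule 0 (shape_of A) (shape_of (move A x)) (shape_of (move A x)) = shape_of (move (move A x) z)"
proof -
  let ?B = "move A x"
  have m: "maya A" by (rule balanced_maya[OF A])
  have B: "balanced ?B" by (rule balanced_move[OF A x])
  have mB: "maya ?B" by (rule balanced_maya[OF B])
  have zB: "movable ?B z" by (rule bump_movable(1)[OF x z])
  have G: "shape_of (move ?B z) = shape_of ?B \<union> {new_cell ?B z, new_cell ?B (z + 1)}"
    using shape_of_move[OF B zB] by (simp add: new_domino_def)
  have ne: "shape_of A \<noteq> shape_of ?B"
    using shape_of_inject[OF A] balanced_move[OF A] x move_neq by metis
  have cB: "beads_above ?B x = beads_above A x + 1" using beads_above_move[OF m x] by simp
  have "card (new_domino A x) = 2"
    using content_new_cell[OF A, of x] content_new_cell[OF A, of "x + 1"] by (auto simp: new_domino_def card_insert_if)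
  moreover have "new_domino A x \<noteq> {}" by (auto simp: new_domino_def)
  moreover note d = shape_of_step_diff[OF A x]
  moreover have BA: "shape_of A \<union> new_domino A x = shape_of ?B" using shape_of_move[OF A x] by simp
  ultimately have rule: "local_rule 0 (shape_of A) (shape_of ?B) (shape_of ?B) =
     (if vertical (new_domino A x) then
         (let l = snd (SOME c. c \<in> new_domino A x); h = collen (shape_of ?B) (l+1)
          in shape_of ?B \<union> {(h+1, l+1), (h+2, l+1)})
      else if horizontal (new_domino A x) then
        (let k = fst (SOME c. c \<in> new_domino A x); h = rowlen (shape_of ?B) (k+1)
          in shape_of ?B \<union> {(k+1, h+1), (k+1, h+2)})
      else shape_of A)"
    unfolding local_rule_def Let_def using ne by simp
  show ?thesis
  proof (cases "x + 1 \<in> A")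
    case True
    then obtain k l where kl: "new_domino A x = {(k,l), (Suc k, l)}" "int l = beads_above A x + 1 + x"
      using new_domino_vertical[OF A] by metis
    \<comment> \<open>Both cells of a vertical domino have column \<open>l\<close>, so the choice is
      immaterial.\<close>
    have some: "snd (SOME c. c \<in> new_domino A x) = l"
      by (rule someI2[of _ "(k,l)"]) (auto simp: kl)
    have zs: "x < z" "z + 2 \<notin> A" "\<And>w. x + 2 < w \<Longrightarrow> w < z + 2 \<Longrightarrow> w \<in> A"
      using z True by (simp_all add: bump_def)
    have beads: "w \<in> ?B" if w: "x < w" "w \<le> z + 1" for w
    proof -
      consider "w = x + 1" | "w = x + 2" | "x + 2 < w" using w by linarith
      then show ?thesis using True zs(3)[of w] w by cases (auto simp: move_def)
    qed
    have g: "z + 2 \<notin> ?B" using zB by (simp add: movable_def)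
    have c1: "beads_above ?B (z + 1) = beads_above ?B (z + 2)" using beads_above_add2[OF mB, of z] g by simp
    have c0: "beads_above ?B z = beads_above ?B (z + 2) + 1"
      using beads_above_add1[OF mB, of z] c1 beads[of "z + 1"] zs(1) by simp
    have "beads_above ?B x = beads_above ?B (z + 1) + (z + 1 - x)"
      by (rule beads_above_beads[OF mB]) (use zs(1) beads in auto)
    \<comment> \<open>Only beads lie between the gap \<open>x\<close>, which is column
      \<open>l\<close> of the enlarged shape, and the gap \<open>z + 2\<close>, which is therefore
      column \<open>l + 1\<close>.\<close>
    then have l1: "beads_above ?B (z + 2) + (z + 2) = int (l + 1)" using c1 cB kl(2) by simp
    define h where "h = nat (beads_above ?B (z + 2))"
    have h: "int h = beads_above ?B (z + 2)" by (simp add: h_def)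
    have "collen (shape_of ?B) (l + 1) = h"
      using collen_shape_of[OF B g] unfolding l1 h_def nat_int .
    moreover have "new_cell ?B z = (h + 2, l + 1)" "new_cell ?B (z + 1) = (h + 1, l + 1)"
      using l1 c0 c1 h by (simp_all add: new_cell_eq_iff[OF B])
    ultimately show ?thesis
      unfolding rule G using True by (simp add: vertical_new_domino_iff[OF A] some Let_def insert_commute)
  next
    case False
    then obtain k l where kl: "new_domino A x = {(k,l), (k, Suc l)}" "int k = beads_above A x + 1"
      using new_domino_horizontal[OF A] by metis
    have some: "fst (SOME c. c \<in> new_domino A x) = k"
      by (rule someI2[of _ "(k,l)"]) (auto simp: kl)
    have zs: "z < x" "z \<in> A" "\<And>w. z < w \<Longrightarrow> w < x \<Longrightarrow> w \<notin> A"
      using z False by (simp_all add: bump_def)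
    have gaps: "w \<notin> ?B" if "z < w" "w \<le> x" for w
      using zs(3)[of w] that by (cases "w = x") (auto simp: move_def)
    have g: "z \<in> ?B" using zB by (simp add: movable_def)
    have c0: "beads_above ?B z = int k"
      using beads_above_gaps[of z x ?B] gaps zs(1) cB kl(2) by simp
    have c1: "beads_above ?B (z + 1) = int k"
      using beads_above_add1[OF mB, of z] c0 gaps[of "z + 1"] zs(1) by simp
    define h where "h = nat (z + beads_above ?B z)"
    have h: "int h = z + int k" using beads_above_ge[OF B, of z] c0 by (simp add: h_def)
    \<comment> \<open>The bead \<open>z\<close> is row \<open>k + 1\<close>, the row following that
      of the moved bead.\<close>
    have k1: "beads_above ?B z + 1 = int (k + 1)" using c0 by simp
    have "rowlen (shape_of ?B) (k + 1) = h"
      using rowlen_shape_of[OF B g] unfolding k1 h_def nat_int .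
    moreover have "new_cell ?B z = (k + 1, h + 1)" "new_cell ?B (z + 1) = (k + 1, h + 2)"
      using c0 c1 h by (simp_all add: new_cell_eq_iff[OF B])
    ultimately show ?thesis
      unfolding rule G using False by (simp add: vertical_new_domino_iff[OF A] horizontal_new_domino_iff[OF A] some Let_def)
  qed
qed

lemma local_rule_top:
  assumes A: "balanced A" and z: "top_bead A z"
  shows "local_rule 1 (shape_of A) (shape_of A) (shape_of A) = shape_of (move A z)"
proof -
  have m: "maya A" by (rule balanced_maya[OF A])
  have c: "beads_above A z = 0" "beads_above A (z + 1) = 0" "z \<in> A"
    using z by (auto simp: top_bead_def intro!: beads_above_eq_0)
  have z0: "0 \<le> z" using beads_above_ge[OF A, of z] c by simp
  have "rowlen (shape_of A) 1 = nat z" using rowlen_shape_of[OF A c(3)] c by simp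
  moreover have "new_cell A z = (1, nat z + 1)" "new_cell A (z + 1) = (1, nat z + 2)"
    using c z0 by (simp_all add: new_cell_eq_iff[OF A])
  ultimately show ?thesis
    unfolding shape_of_move[OF A top_bead_movable[OF z]] new_domino_def local_rule_def by simp
qed

lemma local_rule_bot:
  assumes A: "balanced A" and z: "bottom_gap A (z + 2)"
  shows "local_rule (-1) (shape_of A) (shape_of A) (shape_of A) = shape_of (move A z)"
proof -
  have m: "maya A" by (rule balanced_maya[OF A])
  have b: "w \<in> A" if "w < z + 2" for w using that z by (simp add: bottom_gap_def)
  have g: "z + 2 \<notin> A" using z by (simp add: bottom_gap_def)
  obtain N where N: "\<forall>x\<le>N. beads_above A x = - x" using A balanced_def by blast
  \<comment> \<open>There are only beads left of \<open>z + 2\<close>, so the value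
    \<open>- x\<close> of \<open>beads_above\<close>, known far to the left, persists up to
    \<open>z + 1\<close>.\<close>
  let ?N = "min N (z + 1)"
  have "beads_above A ?N = beads_above A (z + 1) + (z + 1 - ?N)"
    by (rule beads_above_beads[OF m]) (use b in auto)
  then have c1: "beads_above A (z + 1) = - (z + 1)" using N by simp
  have c0: "beads_above A z = - z" using beads_above_add1[OF m, of z] c1 b[of "z + 1"] by simp
  have c2: "beads_above A (z + 2) = - (z + 1)" using beads_above_add2[OF m, of z] c1 g by simp
  define h where "h = nat (- (z + 1))"
  have h: "int h = - (z + 1)" using beads_above_nonneg[of A "z + 2"] c2 by (simp add: h_def)
  have "collen (shape_of A) 1 = h" using collen_shape_of[OF A g] c2 by (simp add: h_def)
  moreover have "new_cell A z = (h + 2, 1)" "new_cell A (z + 1) = (h + 1, 1)"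
    using c0 c1 h by (simp_all add: new_cell_eq_iff[OF A])
  ultimately show ?thesis
    unfolding shape_of_move[OF A bottom_gap_movable[OF z]] new_domino_def local_rule_def by (simp add: insert_commute)
qed

lemma local_rule_shape_of:
  assumes "bead_rule m A B C G" "balanced A"
  shows "local_rule m (shape_of A) (shape_of B) (shape_of C) = shape_of G"
  using assms(1)
proof (cases rule: bead_rule.cases)
  case (bead_rule_top z)
  then show ?thesis using local_rule_top assms(2) by simp
next
  case (bead_rule_bot z)
  then show ?thesis using local_rule_bot assms(2) by simp
next
  case bead_rule_left
  then show ?thesis by (simp add: local_rule_def)
next
  case bead_rule_right
  then show ?thesis by (simp add: local_rule_def)
next
  case (bead_rule_two x y)
  then show ?thesis using local_rule_two assms(2) by simp
next
  case (bead_rule_bump x z)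
  then show ?thesis using local_rule_bump assms(2) by simp
qed

section \<open>Chains of bead sets and semistandard domino tableaux\<close>

definition chain :: "nat \<Rightarrow> nat \<Rightarrow> (nat \<Rightarrow> int set) \<Rightarrow> bool" where
  "chain r n A \<longleftrightarrow> A 0 = core r \<and> (\<forall>k<n. step (A k) (A (Suc k)))"

definition relabel :: "(nat \<Rightarrow> nat) \<Rightarrow> dtab \<Rightarrow> dtab" where
  "relabel f T = {(D, f k) | D k. (D, k) \<in> T}"

text \<open>\<open>f (Suc k)\<close> labels the domino between \<open>A k\<close> and
  \<open>A (Suc k)\<close>. Comparing neighbours is enough, since equal labels form blocks of
  consecutive dominoes.\<close>

definition labelling :: "nat \<Rightarrow> (nat \<Rightarrow> int set) \<Rightarrow> (nat \<Rightarrow> nat) \<Rightarrow> bool" where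
  "labelling n A f \<longleftrightarrow> (\<forall>k\<in>{1..n}. 1 \<le> f k) \<and> (\<forall>i j. 1 \<le> i \<longrightarrow> i \<le> j \<longrightarrow> j \<le> n \<longrightarrow> f i \<le> f j) \<and>
     (\<forall>k. Suc k < n \<longrightarrow> f (Suc k) = f (Suc (Suc k)) \<longrightarrow>
        pos (A k) (A (Suc k)) < pos (A (Suc k)) (A (Suc (Suc k))))"

abbreviation chain_tab :: "(nat \<Rightarrow> int set) \<Rightarrow> nat \<Rightarrow> dtab" where
  "chain_tab A n \<equiv> tab_of_chain (\<lambda>k. shape_of (A k)) n"

lemma chain_balanced: assumes "chain r n A" "k \<le> n" shows "balanced (A k)"
  using assms(2)
proof (induction k)
  case 0
  then show ?case using assms(1) balanced_core by (simp add: chain_def)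
next
  case (Suc k)
  then have "step (A k) (A (Suc k))" using assms(1) by (simp add: chain_def)
  then show ?case using balanced_step_eq Suc unfolding step_eq_def by (metis Suc_leD)
qed

lemma chain_movable:
  assumes "chain r n A" "k < n"
  shows "movable (A k) (pos (A k) (A (Suc k)))" "A (Suc k) = move (A k) (pos (A k) (A (Suc k)))"
proof -
  have "step (A k) (A (Suc k))" using assms by (simp add: chain_def)
  then show "movable (A k) (pos (A k) (A (Suc k)))" "A (Suc k) = move (A k) (pos (A k) (A (Suc k)))"
    using pos_move unfolding step_def by metis+
qed

lemma chain_diff:
  assumes "chain r n A" "k < n"
  shows "shape_of (A (Suc k)) - shape_of (A k) = new_domino (A k) (pos (A k) (A (Suc k)))"
    "shape_of (A k) \<subseteq> shape_of (A (Suc k))"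
  using shape_of_step_diff[OF chain_balanced[OF assms(1)] chain_movable(1)[OF assms]]
    shape_of_move[OF chain_balanced[OF assms(1)] chain_movable(1)[OF assms]]
    chain_movable(2)[OF assms, symmetric] assms(2) by auto

lemma chain_mono:
  assumes "chain r n A" "j \<le> k" "k \<le> n"
  shows "shape_of (A j) \<subseteq> shape_of (A k)"
  using assms(2,3)
proof (induction k rule: dec_induct)
  case (step k)
  then show ?case using chain_diff(2)[OF assms(1), of k] by auto
qed simp

lemma relabel_chain_tab:
  "relabel f (chain_tab A n) = (\<lambda>k. (shape_of (A (Suc k)) - shape_of (A k), f (Suc k))) ` {..<n}"
proof -
  have e: "{1..n} = Suc ` {..<n}" by (metis image_Suc_lessThan)
  show ?thesis unfolding relabel_def tab_of_chain_def e by auto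
qed

lemma chain_tab_image:
  "chain_tab A n = (\<lambda>k. (shape_of (A (Suc k)) - shape_of (A k), Suc k)) ` {..<n}"
  using relabel_chain_tab[of "\<lambda>k. k"] by (simp add: relabel_def)

context
  fixes r n A and D x
  assumes ch: "chain r n A"
  defines "D \<equiv> \<lambda>k. shape_of (A (Suc k)) - shape_of (A k)"
  defines "x \<equiv> \<lambda>k. pos (A k) (A (Suc k))"
begin

lemma D_new_domino: "k < n \<Longrightarrow> D k = new_domino (A k) (x k)"
  unfolding D_def x_def by (rule chain_diff(1)[OF ch])

lemma D_content: "k < n \<Longrightarrow> c \<in> D k \<Longrightarrow> content c = x k \<or> content c = x k + 1"
  using D_new_domino[of k] content_new_domino[OF chain_balanced[OF ch, of k], of c "x k"] by simp

lemma D_new_cell: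
  assumes "k < n"
  shows "new_cell (A k) (x k) \<in> D k" "new_cell (A k) (x k + 1) \<in> D k"
    "content (new_cell (A k) (x k)) = x k" "content (new_cell (A k) (x k + 1)) = x k + 1"
  using D_new_domino[OF assms] content_new_cell[OF chain_balanced[OF ch]] assms by (auto simp: new_domino_def)

lemma D_domino: "k < n \<Longrightarrow> domino (D k)"
  using D_new_domino domino_new_domino chain_balanced[OF ch] by simp

lemma D_le: "c \<in> D j \<Longrightarrow> c \<in> shape_of (A (Suc k)) \<Longrightarrow> k < n \<Longrightarrow> j < n \<Longrightarrow> j \<le> k"
  using chain_mono[OF ch, of "Suc k" j] unfolding D_def by (cases "j \<le> k") auto

lemma D_shape_of: "c \<in> D k \<Longrightarrow> c \<in> shape_of (A (Suc k))"
  by (simp add: D_def)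

lemma D_inject: "j < n \<Longrightarrow> k < n \<Longrightarrow> c \<in> D j \<Longrightarrow> c \<in> D k \<Longrightarrow> j = k"
  by (intro antisym D_le[of c] D_shape_of)

lemma D_eq: "j < n \<Longrightarrow> k < n \<Longrightarrow> D j = D k \<Longrightarrow> j = k"
  using D_inject D_new_cell(1) by metis

lemma inj_D: "inj_on (\<lambda>k. (D k, g k)) {..<n}"
  using D_eq by (intro inj_onI) simp

lemma card_D:
  assumes "k < n" shows "card (D k) = 2"
proof -
  have "new_cell (A k) (x k) \<noteq> new_cell (A k) (x k + 1)" using D_new_cell[OF assms] by (metis add_cancel_right_right zero_neq_one)
  then show ?thesis unfolding D_new_domino[OF assms] new_domino_def by simp
qed

lemma D_cover: "(\<Union>k<n. D k) = shape_of (A n) - delta r"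
proof -
  have "(\<Union>k<j. D k) = shape_of (A j) - shape_of (A 0)" if "j \<le> n" for j
    using that
  proof (induction j)
    case (Suc j)
    then have "(\<Union>k<Suc j. D k) = shape_of (A j) - shape_of (A 0) \<union> D j" by (auto simp: lessThan_Suc)
    then show ?case using chain_mono[OF ch, of 0 j] chain_mono[OF ch, of j "Suc j"] Suc.prems
      unfolding D_def by auto
  qed simp
  then show ?thesis using shape_of_core ch by (simp add: chain_def)
qed

lemma chain_sub: "delta r \<subseteq> shape_of (A n)"
  using chain_mono[OF ch, of 0 n] shape_of_core ch by (simp add: chain_def)

lemma card_chain: assumes "k \<le> n" shows "card (shape_of (A k)) = card (delta r) + 2 * k"
  using assms
proof (induction k)
  case 0
  then show ?case using shape_of_core ch by (simp add: chain_def)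
next
  case (Suc k)
  have "finite (shape_of (A (Suc k)))" "shape_of (A k) \<subseteq> shape_of (A (Suc k))"
    using partition_shape_of[OF chain_balanced[OF ch Suc.prems]] chain_mono[OF ch, of k "Suc k"] Suc.prems
    by (auto simp: is_partition_def)
  then have "card (shape_of (A (Suc k))) = card (shape_of (A k)) + card (D k)"
    unfolding D_def by (metis card_Diff_subset card_mono finite_subset le_add_diff_inverse)
  then show ?case using Suc card_D[of k] by simp
qed

lemma chain_Pr: "shape_of (A n) \<in> Pr r n"
proof -
  have "has_2core (shape_of (A n)) (delta r)"
    unfolding has_2core_def
  proof (intro conjI exI allI impI)
    show "is_2core (delta r)" by (rule is_2core_delta)
    show "shape_of (A 0) = delta r" using shape_of_core ch by (simp add: chain_def)
    fix k assume "k < n"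
    then show "is_partition (shape_of (A (Suc k)))" "shape_of (A k) \<subseteq> shape_of (A (Suc k))"
        "domino (shape_of (A (Suc k)) - shape_of (A k))"
      using partition_shape_of[OF chain_balanced[OF ch]] chain_mono[OF ch] D_domino by (auto simp: D_def)
  qed simp
  then show ?thesis
    using partition_shape_of[OF chain_balanced[OF ch]] card_chain unfolding Pr_def by simp
qed

lemma spin_relabel:
  "spin (relabel f (chain_tab A n)) = of_nat (\<Sum>k<n. vert (A k) (A (Suc k))) / 2"
proof -
  have "{p \<in> relabel f (chain_tab A n). vertical (fst p)} = (\<lambda>k. (D k, f (Suc k))) ` {k \<in> {..<n}. vertical (D k)}"
    unfolding relabel_chain_tab D_def by auto
  moreover have "inj_on (\<lambda>k. (D k, f (Suc k))) {k \<in> {..<n}. vertical (D k)}"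
    using inj_D by (rule inj_on_subset) auto
  ultimately have "card {p \<in> relabel f (chain_tab A n). vertical (fst p)} = card {k \<in> {..<n}. vertical (D k)}"
    by (simp add: card_image)
  also have "\<dots> = (\<Sum>k<n. of_bool (vertical (D k)))" by (simp add: of_bool_def sum.If_cases Int_def)
  also have "\<dots> = (\<Sum>k<n. vert (A k) (A (Suc k)))"
  proof (rule sum.cong)
    fix k assume "k \<in> {..<n}"
    then have "vertical (D k) \<longleftrightarrow> x k + 1 \<in> A k" "A k \<noteq> A (Suc k)"
      using D_new_domino vertical_new_domino_iff chain_balanced[OF ch] ch step_neq by (auto simp: chain_def)
    then show "of_bool (vertical (D k)) = vert (A k) (A (Suc k))" by (simp add: vert_def x_def)
  qed simp
  finally show ?thesis by (simp add: spin_def)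
qed

lemma tab_wt_relabel: "tab_wt (relabel f (chain_tab A n)) i = card {k. k < n \<and> f (Suc k) = i}"
proof -
  have "{E. (E, i) \<in> relabel f (chain_tab A n)} = D ` {k. k < n \<and> f (Suc k) = i}"
    unfolding relabel_chain_tab D_def by auto
  moreover have "inj_on D {k. k < n \<and> f (Suc k) = i}"
    using D_eq by (intro inj_onI) simp
  ultimately show ?thesis by (simp add: tab_wt_def card_image)
qed

context
  fixes f
  assumes f: "labelling n A f"
begin

lemma label_mono: "j \<le> k \<Longrightarrow> k < n \<Longrightarrow> f (Suc j) \<le> f (Suc k)"
  using f unfolding labelling_def by simp

lemma label_pos: "j < k \<Longrightarrow> k < n \<Longrightarrow> f (Suc j) = f (Suc k) \<Longrightarrow> x j < x k"
proof (induction k rule: less_induct)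
  case (less k)
  then obtain i where i: "k = Suc i" "j \<le> i" by (metis less_eq_Suc_le Suc_le_D Suc_le_mono)
  have e: "f (Suc i) = f (Suc j)" "f (Suc i) = f (Suc k)"
    using label_mono[of j i] label_mono[of i k] less i by auto
  then have "x i < x k" using f less i unfolding labelling_def x_def by simp
  moreover have "x j < x i" if "j \<noteq> i"
  proof (rule less.IH)
    show "i < k" "j < i" "i < n" "f (Suc j) = f (Suc i)"
      using less.prems(1,2) i e(1) that by simp_all
  qed
  ultimately show ?case by (cases "j = i") simp_all
qed

text \<open>With equal labels the later domino lies on larger diagonals than the lower left end
  \<open>p\<close> of the earlier one. A cell of it in a column not right of \<open>p\<close> would
  thus lie weakly above and left of \<open>p\<close>, hence already in the earlier shape.\<close>

lemma label_mincol:
  assumes "j < k" "k < n" "f (Suc j) = f (Suc k)"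
  shows "mincol (D j) < mincol (D k)"
proof -
  have jn: "j < n" using assms by simp
  define p where "p = new_cell (A j) (x j)"
  have p: "p \<in> D j" "content p = x j" using D_new_cell[OF jn] by (auto simp: p_def)
  have *: "snd p < snd q" if q: "q \<in> D k" for q
  proof (rule ccontr)
    assume neg: "\<not> ?thesis"
    have "x j < x k" by (rule label_pos[OF assms])
    then have "content p < content q" using D_content[OF assms(2) q] p by auto
    then have "fst q \<le> fst p" using neg by (simp add: content_def)
    moreover have P: "is_partition (shape_of (A (Suc j)))" using partition_shape_of chain_balanced[OF ch] jn by simp
    moreover have "1 \<le> fst q \<and> 1 \<le> snd q"
      using D_shape_of[OF q] partition_pos[OF partition_shape_of[OF chain_balanced[OF ch]], of "Suc k" "fst q" "snd q"] assms(2) by simp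
    ultimately have "q \<in> shape_of (A (Suc j))"
      using partition_closed[OF P, of "fst p" "snd p" "fst q" "snd q"] D_shape_of[OF p(1)] neg by simp
    then have "k \<le> j" using D_le[OF q _ jn assms(2)] by simp
    then show False using assms(1) by simp
  qed
  have fin: "finite (D k)" "finite (D j)" "D k \<noteq> {}"
    using D_new_domino[OF assms(2)] D_new_domino[OF jn] by (simp_all add: new_domino_def)
  then have "mincol (D k) \<in> snd ` D k"
    unfolding mincol_def using Min_in[of "snd ` D k"] by simp
  then obtain q where "q \<in> D k" "mincol (D k) = snd q" by (metis imageE)
  moreover have "mincol (D j) \<le> snd p" unfolding mincol_def using fin p by simp
  ultimately show ?thesis using * by (metis le_less_trans)
qed

text \<open>\<open>std_label\<close> counts the dominoes that weakly precede in the order by label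
  and then leftmost column; by \<open>label_mincol\<close> this is the order of the chain.\<close>

lemma std_label_relabel:
  assumes k: "k < n"
  shows "std_label (relabel f (chain_tab A n)) (D k) (f (Suc k)) = Suc k"
proof -
  let ?T = "relabel f (chain_tab A n)"
  let ?h = "\<lambda>j. (D j, f (Suc j))"
  have T: "?T = ?h ` {..<n}" unfolding relabel_chain_tab D_def ..
  have iff: "f (Suc j) < f (Suc k) \<or> f (Suc j) = f (Suc k) \<and> mincol (D j) \<le> mincol (D k) \<longleftrightarrow> j \<le> k"
    if "j < n" for j
  proof (cases j k rule: linorder_cases)
    case less
    then show ?thesis using label_mono[of j k] label_mincol[of j k] k by auto
  next
    case greater
    then show ?thesis using label_mono[of k j] label_mincol[of k j] that by auto
  qed simp
  let ?X = "{p \<in> ?T. snd p < f (Suc k)}" and ?Y = "{p \<in> ?T. snd p = f (Suc k) \<and> mincol (fst p) \<le> mincol (D k)}"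
  have "?X \<union> ?Y = ?h ` {j \<in> {..<n}. f (Suc j) < f (Suc k) \<or> f (Suc j) = f (Suc k) \<and> mincol (D j) \<le> mincol (D k)}"
    unfolding T by auto
  also have "{j \<in> {..<n}. f (Suc j) < f (Suc k) \<or> f (Suc j) = f (Suc k) \<and> mincol (D j) \<le> mincol (D k)} = {j \<in> {..<n}. j \<le> k}"
    using iff by (intro Collect_cong) auto
  also have "\<dots> = {..k}" using k by auto
  finally have "?X \<union> ?Y = ?h ` {..k}" .
  moreover have "inj_on ?h {..k}" by (rule inj_on_subset[OF inj_D]) (use k in auto)
  ultimately have "card (?X \<union> ?Y) = Suc k" by (simp add: card_image)
  moreover have "card (?X \<union> ?Y) = card ?X + card ?Y"
    by (rule card_Un_disjoint) (auto simp: T)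
  ultimately show ?thesis unfolding std_label_def by simp
qed

lemma tab_std_relabel: "tab_std (relabel f (chain_tab A n)) = chain_tab A n"
proof -
  let ?T = "relabel f (chain_tab A n)"
  have T: "?T = (\<lambda>j. (D j, f (Suc j))) ` {..<n}" unfolding relabel_chain_tab D_def ..
  have "tab_std ?T = (\<lambda>j. (D j, std_label ?T (D j) (f (Suc j)))) ` {..<n}"
    unfolding tab_std_def by (subst (2) T) auto
  also have "\<dots> = (\<lambda>j. (D j, Suc j)) ` {..<n}"
    using std_label_relabel by (intro image_cong) auto
  finally show ?thesis unfolding chain_tab_image D_def .
qed

lemma ssdt_relabel: "ssdt r (shape_of (A n)) (relabel f (chain_tab A n))"
proof -
  let ?h = "\<lambda>j. (D j, f (Suc j))"
  let ?T = "?h ` {..<n}"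
  have col: "f (Suc j) < f (Suc k)"
    if jk: "j < n" "k < n" and c: "(a,b) \<in> D j" "(a',b) \<in> D k" "a < a'" "D j \<noteq> D k" for j k a a' b
  proof -
    have P: "is_partition (shape_of (A (Suc k)))" using partition_shape_of chain_balanced[OF ch] jk by simp
    have "1 \<le> a \<and> 1 \<le> b"
      using D_shape_of[OF c(1)] partition_pos[OF partition_shape_of[OF chain_balanced[OF ch]], of "Suc j"] jk by simp
    then have "(a,b) \<in> shape_of (A (Suc k))" using partition_closed[OF P D_shape_of[OF c(2)]] c(3) by simp
    then have "j \<le> k" using D_le[OF c(1)] jk by simp
    moreover have "j \<noteq> k" using c(4) by auto
    ultimately have lt: "j < k" by simp
    \<comment> \<open>Equal labels would put the later domino on larger diagonals, whereas going
      down a column lowers the diagonal.\<close>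
    have "f (Suc j) \<noteq> f (Suc k)"
    proof
      assume "f (Suc j) = f (Suc k)"
      then have "x j < x k" using label_pos lt jk by simp
      then show False using D_content[OF jk(1) c(1)] D_content[OF jk(2) c(2)] c(3) by (auto simp: content_def)
    qed
    then show ?thesis using label_mono[of j k] lt jk by simp
  qed
  have row: "f (Suc j) \<le> f (Suc k)"
    if jk: "j < n" "k < n" and c: "(a,b) \<in> D j" "(a,b') \<in> D k" "b < b'" for j k a b b'
  proof -
    have P: "is_partition (shape_of (A (Suc k)))" using partition_shape_of chain_balanced[OF ch] jk by simp
    have "1 \<le> a \<and> 1 \<le> b"
      using D_shape_of[OF c(1)] partition_pos[OF partition_shape_of[OF chain_balanced[OF ch]], of "Suc j"] jk by simp
    then have "(a,b) \<in> shape_of (A (Suc k))" using partition_closed[OF P D_shape_of[OF c(2)]] c(3) by simp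
    then have "j \<le> k" using D_le[OF c(1)] jk by simp
    then show ?thesis using label_mono jk by simp
  qed
  have "ssdt r (shape_of (A n)) ?T"
    unfolding ssdt_def
  proof (intro conjI)
    show "delta r \<subseteq> shape_of (A n)" by (rule chain_sub)
    show "\<forall>(E,i)\<in>?T. domino E \<and> 1 \<le> i" using D_domino f by (auto simp: labelling_def)
    show "\<forall>p\<in>?T. \<forall>q\<in>?T. p \<noteq> q \<longrightarrow> fst p \<inter> fst q = {}"
      using D_inject by (auto dest: D_inject)
    show "\<Union>(fst ` ?T) = shape_of (A n) - delta r" using D_cover by (simp add: image_image)
    show "\<forall>(E,i)\<in>?T. \<forall>(E',j)\<in>?T. \<forall>c\<in>E. \<forall>c'\<in>E'. fst c = fst c' \<and> snd c < snd c' \<longrightarrow> i \<le> j"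
      using row by fastforce
    show "\<forall>(E,i)\<in>?T. \<forall>(E',j)\<in>?T. \<forall>c\<in>E. \<forall>c'\<in>E'. E \<noteq> E' \<and> snd c = snd c' \<and> fst c < fst c' \<longrightarrow> i < j"
      using col by fastforce
  qed simp
  then show ?thesis unfolding relabel_chain_tab D_def .
qed

end

end

section \<open>Recovering a chain from a semistandard tableau\<close>

lemma domino_card: "domino E \<Longrightarrow> card E = 2 \<and> finite E \<and> E \<noteq> {}"
  unfolding domino_def vertical_def horizontal_def by auto

lemma domino_near:
  assumes "domino E" "p \<in> E" "q \<in> E"
  shows "fst p \<le> fst q + 1" "snd p \<le> snd q + 1"
  using assms unfolding domino_def vertical_def horizontal_def by auto

lemma domino_row: "domino E \<Longrightarrow> (a,b) \<in> E \<Longrightarrow> (a',b') \<in> E \<Longrightarrow> b \<noteq> b' \<Longrightarrow> a = a'"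
  unfolding domino_def vertical_def horizontal_def by auto

lemma mincol_in: assumes "domino E" obtains a where "(a, mincol E) \<in> E"
proof -
  have "mincol E \<in> snd ` E" unfolding mincol_def using domino_card[OF assms] Min_in[of "snd ` E"] by simp
  then show ?thesis using that by force
qed

lemma mincol_le: "domino E \<Longrightarrow> c \<in> E \<Longrightarrow> mincol E \<le> snd c"
  unfolding mincol_def using domino_card by simp

text \<open>The dominoes are added in the order of standardisation. The row and column conditions
  make every intermediate shape a partition, and \<open>domino_step\<close> lifts the chain of
  shapes to bead sets.\<close>

lemma ssdt_chainE:
  assumes T: "ssdt r lam T" and lam: "lam \<in> Pr r n"
  obtains A f where "chain r n A" "shape_of (A n) = lam" "labelling n A f" "T = relabel f (chain_tab A n)"
proof -
  have P: "is_partition lam" and cl: "card lam = card (delta r) + 2 * n" using lam by (auto simp: Pr_def)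
  have finT: "finite T" and sub: "delta r \<subseteq> lam" and dm: "\<And>p. p \<in> T \<Longrightarrow> domino (fst p) \<and> 1 \<le> snd p"
    and disj: "\<And>p q. p \<in> T \<Longrightarrow> q \<in> T \<Longrightarrow> p \<noteq> q \<Longrightarrow> fst p \<inter> fst q = {}"
    and cover: "\<Union>(fst ` T) = lam - delta r"
    using T unfolding ssdt_def by auto
  have row: "snd p \<le> snd q" if "p \<in> T" "q \<in> T" "(a,b) \<in> fst p" "(a,b') \<in> fst q" "b < b'" for p q a b b'
  proof -
    have "\<forall>p\<in>T. \<forall>q\<in>T. \<forall>c\<in>fst p. \<forall>c'\<in>fst q. fst c = fst c' \<and> snd c < snd c' \<longrightarrow> snd p \<le> snd q"
      using T unfolding ssdt_def split_beta by blast
    from this[rule_format, OF that(1,2,3,4)] show ?thesis using that(5) by simp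
  qed
  have col: "snd p < snd q" if "p \<in> T" "q \<in> T" "p \<noteq> q" "(a,b) \<in> fst p" "(a',b) \<in> fst q" "a < a'" for p q a b a'
  proof -
    have "\<forall>p\<in>T. \<forall>q\<in>T. \<forall>c\<in>fst p. \<forall>c'\<in>fst q.
        fst p \<noteq> fst q \<and> snd c = snd c' \<and> fst c < fst c' \<longrightarrow> snd p < snd q"
      using T unfolding ssdt_def split_beta by blast
    from this[rule_format, OF that(1,2,4,5)] show ?thesis
      using that(6) disj[OF that(1-3)] that(4) by auto
  qed
  have samecol: "snd p \<noteq> snd q" if "p \<in> T" "q \<in> T" "p \<noteq> q" "(a,b) \<in> fst p" "(a',b) \<in> fst q" for p q a b a'
  proof -
    have "a \<noteq> a'" using disj[OF that(1-3)] that(4,5) by auto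
    then show ?thesis using col[of p q a b a'] col[of q p a' b a] that by (metis linorder_neqE_nat nat_neq_iff)
  qed
  \<comment> \<open>Label first, then leftmost column, compared lexicographically. Dominoes with
    equal labels share no column, by \<open>samecol\<close>, so keys are distinct.\<close>
  define key where "key p = (snd p, mincol (fst p))" for p :: "cell set \<times> nat"
  have inj: "inj_on key T"
  proof (rule inj_onI, rule ccontr)
    fix p q assume pq: "p \<in> T" "q \<in> T" "key p = key q" "p \<noteq> q"
    obtain a where a: "(a, mincol (fst p)) \<in> fst p" using mincol_in dm pq(1) by blast
    obtain a' where a': "(a', mincol (fst q)) \<in> fst q" using mincol_in dm pq(2) by blast
    have "mincol (fst p) = mincol (fst q)" "snd p = snd q" using pq(3) by (auto simp: key_def)
    then show False using samecol[OF pq(1,2,4) a] a' by simp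
  qed
  have finl: "finite lam" using P by (simp add: is_partition_def)
  have "card (\<Union>(fst ` T)) = (\<Sum>p\<in>T. card (fst p))"
    by (rule card_UN_disjoint) (use finT dm domino_card disj in auto)
  also have "\<dots> = 2 * card T" using dm domino_card by simp
  also have "card (\<Union>(fst ` T)) = 2 * n"
    unfolding cover using card_Diff_subset[of "delta r" lam] finite_subset[OF sub finl] sub cl by simp
  finally have cT: "card T = n" by simp
  define ks where "ks = sorted_list_of_set (key ` T)"
  have ks: "set ks = key ` T" "length ks = n" "sorted_wrt (<) ks"
    using finT card_image[OF inj] cT by (auto simp: ks_def)
  define e where "e k = inv_into T key (ks ! k)" for k
  have e: "e k \<in> T" "key (e k) = ks ! k" if "k < n" for k
    using that ks nth_mem[of k ks] unfolding e_def by (auto intro: inv_into_into f_inv_into_f)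
  have Te: "T = e ` {..<n}"
  proof
    show "T \<subseteq> e ` {..<n}"
    proof
      fix p assume "p \<in> T"
      then obtain k where "k < n" "ks ! k = key p" using ks by (metis imageI in_set_conv_nth)
      then show "p \<in> e ` {..<n}" using \<open>p \<in> T\<close> inj by (auto simp: e_def image_iff intro!: bexI[of _ k])
    qed
  qed (use e in auto)
  have key_less: "key (e i) < key (e j) \<longleftrightarrow> i < j" if "i < n" "j < n" for i j
  proof (cases i j rule: linorder_cases)
    case less
    then show ?thesis using sorted_wrt_nth_less[OF ks(3) less] e ks(2) that by simp
  next
    case greater
    then have "key (e j) < key (e i)" using sorted_wrt_nth_less[OF ks(3) greater] e ks(2) that by simp
    then show ?thesis using greater by auto
  qed simp
  have e_inj: "i = j" if "e i = e j" "i < n" "j < n" for i j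
    using key_less[of i j] key_less[of j i] that by auto
  define D where "D k = fst (e k)" for k
  define c where "c k = delta r \<union> (\<Union>j<k. D j)" for k
  have dD: "domino (D k)" if "k < n" for k using dm e that by (simp add: D_def)
  have Ddisj: "i = j" if "p \<in> D i" "p \<in> D j" "i < n" "j < n" for p i j
    using disj[of "e i" "e j"] e e_inj that unfolding D_def by blast
  have lamD: "p \<in> delta r \<or> (\<exists>j<n. p \<in> D j)" if "p \<in> lam" for p
  proof -
    have "p \<in> delta r \<or> p \<in> \<Union>(fst ` T)" using that cover by auto
    then show ?thesis unfolding Te D_def by auto
  qed
  have Dlam: "p \<in> lam" "p \<notin> delta r" if "p \<in> D j" "j < n" for p j
    using that e(1) cover unfolding D_def by blast+
  have dP: "is_partition (delta r)" using is_2core_delta by (simp add: is_2core_def)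
  have c_sub: "c k \<subseteq> lam" if "k \<le> n" for k
    using that sub Dlam by (auto simp: c_def)
  have up: "(a',b) \<in> c k" if k: "k \<le> n" and ab: "(a,b) \<in> c k" "1 \<le> a'" "a' \<le> a" for k a a' b
  proof -
    have inl: "(a,b) \<in> lam" using c_sub[OF k] ab(1) by blast
    then have b: "1 \<le> b" using partition_pos[OF P] by blast
    have "(a',b) \<in> lam" using partition_closed[OF P inl] ab b by simp
    then consider "(a',b) \<in> delta r" | i where "i < n" "(a',b) \<in> D i" using lamD by blast
    then show ?thesis
    proof cases
      case (2 i)
      have "(a,b) \<notin> delta r"
        using partition_closed[OF dP, of a b a' b] ab b Dlam(2)[OF 2(2,1)] by auto
      then obtain j where j: "j < k" "(a,b) \<in> D j" using ab(1) by (auto simp: c_def)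
      have jn: "j < n" using j k by simp
      have "i \<le> j"
      proof (cases "i = j \<or> a' = a")
        case True
        then have "i = j" using Ddisj[OF 2(2) _ 2(1) jn] j(2) by blast
        then show ?thesis by simp
      next
        case False
        then have "snd (e i) < snd (e j)"
          using col[OF e(1)[OF 2(1)] e(1)[OF jn], of a' b a] e_inj[OF _ 2(1) jn] 2(2) j(2) ab(3)
          by (auto simp: D_def)
        then have "key (e i) < key (e j)" by (simp add: key_def)
        then show ?thesis using key_less[OF 2(1) jn] by simp
      qed
      then show ?thesis using 2 j by (auto simp: c_def)
    qed (simp add: c_def)
  qed
  have left: "(a,b') \<in> c k" if k: "k \<le> n" and ab: "(a,b) \<in> c k" "1 \<le> b'" "b' \<le> b" for k a b b'
  proof -
    have inl: "(a,b) \<in> lam" using c_sub[OF k] ab(1) by blast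
    then have a: "1 \<le> a" using partition_pos[OF P] by blast
    have "(a,b') \<in> lam" using partition_closed[OF P inl] ab a by simp
    then consider "(a,b') \<in> delta r" | i where "i < n" "(a,b') \<in> D i" using lamD by blast
    then show ?thesis
    proof cases
      case (2 i)
      have "(a,b) \<notin> delta r"
        using partition_closed[OF dP, of a b a b'] ab a Dlam(2)[OF 2(2,1)] by auto
      then obtain j where j: "j < k" "(a,b) \<in> D j" using ab(1) by (auto simp: c_def)
      have jn: "j < n" using j k by simp
      have "i \<le> j"
      proof (cases "i = j \<or> b' = b")
        case True
        then have "i = j" using Ddisj[OF 2(2) _ 2(1) jn] j(2) by blast
        then show ?thesis by simp
      next
        case False
        then have le: "snd (e i) \<le> snd (e j)"
          using row[OF e(1)[OF 2(1)] e(1)[OF jn], of a b' b] 2(2) j(2) ab(3) by (simp add: D_def)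
        \<comment> \<open>Labels may tie along a row, so the columns must decide. If
          \<open>D j\<close> began at or left of column \<open>b'\<close>, it would be horizontal
          and contain \<open>(a,b')\<close> itself.\<close>
        have "mincol (D i) < mincol (D j)"
        proof -
          have i: "mincol (D i) \<le> b'" using mincol_le[OF dD[OF 2(1)] 2(2)] by simp
          obtain a'' where a'': "(a'', mincol (D j)) \<in> D j" using mincol_in[OF dD[OF jn]] by blast
          have "b' < mincol (D j)"
          proof (rule ccontr)
            assume neg: "\<not> ?thesis"
            then have "mincol (D j) \<noteq> b" using False ab(3) by simp
            then have "a'' = a" using domino_row[OF dD[OF jn] a'' j(2)] by simp
            moreover have "b \<le> mincol (D j) + 1" using domino_near(2)[OF dD[OF jn] j(2) a''] by simp
            moreover from this have "b' = mincol (D j)" using neg False ab(3) by linarith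
            ultimately have "(a,b') \<in> D j" using a'' by simp
            then show False using Ddisj[OF 2(2) _ 2(1) jn] False by blast
          qed
          then show ?thesis using i by simp
        qed
        then have "key (e i) < key (e j)" using le by (auto simp: key_def D_def)
        then show ?thesis using key_less[OF 2(1) jn] by simp
      qed
      then show ?thesis using 2 j by (auto simp: c_def)
    qed (simp add: c_def)
  qed
  have cP: "is_partition (c k)" if "k \<le> n" for k
    unfolding is_partition_def
  proof (intro conjI ballI, goal_cases)
    case 1
    show ?case using c_sub[OF that] finl finite_subset by blast
  next
    case (2 p)
    then show ?case using partition_pos[OF P] c_sub[OF that] up[OF that] left[OF that]
      by (cases p) blast
  qed
  have c_diff: "c (Suc k) - c k = D k" "c k \<subseteq> c (Suc k)" if "k < n" for k
  proof -
    have "p \<notin> c k" if p: "p \<in> D k" for p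
    proof
      assume "p \<in> c k"
      then obtain j where "j < k" "p \<in> D j" using Dlam(2)[OF p \<open>k < n\<close>] by (auto simp: c_def)
      then show False using Ddisj[OF p, of j] \<open>k < n\<close> by simp
    qed
    then show "c (Suc k) - c k = D k" "c k \<subseteq> c (Suc k)" by (auto simp: c_def lessThan_Suc)
  qed
  define A where "A k = (SOME S. balanced S \<and> shape_of S = c k)" for k
  have A: "balanced (A k) \<and> shape_of (A k) = c k" if "k \<le> n" for k
  proof -
    have "\<exists>S. balanced S \<and> shape_of S = c k" using that
    proof (induction k)
      case 0
      then show ?case using balanced_core shape_of_core by (auto simp: c_def)
    next
      case (Suc k)
      then obtain S where S: "balanced S" "shape_of S = c k" by auto
      obtain x where "movable S x" "c (Suc k) = shape_of (move S x)"
        using domino_step[OF S(1) cP[OF Suc.prems]] c_diff[of k] dD[of k] S(2) Suc.prems by auto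
      then show ?case using balanced_move[OF S(1)] by metis
    qed
    then show ?thesis unfolding A_def by (rule someI_ex)
  qed
  have "step (A k) (A (Suc k))" if kn: "k < n" for k
  proof -
    have Ak: "balanced (A k)" "shape_of (A k) = c k" "balanced (A (Suc k))" "shape_of (A (Suc k)) = c (Suc k)"
      using A[of k] A[of "Suc k"] kn by auto
    obtain x where x: "movable (A k) x" "c (Suc k) = shape_of (move (A k) x)"
      using domino_step[OF Ak(1) cP[of "Suc k"]] c_diff[OF kn] dD[OF kn] Ak kn by auto
    then have "A (Suc k) = move (A k) x" using shape_of_inject[OF Ak(3) balanced_move[OF Ak(1) x(1)]] Ak by simp
    then show ?thesis using x step_def by blast
  qed
  moreover have "A 0 = core r"
    using A[of 0] balanced_core shape_of_core shape_of_inject by (simp add: c_def)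
  ultimately have ch: "chain r n A" by (simp add: chain_def)
  have An: "shape_of (A n) = lam"
  proof -
    have "lam \<subseteq> c n" using lamD by (auto simp: c_def)
    then show ?thesis using A[of n] c_sub[of n] by auto
  qed
  have AD: "shape_of (A (Suc k)) - shape_of (A k) = D k" if "k < n" for k
    using A[of k] A[of "Suc k"] c_diff[OF that] that by simp
  define f where "f k = snd (e (k - 1))" for k
  have Tf: "T = relabel f (chain_tab A n)"
    unfolding relabel_chain_tab by (subst Te) (intro image_cong, simp_all add: AD f_def D_def)
  have "labelling n A f"
    unfolding labelling_def
  proof (intro conjI ballI allI impI)
    fix k assume "k \<in> {1..n}"
    then have "k - 1 < n" by auto
    then show "1 \<le> f k" using dm[OF e(1)] by (simp add: f_def)
  next
    fix i j assume ij: "1 \<le> i" "i \<le> j" "j \<le> n"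
    then have "i = j \<or> i - 1 < j - 1" "i - 1 < n" "j - 1 < n" by auto
    then have "i = j \<or> key (e (i - 1)) < key (e (j - 1))" using key_less by blast
    then show "f i \<le> f j" by (auto simp: f_def key_def)
  next
    fix k assume k: "Suc k < n" "f (Suc k) = f (Suc (Suc k))"
    let ?x = "pos (A k) (A (Suc k))" and ?y = "pos (A (Suc k)) (A (Suc (Suc k)))"
    have kn: "k < n" using k by simp
    have lab: "snd (e k) = snd (e (Suc k))" using k by (simp add: f_def)
    have "key (e k) < key (e (Suc k))" using key_less[of k "Suc k"] k by simp
    then have mc: "mincol (D k) < mincol (D (Suc k))" using lab by (simp add: key_def D_def)
    have ne: "e k \<noteq> e (Suc k)" using e_inj[of k "Suc k"] k by auto
    have cols: "snd p < snd q" if "p \<in> D k" "q \<in> D (Suc k)" for p q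
    proof -
      obtain a where a: "(a, mincol (D k)) \<in> D k" using mincol_in[OF dD[OF kn]] by blast
      have "snd p \<le> mincol (D k) + 1" using domino_near(2)[OF dD[OF kn] that(1) a] by simp
      moreover have "mincol (D (Suc k)) \<le> snd q" using mincol_le[OF dD that(2)] k by simp
      moreover have "snd p \<noteq> snd q"
        using samecol[of "e k" "e (Suc k)" "fst p" "snd p" "fst q"] e kn k lab ne that unfolding D_def by auto
      ultimately show ?thesis using mc by simp
    qed
    show "?x < ?y"
    proof (rule ccontr)
      assume neg: "\<not> ?thesis"
      \<comment> \<open>The upper right end of the first domino and the lower left end of the
        second. If the second move does not start further right, then being in a later column forces
        \<open>q\<close> at least two rows below \<open>p\<close>.\<close>
      define p where "p = new_cell (A k) (?x + 1)"
      define q where "q = new_cell (A (Suc k)) ?y"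
      have p: "p \<in> D k" "content p = ?x + 1"
        using D_new_cell(2,4)[OF ch kn] AD[OF kn] by (simp_all add: p_def)
      have q: "q \<in> D (Suc k)" "content q = ?y"
        using D_new_cell(1,3)[OF ch k(1)] AD[OF k(1)] by (simp_all add: q_def)
      have c: "snd p < snd q" using cols p q by blast
      then have r: "fst p + 2 \<le> fst q" using neg p(2) q(2) by (simp add: content_def)
      have pl: "p \<in> lam" "p \<notin> delta r" "q \<in> lam" using Dlam p q kn k by auto
      have p1: "1 \<le> fst p" "1 \<le> snd p" using partition_pos[OF P, of "fst p" "snd p"] pl by auto
      \<comment> \<open>This corner is below \<open>p\<close> and left of \<open>q\<close>, and too
        far down to belong to \<open>D k\<close>. Strict increase from \<open>p\<close> down to it
        and weak increase from it to \<open>q\<close> contradict the equal labels.\<close>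
      let ?s = "(fst q, snd p)"
      have "?s \<in> lam" using partition_closed[OF P, of "fst q" "snd q" "fst q" "snd p"] pl c r p1 by simp
      moreover have "?s \<notin> delta r"
        using partition_closed[OF dP, of "fst q" "snd p" "fst p" "snd p"] pl p1 r by auto
      ultimately obtain j where j: "j < n" "?s \<in> D j" using lamD by blast
      have "e j \<noteq> e k"
      proof
        assume "e j = e k"
        then have "?s \<in> D k" using j by (simp add: D_def)
        then show False using domino_near(1)[OF dD[OF kn] _ p(1)] r by fastforce
      qed
      then have "snd (e k) < snd (e j)"
        using col[of "e k" "e j" "fst p" "snd p" "fst q"] e j kn p(1) r unfolding D_def by auto
      moreover have "snd (e j) \<le> snd (e (Suc k))"
        using row[of "e j" "e (Suc k)" "fst q" "snd p" "snd q"] e j k q(1) c unfolding D_def by auto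
      ultimately show False using lab by simp
    qed
  qed
  then show ?thesis using that ch An Tf by blast
qed

section \<open>Standardisation of colored biwords\<close>

text \<open>Turns \<open>prec\<close> into a lexicographic order of integers, so that facts about
  sorted lists apply. Barred top letters come first and reverse the comparison of the bottom
  letters.\<close>

definition bkey :: "biletter \<Rightarrow> int \<times> int \<times> int" where
  "bkey a = (int (fst (fst a)), of_bool (\<not> snd (fst a)),
     if snd (fst a) then - neg (snd a) else neg (snd a))"

lemma prec_iff_bkey: "prec a b \<longleftrightarrow> bkey a < bkey b"
proof -
  obtain m p y k q z where ab: "a = ((m, p), y)" "b = ((k, q), z)" by (metis prod.exhaust)
  show ?thesis unfolding ab by (cases p; cases q) (simp_all add: prec_def bkey_def less_prod_def')
qed

lemma neg_inject: "1 \<le> fst y \<Longrightarrow> 1 \<le> fst z \<Longrightarrow> neg y = neg z \<longleftrightarrow> y = z"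
  by (auto simp: neg_def prod_eq_iff split: if_splits)

lemma inj_on_bkey: "inj_on bkey {a. 1 \<le> fst (snd a)}"
proof (rule inj_onI)
  fix a b :: biletter
  assume "a \<in> {a. 1 \<le> fst (snd a)}" "b \<in> {a. 1 \<le> fst (snd a)}" and e: "bkey a = bkey b"
  then have "1 \<le> fst (snd a)" "1 \<le> fst (snd b)" by simp_all
  then have "snd a = snd b \<longleftrightarrow> neg (snd a) = neg (snd b)" using neg_inject by metis
  then show "a = b" using e by (auto simp: bkey_def prod_eq_iff split: if_splits)
qed

lemma canonical_iff:
  assumes "\<forall>a\<in>set w. 1 \<le> fst (snd a)"
  shows "canonical w \<longleftrightarrow> sorted (map bkey w)"
proof -
  have "a = b \<or> prec a b \<longleftrightarrow> bkey a \<le> bkey b" if "a \<in> set w" "b \<in> set w" for a b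
    using inj_onD[OF inj_on_bkey, of a b] that assms by (auto simp: prec_iff_bkey le_less)
  note e = this
  show ?thesis
    unfolding canonical_def sorted_map by (rule iffI; erule sorted_wrt_mono_rel[rotated]; simp add: e)
qed

text \<open>Justifies the \<open>THE\<close> in \<open>binv\<close>: \<open>bkey\<close> is
  injective on positive bottom letters, so a multiset of biletters has only one canonical
  arrangement.\<close>

lemma binv_eqI:
  assumes "canonical v" "mset v = mset (map prod.swap w)" "\<forall>a\<in>set v. 1 \<le> fst (snd a)"
  shows "binv w = v"
  unfolding binv_def
proof (rule the_equality)
  fix u assume u: "canonical u \<and> mset u = mset (map prod.swap w)"
  then have m: "mset u = mset v" using assms(2) by simp
  then have su: "set u = set v" by (rule mset_eq_setD)
  then have "sorted (map bkey u)" "sorted (map bkey v)" using canonical_iff[of u] canonical_iff[of v] u assms by auto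
  moreover have "mset (map bkey u) = mset (map bkey v)" using m by simp
  ultimately have "map bkey u = map bkey v" by (metis properties_for_sort sorted_sort_id)
  moreover have "inj_on bkey (set u \<union> set v)"
    by (rule inj_on_subset[OF inj_on_bkey]) (use su assms(3) in auto)
  ultimately show "u = v" by (metis map_inj_on)
qed (use assms in simp)

definition pneg :: "(nat \<Rightarrow> nat) \<Rightarrow> (nat \<Rightarrow> bool) \<Rightarrow> nat \<Rightarrow> int" where
  "pneg \<rho> \<beta> i = (if \<beta> i then - int (Suc (\<rho> i)) else int (Suc (\<rho> i)))"

definition inv_perms :: "nat \<Rightarrow> (nat \<Rightarrow> nat) \<Rightarrow> (nat \<Rightarrow> nat) \<Rightarrow> bool" where
  "inv_perms n \<rho> \<sigma> \<longleftrightarrow> (\<forall>i<n. \<rho> i < n \<and> \<sigma> i < n \<and> \<sigma> (\<rho> i) = i \<and> \<rho> (\<sigma> i) = i)"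

text \<open>The top row is \<open>f\<close>, the weakly increasing rearrangement of the bottom row is \<open>g\<close>, and
  position \<open>i\<close> of the standardised word carries the letter \<open>\<rho> i + 1\<close>, barred iff \<open>\<beta> i\<close>.\<close>

definition bidata :: "nat \<Rightarrow> (nat \<Rightarrow> nat) \<Rightarrow> (nat \<Rightarrow> nat) \<Rightarrow> (nat \<Rightarrow> nat) \<Rightarrow> (nat \<Rightarrow> nat) \<Rightarrow> (nat \<Rightarrow> bool) \<Rightarrow> bool" where
  "bidata n f g \<rho> \<sigma> \<beta> \<longleftrightarrow>
     inv_perms n \<rho> \<sigma> \<and> (\<forall>i<n. 1 \<le> f i \<and> 1 \<le> g i) \<and>
     (\<forall>i j. i \<le> j \<longrightarrow> j < n \<longrightarrow> f i \<le> f j \<and> g i \<le> g j) \<and>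
     (\<forall>i. Suc i < n \<longrightarrow> f i = f (Suc i) \<longrightarrow> pneg \<rho> \<beta> i < pneg \<rho> \<beta> (Suc i)) \<and>
     (\<forall>k. Suc k < n \<longrightarrow> g k = g (Suc k) \<longrightarrow> pneg \<sigma> (\<beta> \<circ> \<sigma>) k < pneg \<sigma> (\<beta> \<circ> \<sigma>) (Suc k))"

definition biword :: "nat \<Rightarrow> (nat \<Rightarrow> nat) \<Rightarrow> (nat \<Rightarrow> nat) \<Rightarrow> (nat \<Rightarrow> nat) \<Rightarrow> (nat \<Rightarrow> bool) \<Rightarrow> biletter list" where
  "biword n f g \<rho> \<beta> = map (\<lambda>i. ((f i, False), (g (\<rho> i), \<beta> i))) [0..<n]"

lemma inv_perms_swap: "inv_perms n \<rho> \<sigma> \<Longrightarrow> inv_perms n \<sigma> \<rho>"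
  by (simp add: inv_perms_def)

lemma mset_map_perm:
  assumes "inv_perms n \<rho> \<sigma>"
  shows "mset (map (\<lambda>k. h (\<sigma> k)) [0..<n]) = mset (map h [0..<n])"
proof -
  have "bij_betw \<sigma> {0..<n} {0..<n}"
    by (rule bij_betw_byWitness[of _ \<rho>]) (use assms in \<open>auto simp: inv_perms_def\<close>)
  then have "image_mset \<sigma> (mset_set {0..<n}) = mset_set {0..<n}"
    by (simp add: bij_betw_def image_mset_mset_set)
  then have "mset (map \<sigma> [0..<n]) = mset [0..<n]" by simp
  then have "image_mset h (mset (map \<sigma> [0..<n])) = image_mset h (mset [0..<n])" by simp
  then show ?thesis by (simp add: image_mset.compositionality comp_def)
qed

lemma ostd_map: "ostd (map (\<lambda>i. (h i, h' i)) [0..<n]) = map (\<lambda>i. ((Suc i, snd (h i)), h' i)) [0..<n]"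
  unfolding ostd_def by (auto intro!: map_cong)

lemma sorted_bkey_map:
  "sorted (map bkey (map h [0..<n])) \<longleftrightarrow> (\<forall>i. Suc i < n \<longrightarrow> bkey (h i) \<le> bkey (h (Suc i)))"
  by (simp add: sorted_iff_nth_Suc)

lemma bstd_biword:
  assumes "bidata n f g \<rho> \<sigma> \<beta>"
  shows "cbiword (biword n f g \<rho> \<beta>)"
    "bstd (biword n f g \<rho> \<beta>) = map (\<lambda>i. ((Suc i, False), (Suc (\<rho> i), \<beta> i))) [0..<n]"
proof -
  have ip: "inv_perms n \<rho> \<sigma>" using assms by (simp add: bidata_def)
  have pos: "1 \<le> f i" "1 \<le> g i" and perm: "\<rho> i < n \<and> \<sigma> i < n \<and> \<sigma> (\<rho> i) = i \<and> \<rho> (\<sigma> i) = i" if "i < n" for i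
    using assms that unfolding bidata_def inv_perms_def by auto
  have fm: "f i \<le> f j" and gm: "g i \<le> g j" if "i \<le> j" "j < n" for i j
    using assms that unfolding bidata_def by auto
  have fs: "pneg \<rho> \<beta> i < pneg \<rho> \<beta> (Suc i)" if "Suc i < n" "f i = f (Suc i)" for i
    using assms that unfolding bidata_def by auto
  have gs: "pneg \<sigma> (\<beta> \<circ> \<sigma>) k < pneg \<sigma> (\<beta> \<circ> \<sigma>) (Suc k)" if "Suc k < n" "g k = g (Suc k)" for k
    using assms that unfolding bidata_def by auto
  let ?w = "biword n f g \<rho> \<beta>"
  have "canonical ?w"
  proof -
    have p: "\<forall>a\<in>set ?w. 1 \<le> fst (snd a)" using pos perm by (auto simp: biword_def)
    have "bkey ((f i, False), (g (\<rho> i), \<beta> i)) \<le> bkey ((f (Suc i), False), (g (\<rho> (Suc i)), \<beta> (Suc i)))"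
      if i: "Suc i < n" for i
    proof (cases "f i = f (Suc i)")
      case True
      then have less: "pneg \<rho> \<beta> i < pneg \<rho> \<beta> (Suc i)" using fs i by simp
      have r: "\<rho> i < n" "\<rho> (Suc i) < n" using perm i by auto
      have "neg (g (\<rho> i), \<beta> i) \<le> neg (g (\<rho> (Suc i)), \<beta> (Suc i))"
        using less gm[of "\<rho> i" "\<rho> (Suc i)"] gm[of "\<rho> (Suc i)" "\<rho> i"] r
        by (auto simp: pneg_def neg_def split: if_splits)
      then show ?thesis using True by (simp add: bkey_def less_eq_prod_def)
    next
      case False
      then have "f i < f (Suc i)" using fm[of i "Suc i"] i by simp
      then show ?thesis by (simp add: bkey_def less_eq_prod_def)
    qed
    then show ?thesis unfolding canonical_iff[OF p] by (simp add: biword_def sorted_bkey_map del: map_map)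
  qed
  then show "cbiword ?w" unfolding cbiword_def dcbiword_def using pos perm by (auto simp: biword_def)
  have o: "ostd ?w = map (\<lambda>i. ((Suc i, False), (g (\<rho> i), \<beta> i))) [0..<n]"
    unfolding biword_def ostd_map by simp
  \<comment> \<open>In the inverse word the bars sit on the top letters, position \<open>k\<close>
    holding the bar of position \<open>\<sigma> k\<close>. Among equal barred tops the canonical
    order reverses the bottom letters, which is the order by
    \<open>pneg \<sigma> (\<beta> \<circ> \<sigma>)\<close>.\<close>
  define v where "v = map (\<lambda>k. ((g k, \<beta> (\<sigma> k)), (Suc (\<sigma> k), False))) [0..<n]"
  have bv: "binv (ostd ?w) = v"
  proof (rule binv_eqI)
    have "mset v = mset (map (\<lambda>k. (\<lambda>i. ((g (\<rho> i), \<beta> i), (Suc i, False))) (\<sigma> k)) [0..<n])"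
      unfolding v_def using perm by (intro arg_cong[of _ _ mset] map_cong) auto
    also have "\<dots> = mset (map (\<lambda>i. ((g (\<rho> i), \<beta> i), (Suc i, False))) [0..<n])"
      by (rule mset_map_perm[OF ip])
    also have "\<dots> = mset (map prod.swap (ostd ?w))" unfolding o by (simp add: comp_def)
    finally show "mset v = mset (map prod.swap (ostd ?w))" .
    show p: "\<forall>a\<in>set v. 1 \<le> fst (snd a)" by (auto simp: v_def)
    have "bkey ((g k, \<beta> (\<sigma> k)), (Suc (\<sigma> k), False)) \<le> bkey ((g (Suc k), \<beta> (\<sigma> (Suc k))), (Suc (\<sigma> (Suc k)), False))"
      if k: "Suc k < n" for k
    proof (cases "g k = g (Suc k)")
      case True
      then show ?thesis using gs[OF k True] by (auto simp: bkey_def less_eq_prod_def pneg_def neg_def split: if_splits)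
    next
      case False
      then have "g k < g (Suc k)" using gm[of k "Suc k"] k by simp
      then show ?thesis by (simp add: bkey_def less_eq_prod_def)
    qed
    then show "canonical v" unfolding canonical_iff[OF p] by (simp add: v_def sorted_bkey_map del: map_map)
  qed
  have ov: "ostd v = map (\<lambda>k. ((Suc k, \<beta> (\<sigma> k)), (Suc (\<sigma> k), False))) [0..<n]"
    unfolding v_def ostd_map by simp
  have "binv (ostd v) = map (\<lambda>i. ((Suc i, False), (Suc (\<rho> i), \<beta> i))) [0..<n]" (is "_ = ?u")
  proof (rule binv_eqI)
    have "mset ?u = mset (map (\<lambda>i. (\<lambda>k. ((Suc (\<sigma> k), False), (Suc k, \<beta> (\<sigma> k)))) (\<rho> i)) [0..<n])"
      using perm by (intro arg_cong[of _ _ mset] map_cong) auto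
    also have "\<dots> = mset (map (\<lambda>k. ((Suc (\<sigma> k), False), (Suc k, \<beta> (\<sigma> k)))) [0..<n])"
      by (rule mset_map_perm[OF inv_perms_swap[OF ip]])
    also have "\<dots> = mset (map prod.swap (ostd v))" unfolding ov by (simp add: comp_def)
    finally show "mset ?u = mset (map prod.swap (ostd v))" .
    show p: "\<forall>a\<in>set ?u. 1 \<le> fst (snd a)" by auto
    show "canonical ?u" unfolding canonical_iff[OF p] sorted_bkey_map
      by (simp add: bkey_def less_eq_prod_def)
  qed
  then show "bstd ?w = ?u" unfolding bstd_def bv .
qed

lemma biword_exists:
  assumes w: "cbiword w" "length w = n"
  obtains f g \<rho> \<sigma> \<beta> where "bidata n f g \<rho> \<sigma> \<beta>" "w = biword n f g \<rho> \<beta>"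
proof -
  have pos: "1 \<le> fst (fst a)" "1 \<le> fst (snd a)" and unb: "\<not> snd (fst a)" if "a \<in> set w" for a
    using w(1) that unfolding cbiword_def dcbiword_def by auto
  have srt: "sorted (map bkey w)"
    using w(1) canonical_iff[of w] pos(2) unfolding cbiword_def dcbiword_def by auto
  define f where "f i = fst (fst (w ! i))" for i
  define y where "y i = snd (w ! i)" for i
  have wi: "w ! i = ((f i, False), y i)" and f1: "1 \<le> f i" and y1: "1 \<le> fst (y i)" if "i < n" for i
    using pos[of "w ! i"] unb[of "w ! i"] that w(2) by (auto simp: f_def y_def prod_eq_iff)
  \<comment> \<open>The order of the inverse word after its bottom row has become the positions.
    Sorting the positions by it yields \<open>\<sigma>\<close>; equal unbarred letters are thereby
    numbered from left to right and equal barred ones from right to left.\<close>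
  define key where "key i = bkey (y i, (Suc i, False))" for i
  have key_eq: "key i = (int (fst (y i)), of_bool (\<not> snd (y i)), if snd (y i) then - int (Suc i) else int (Suc i))" for i
    by (simp add: key_def bkey_def neg_def)
  have key_inj: "i = j" if "key i = key j" for i j
    using that unfolding key_eq by (auto split: if_splits)
  define idx where "idx = sort_key key [0..<n]"
  have idx: "length idx = n" "set idx = {..<n}" "distinct idx" "sorted (map key idx)"
    by (auto simp: idx_def)
  define \<sigma> where "\<sigma> k = idx ! k" for k
  define \<rho> where "\<rho> i = (THE k. k < n \<and> idx ! k = i)" for i
  have \<sigma>n: "\<sigma> k < n" if "k < n" for k using idx(1,2) that nth_mem[of k idx] by (auto simp: \<sigma>_def)
  have \<rho>: "\<rho> i < n \<and> \<sigma> (\<rho> i) = i" if "i < n" for i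
  proof -
    have "\<exists>!k. k < n \<and> idx ! k = i"
      using idx(1,2) distinct_Ex1[OF idx(3), of i] that by auto
    then show ?thesis unfolding \<rho>_def \<sigma>_def by (rule theI')
  qed
  have \<rho>\<sigma>: "\<rho> (\<sigma> k) = k" if "k < n" for k
    using \<rho>[OF \<sigma>n[OF that]] that idx(1,3) by (metis \<sigma>_def nth_eq_iff_index_eq)
  have key_less: "key (\<sigma> k) < key (\<sigma> l)" if "k < l" "l < n" for k l
  proof -
    have "key (\<sigma> k) \<le> key (\<sigma> l)"
      using sorted_nth_mono[OF idx(4), of k l] that idx(1) by (simp add: \<sigma>_def)
    moreover have "key (\<sigma> k) \<noteq> key (\<sigma> l)" using key_inj \<rho>\<sigma>[of k] \<rho>\<sigma>[of l] that by fastforce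
    ultimately show ?thesis by simp
  qed
  have \<rho>_less: "\<rho> i < \<rho> j" if "key i < key j" "i < n" "j < n" for i j
  proof (rule ccontr)
    assume "\<not> ?thesis"
    then have "\<rho> j < \<rho> i \<or> \<rho> i = \<rho> j" by auto
    then have "key j < key i \<or> i = j" using key_less[of "\<rho> j" "\<rho> i"] \<rho>[OF that(2)] \<rho>[OF that(3)] by metis
    then show False using that(1) by auto
  qed
  define g where "g k = fst (y (\<sigma> k))" for k
  define \<beta> where "\<beta> i = snd (y i)" for i
  have gy: "y i = (g (\<rho> i), \<beta> i)" if "i < n" for i
    using \<rho>[OF that] by (simp add: g_def \<beta>_def)
  have "w = biword n f g \<rho> \<beta>"
    by (rule nth_equalityI) (use w(2) wi gy in \<open>auto simp: biword_def\<close>)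
  moreover have "bidata n f g \<rho> \<sigma> \<beta>"
    unfolding bidata_def
  proof (intro conjI allI impI, goal_cases)
    case 1 show ?case unfolding inv_perms_def using \<rho> \<sigma>n \<rho>\<sigma> by blast
  next
    case (2 i) then show ?case by (rule f1)
  next
    case (3 i) then show ?case unfolding g_def using y1 \<sigma>n by blast
  next
    case (4 i j)
    then have "bkey (w ! i) \<le> bkey (w ! j)" using sorted_nth_mono[OF srt, of i j] w(2) by simp
    then show ?case using 4 by (auto simp: wi bkey_def less_eq_prod_def)
  next
    case (5 i j)
    then have "key (\<sigma> i) \<le> key (\<sigma> j)" using key_less[of i j] by (cases "i = j") auto
    then show ?case by (auto simp: key_eq g_def less_eq_prod_def)
  next
    case (6 i)
    then have "bkey (w ! i) \<le> bkey (w ! Suc i)" using sorted_nth_mono[OF srt, of i "Suc i"] w(2) by simp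
    then have n: "neg (y i) \<le> neg (y (Suc i))" using 6 by (auto simp: wi bkey_def less_eq_prod_def)
    have i: "i < n" using 6 by simp
    consider "\<not> \<beta> i" "\<not> \<beta> (Suc i)" | "\<beta> i" "\<beta> (Suc i)" | "\<beta> i" "\<not> \<beta> (Suc i)" | "\<not> \<beta> i" "\<beta> (Suc i)" by blast
    then show ?case
    proof cases
      case 1
      then have "key i < key (Suc i)" using n by (auto simp: key_eq neg_def \<beta>_def less_prod_def')
      then show ?thesis using \<rho>_less[OF _ i 6(1)] 1 by (simp add: pneg_def)
    next
      case 2
      then have "key (Suc i) < key i" using n by (auto simp: key_eq neg_def \<beta>_def less_prod_def')
      then show ?thesis using \<rho>_less[OF _ 6(1) i] 2 by (simp add: pneg_def)
    next
      case 3
      then show ?thesis by (simp add: pneg_def)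
    next
      case 4
      then show ?thesis using n y1[OF i] y1[OF 6(1)] by (auto simp: neg_def \<beta>_def)
    qed
  next
    case (7 k)
    then show ?case using key_less[of k "Suc k"]
      by (auto simp: key_eq g_def \<beta>_def less_prod_def' pneg_def split: if_splits)
  qed
  ultimately show ?thesis using that by blast
qed

section \<open>The bijection\<close>

lemma grid_balanced:
  assumes "grid n m (core r) X" "i \<le> n" "j \<le> n"
  shows "balanced (X i j)"
  using assms(2)
proof (induction i)
  case 0
  then show ?case using gridD(1)[OF assms(1,3)] balanced_core by simp
next
  case (Suc i)
  then show ?case using grid_step_eq[OF assms(1) _ assms(3), of i] balanced_step_eq by simp
qed

lemma growth_shape_of:
  assumes "grid n m (core r) X" "\<And>i j. i < n \<Longrightarrow> j < n \<Longrightarrow> Mval p (Suc i) (Suc j) = m i j"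
  shows "i \<le> n \<Longrightarrow> j \<le> n \<Longrightarrow> growth r p i j = shape_of (X i j)"
proof (induction i arbitrary: j)
  case 0
  then show ?case using gridD(1)[OF assms(1)] shape_of_core by simp
next
  case (Suc i)
  note IH = Suc.IH
  note i = Suc.prems(1)
  show ?case using Suc.prems(2)
  proof (induction j)
    case 0
    then show ?case using gridD(2)[OF assms(1) i] shape_of_core by simp
  next
    case (Suc j)
    then have "growth r p (Suc i) (Suc j) = local_rule (m i j) (shape_of (X i j)) (shape_of (X (Suc i) j)) (shape_of (X i (Suc j)))"
      using IH i assms(2) by simp
    then show ?case
      using local_rule_shape_of[OF gridD(3)[OF assms(1), of i j] grid_balanced[OF assms(1), of i j]] i Suc.prems
      by simp
  qed
qed

lemma grid_chain:
  assumes "grid n m (core r) X" "signed_perm n m"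
  shows "chain r n (\<lambda>k. X k n)"
  using grid_step[OF assms] gridD(1)[OF assms(1)] by (simp add: chain_def)

section \<open>Signed permutations as matrices, and the map from biwords to tableaux\<close>

definition perm_matrix :: "(nat \<Rightarrow> nat) \<Rightarrow> (nat \<Rightarrow> bool) \<Rightarrow> nat \<Rightarrow> nat \<Rightarrow> int" where
  "perm_matrix \<rho> \<beta> i j = (if \<rho> i = j then if \<beta> i then -1 else 1 else 0)"

lemma perm_matrix_nonzero: "perm_matrix \<rho> \<beta> i j \<noteq> 0 \<longleftrightarrow> \<rho> i = j"
  by (simp add: perm_matrix_def)

lemma inv_permsD:
  assumes "inv_perms n \<rho> \<sigma>" "i < n"
  shows "\<rho> i < n" "\<sigma> i < n" "\<sigma> (\<rho> i) = i" "\<rho> (\<sigma> i) = i"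
  using assms by (auto simp: inv_perms_def)

lemma bidata_perms: "bidata n f g \<rho> \<sigma> \<beta> \<Longrightarrow> inv_perms n \<rho> \<sigma>"
  by (simp add: bidata_def)

lemma signed_perm_matrix: assumes "inv_perms n \<rho> \<sigma>" shows "signed_perm n (perm_matrix \<rho> \<beta>)"
  unfolding signed_perm_def perm_matrix_nonzero
proof (intro conjI allI impI)
  fix j assume "j < n"
  then show "\<exists>!i. i < n \<and> \<rho> i = j" using inv_permsD[OF assms] by metis
qed (use inv_permsD[OF assms] in \<open>auto simp: perm_matrix_def\<close>)

lemma grid_cong:
  assumes "grid n m S X" "\<And>i j. i < n \<Longrightarrow> j < n \<Longrightarrow> m i j = m' i j"
  shows "grid n m' S X"
  using assms by (simp add: grid_def)

lemma grid_transpose: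
  assumes "grid n (perm_matrix \<rho> \<beta>) S X" "inv_perms n \<rho> \<sigma>"
  shows "grid n (perm_matrix \<sigma> (\<beta> \<circ> \<sigma>)) S (\<lambda>i j. X j i)"
  by (rule grid_cong[OF grid_swap[OF assms(1)]])
    (use inv_permsD[OF assms(2)] in \<open>auto simp: perm_matrix_def\<close>)

lemma descent_rows:
  assumes X: "grid n (perm_matrix \<rho> \<beta>) (core r) X" and p: "inv_perms n \<rho> \<sigma>" and k: "Suc k < n"
  shows "pos (X k n) (X (Suc k) n) < pos (X (Suc k) n) (X (Suc (Suc k)) n) \<longleftrightarrow> pneg \<rho> \<beta> k < pneg \<rho> \<beta> (Suc k)"
  using grid_descent[OF X signed_perm_matrix[OF p] k, of "\<rho> k" "\<rho> (Suc k)"]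
    inv_permsD(1)[OF p, of k] inv_permsD(1)[OF p k] k
  by (simp add: perm_matrix_def pneg_def)

text \<open>The dominoes are those of the standardised word; only the letters are restored. The k-th
  domino of \<open>P\<close> gets the k-th smallest bottom letter, while the top row is already
  increasing. Labels start at 1 and list positions at 0, hence \<open>k - 1\<close>.\<close>

definition tab_pair :: "nat \<Rightarrow> biletter list \<Rightarrow> dtab \<times> dtab" where
  "tab_pair r w =
     (relabel (\<lambda>k. sort (map (\<lambda>(x,y). fst y) w) ! (k - 1)) (Pd r (map snd (bstd w))),
      relabel (\<lambda>k. map (\<lambda>(x,y). fst x) w ! (k - 1)) (Qd r (map snd (bstd w))))"

lemma sort_bottom_biword:
  assumes "bidata n f g \<rho> \<sigma> \<beta>"
  shows "sort (map (\<lambda>(x,y). fst y) (biword n f g \<rho> \<beta>)) = map g [0..<n]"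
proof (rule properties_for_sort)
  have "mset (map g [0..<n]) = mset (map (\<lambda>i. g (\<rho> i)) [0..<n])"
    by (rule mset_map_perm[OF inv_perms_swap[OF bidata_perms[OF assms]], symmetric])
  then show "mset (map g [0..<n]) = mset (map (\<lambda>(x,y). fst y) (biword n f g \<rho> \<beta>))"
    by (simp add: biword_def comp_def)
  show "sorted (map g [0..<n])"
    using assms by (auto simp: bidata_def sorted_iff_nth_mono)
qed

lemma top_biword: "map (\<lambda>(x,y). fst x) (biword n f g \<rho> \<beta>) = map f [0..<n]"
  by (simp add: biword_def comp_def)

lemma sorted_top: "bidata n f g \<rho> \<sigma> \<beta> \<Longrightarrow> sorted (map f [0..<n])"
  by (auto simp: bidata_def sorted_iff_nth_mono)

lemma Mval_biword:
  assumes "bidata n f g \<rho> \<sigma> \<beta>" "i < n"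
  shows "Mval (map snd (bstd (biword n f g \<rho> \<beta>))) (Suc i) (Suc j) = perm_matrix \<rho> \<beta> i j"
  using assms(2) unfolding bstd_biword(2)[OF assms(1)] Mval_def perm_matrix_def by auto

lemma Pd_Qd_chain:
  assumes b: "bidata n f g \<rho> \<sigma> \<beta>" and X: "grid n (perm_matrix \<rho> \<beta>) (core r) X"
  shows "Pd r (map snd (bstd (biword n f g \<rho> \<beta>))) = chain_tab (\<lambda>k. X n k) n"
    "Qd r (map snd (bstd (biword n f g \<rho> \<beta>))) = chain_tab (\<lambda>k. X k n) n"
proof -
  let ?p = "map snd (bstd (biword n f g \<rho> \<beta>))"
  have l: "length ?p = n" unfolding bstd_biword(2)[OF b] by simp
  have G: "growth r ?p i j = shape_of (X i j)" if "i \<le> n" "j \<le> n" for i j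
    by (rule growth_shape_of[OF X _ that]) (rule Mval_biword[OF b])
  show "Pd r ?p = chain_tab (\<lambda>k. X n k) n" "Qd r ?p = chain_tab (\<lambda>k. X k n) n"
    unfolding Pd_def Qd_def l tab_of_chain_def by (auto simp: G)
qed

lemma bidata_labelling:
  assumes b: "bidata n f g \<rho> \<sigma> \<beta>" and X: "grid n (perm_matrix \<rho> \<beta>) (core r) X"
  shows "labelling n (\<lambda>k. X k n) (\<lambda>k. f (k - 1))" "labelling n (\<lambda>k. X n k) (\<lambda>k. g (k - 1))"
proof -
  note p = bidata_perms[OF b]
  have m: "f i \<le> f j" "g i \<le> g j" if "i \<le> j" "j < n" for i j
    using b that by (auto simp: bidata_def)
  have 1: "1 \<le> f i" "1 \<le> g i" if "i < n" for i
    using b that by (auto simp: bidata_def)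
  have "pos (X k n) (X (Suc k) n) < pos (X (Suc k) n) (X (Suc (Suc k)) n)"
    if "Suc k < n" "f k = f (Suc k)" for k
    using descent_rows[OF X p that(1)] b that by (simp add: bidata_def)
  then show "labelling n (\<lambda>k. X k n) (\<lambda>k. f (k - 1))"
    unfolding labelling_def using m(1) 1(1) by auto
  have "pos (X n k) (X n (Suc k)) < pos (X n (Suc k)) (X n (Suc (Suc k)))"
    if "Suc k < n" "g k = g (Suc k)" for k
    using descent_rows[OF grid_transpose[OF X p] inv_perms_swap[OF p] that(1)] b that
    by (simp add: bidata_def)
  then show "labelling n (\<lambda>k. X n k) (\<lambda>k. g (k - 1))"
    unfolding labelling_def using m(2) 1(2) by auto
qed

lemma tab_pair_biword:
  assumes b: "bidata n f g \<rho> \<sigma> \<beta>" and X: "grid n (perm_matrix \<rho> \<beta>) (core r) X"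
  shows "tab_pair r (biword n f g \<rho> \<beta>) =
    (relabel (\<lambda>k. g (k - 1)) (chain_tab (\<lambda>k. X n k) n), relabel (\<lambda>k. f (k - 1)) (chain_tab (\<lambda>k. X k n) n))"
  unfolding tab_pair_def Pd_Qd_chain[OF b X] sort_bottom_biword[OF b] top_biword relabel_chain_tab
  by (auto intro!: image_cong)

lemma card_bars:
  assumes b: "bidata n f g \<rho> \<sigma> \<beta>"
  shows "(\<Sum>i<n. \<Sum>j<n. if perm_matrix \<rho> \<beta> i j = -1 then 2 else 0 :: nat) = 2 * tc (biword n f g \<rho> \<beta>)"
proof -
  have "(\<Sum>j<n. if perm_matrix \<rho> \<beta> i j = -1 then 2 else 0 :: nat) = 2 * of_bool (\<beta> i)" if "i < n" for i
  proof -
    have "(\<Sum>j<n. if perm_matrix \<rho> \<beta> i j = -1 then 2 else 0 :: nat) = (\<Sum>j<n. if \<rho> i = j then 2 * of_bool (\<beta> i) else 0)"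
      by (intro sum.cong) (auto simp: perm_matrix_def)
    then show ?thesis using inv_permsD(1)[OF bidata_perms[OF b] that] by simp
  qed
  then have "(\<Sum>i<n. \<Sum>j<n. if perm_matrix \<rho> \<beta> i j = -1 then 2 else 0 :: nat) = 2 * (\<Sum>i<n. of_bool (\<beta> i))"
    by (simp add: sum_distrib_left)
  also have "(\<Sum>i<n. of_bool (\<beta> i)) = card {i. i < n \<and> \<beta> i}"
    by (simp add: of_bool_def sum.If_cases Int_def)
  also have "\<dots> = tc (biword n f g \<rho> \<beta>)"
    unfolding tc_def biword_def by (simp add: filter_map comp_def length_filter_conv_card cong: conj_cong)
  finally show ?thesis .
qed

lemma count_map_upt: "count (mset (map h [0..<n])) i = card {k. k < n \<and> h k = i}"
  unfolding count_mset count_list_eq_length_filter length_filter_conv_card by (intro arg_cong[of _ _ card]) auto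

lemma wt_top_biword: "wt_top (biword n f g \<rho> \<beta>) = (\<lambda>i. card {k. k < n \<and> f k = i})"
  unfolding wt_top_def top_biword count_map_upt ..

lemma wt_bot_biword:
  assumes "bidata n f g \<rho> \<sigma> \<beta>"
  shows "wt_bot (biword n f g \<rho> \<beta>) = (\<lambda>i. card {k. k < n \<and> g k = i})"
proof -
  have "mset (map (\<lambda>(x,y). fst y) (biword n f g \<rho> \<beta>)) = mset (map g [0..<n])"
    using sort_bottom_biword[OF assms] by (metis mset_sort)
  then show ?thesis unfolding wt_bot_def by (simp add: count_map_upt[symmetric] del: mset_map)
qed

section \<open>Properties and bijectivity of the map\<close>

lemma tab_pair_props:
  assumes w: "cbiword w" "length w = n"
  shows "\<exists>lam \<in> Pr r n. ssdt r lam (fst (tab_pair r w)) \<and> ssdt r lam (snd (tab_pair r w))"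
    "of_nat (tc w) = spin (fst (tab_pair r w)) + spin (snd (tab_pair r w))"
    "tab_wt (fst (tab_pair r w)) = wt_bot w" "tab_wt (snd (tab_pair r w)) = wt_top w"
    "tab_std (fst (tab_pair r w)) = Pd r (map snd (bstd w))"
    "tab_std (snd (tab_pair r w)) = Qd r (map snd (bstd w))"
proof -
  obtain f g \<rho> \<sigma> \<beta> where b: "bidata n f g \<rho> \<sigma> \<beta>" and wb: "w = biword n f g \<rho> \<beta>"
    using biword_exists[OF w] .
  let ?m = "perm_matrix \<rho> \<beta>"
  note sp = signed_perm_matrix[OF bidata_perms[OF b]]
  obtain X where X: "grid n ?m (core r) X" using grid_exists[OF sp maya_core] by blast
  have Q: "chain r n (\<lambda>k. X k n)" by (rule grid_chain[OF X sp])
  have P: "chain r n (\<lambda>k. X n k)" by (rule grid_chain[OF grid_swap[OF X] signed_perm_swap[OF sp]])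
  note lab = bidata_labelling[OF b X]
  have eq: "fst (tab_pair r w) = relabel (\<lambda>k. g (k - 1)) (chain_tab (\<lambda>k. X n k) n)"
     "snd (tab_pair r w) = relabel (\<lambda>k. f (k - 1)) (chain_tab (\<lambda>k. X k n) n)"
    using tab_pair_biword[OF b X] wb by simp_all
  note PQ = Pd_Qd_chain[OF b X, folded wb]
  show "\<exists>lam \<in> Pr r n. ssdt r lam (fst (tab_pair r w)) \<and> ssdt r lam (snd (tab_pair r w))"
    using ssdt_relabel[OF P lab(2)] ssdt_relabel[OF Q lab(1)] chain_Pr[OF Q] eq by auto
  show "of_nat (tc w) = spin (fst (tab_pair r w)) + spin (snd (tab_pair r w))"
  proof -
    have "(\<Sum>k<n. vert (X n k) (X n (Suc k))) + (\<Sum>k<n. vert (X k n) (X (Suc k) n)) = 2 * tc w"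
      using grid_vert[OF X] card_bars[OF b] wb by simp
    then have "(of_nat ((\<Sum>k<n. vert (X n k) (X n (Suc k))) + (\<Sum>k<n. vert (X k n) (X (Suc k) n))) :: rat) = 2 * of_nat (tc w)"
      by simp
    then show ?thesis unfolding eq spin_relabel[OF P] spin_relabel[OF Q] of_nat_add by simp
  qed
  show "tab_wt (fst (tab_pair r w)) = wt_bot w"
    unfolding eq by (rule ext) (simp add: tab_wt_relabel[OF P] wb wt_bot_biword[OF b])
  show "tab_wt (snd (tab_pair r w)) = wt_top w"
    unfolding eq by (rule ext) (simp add: tab_wt_relabel[OF Q] wb wt_top_biword)
  show "tab_std (fst (tab_pair r w)) = Pd r (map snd (bstd w))"
    unfolding eq PQ by (rule tab_std_relabel[OF P lab(2)])
  show "tab_std (snd (tab_pair r w)) = Qd r (map snd (bstd w))"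
    unfolding eq PQ by (rule tab_std_relabel[OF Q lab(1)])
qed

lemma chain_tab_inject:
  assumes A: "chain r n A" and B: "chain r n B" and e: "chain_tab A n = chain_tab B n" and "k \<le> n"
  shows "A k = B k"
  using assms(4)
proof (induction k)
  case 0
  then show ?case using A B by (simp add: chain_def)
next
  case (Suc k)
  have "(shape_of (A (Suc k)) - shape_of (A k), Suc k) \<in> chain_tab A n"
    unfolding chain_tab_image using Suc.prems by auto
  then have "(shape_of (A (Suc k)) - shape_of (A k), Suc k) \<in> chain_tab B n" unfolding e .
  then have "shape_of (A (Suc k)) - shape_of (A k) = shape_of (B (Suc k)) - shape_of (B k)"
    unfolding chain_tab_image by auto
  moreover have "shape_of (A k) \<subseteq> shape_of (A (Suc k))" "shape_of (B k) \<subseteq> shape_of (B (Suc k))"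
    using chain_diff(2) A B Suc.prems by (metis Suc_le_lessD)+
  ultimately have "shape_of (A (Suc k)) = shape_of (B (Suc k))" using Suc by auto
  then show ?case using shape_of_inject chain_balanced A B Suc.prems by blast
qed

lemma sorted_count_eq:
  assumes "sorted (map f [0..<n])" "sorted (map f' [0..<n])"
    "\<And>i. card {k. k < n \<and> f k = i} = card {k. k < n \<and> f' k = i}" "k < n"
  shows "f k = (f' k :: nat)"
proof -
  have "mset (map f [0..<n]) = mset (map f' [0..<n])"
    using assms(3) by (intro multiset_eqI) (simp only: count_map_upt)
  then have "map f [0..<n] = map f' [0..<n]"
    using assms(1,2) by (metis properties_for_sort sorted_sort_id)
  then show ?thesis using assms(4) by simp
qed

text \<open>Standardising the tableaux recovers the boundary of the grid and with it the signed
  permutation; the weights recover the two rows in increasing order.\<close>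

lemma tab_pair_inject:
  assumes w: "cbiword w" "length w = n" and w': "cbiword w'" "length w' = n"
    and e: "tab_pair r w = tab_pair r w'"
  shows "w = w'"
proof -
  obtain f g \<rho> \<sigma> \<beta> where b: "bidata n f g \<rho> \<sigma> \<beta>" and wb: "w = biword n f g \<rho> \<beta>"
    using biword_exists[OF w] .
  obtain f' g' \<rho>' \<sigma>' \<beta>' where b': "bidata n f' g' \<rho>' \<sigma>' \<beta>'" and wb': "w' = biword n f' g' \<rho>' \<beta>'"
    using biword_exists[OF w'] .
  note sp = signed_perm_matrix[OF bidata_perms[OF b]] and sp' = signed_perm_matrix[OF bidata_perms[OF b']]
  obtain X where X: "grid n (perm_matrix \<rho> \<beta>) (core r) X" using grid_exists[OF sp maya_core] by blast
  obtain X' where X': "grid n (perm_matrix \<rho>' \<beta>') (core r) X'" using grid_exists[OF sp' maya_core] by blast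
  have PQ: "Pd r (map snd (bstd w)) = Pd r (map snd (bstd w'))" "Qd r (map snd (bstd w)) = Qd r (map snd (bstd w'))"
    using tab_pair_props(5,6)[OF w] tab_pair_props(5,6)[OF w'] e by metis+
  have last: "X n k = X' n k" "X k n = X' k n" if "k \<le> n" for k
    using chain_tab_inject[OF grid_chain[OF grid_swap[OF X] signed_perm_swap[OF sp]]
        grid_chain[OF grid_swap[OF X'] signed_perm_swap[OF sp']] _ that]
      chain_tab_inject[OF grid_chain[OF X sp] grid_chain[OF X' sp'] _ that]
      PQ Pd_Qd_chain[OF b X] Pd_Qd_chain[OF b' X'] wb wb' by simp_all
  have m: "perm_matrix \<rho> \<beta> i j = perm_matrix \<rho>' \<beta>' i j" if "i < n" "j < n" for i j
    using grid_unique[OF X X' last that] .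
  have \<rho>: "\<rho>' i = \<rho> i" "\<beta>' i = \<beta> i" if "i < n" for i
    using m[OF that inv_permsD(1)[OF bidata_perms[OF b] that]] by (auto simp: perm_matrix_def split: if_splits)
  have "wt_top w = wt_top w'" "wt_bot w = wt_bot w'"
    using tab_pair_props(3,4)[OF w] tab_pair_props(3,4)[OF w'] e by metis+
  then have c: "\<And>i. card {k. k < n \<and> f k = i} = card {k. k < n \<and> f' k = i}"
      "\<And>i. card {k. k < n \<and> g k = i} = card {k. k < n \<and> g' k = i}"
    unfolding wb wb' wt_top_biword wt_bot_biword[OF b] wt_bot_biword[OF b'] by metis+
  have sg: "sorted (map g [0..<n])" "sorted (map g' [0..<n])"
    using sort_bottom_biword[OF b] sort_bottom_biword[OF b'] by (metis sorted_sort)+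
  have f: "f i = f' i" and g: "g i = g' i" if "i < n" for i
    using sorted_count_eq[OF sorted_top[OF b] sorted_top[OF b'] c(1) that]
      sorted_count_eq[OF sg c(2) that] by simp_all
  show ?thesis unfolding wb wb' biword_def
    using f g \<rho> inv_permsD(1)[OF bidata_perms[OF b]] by (intro map_cong) simp_all
qed

text \<open>The labels of \<open>Q\<close> become the top row and those of \<open>P\<close> the
  sorted bottom row. By \<open>descent_rows\<close>, applied to the grid and to its transpose, the
  labelling conditions are exactly the ascent conditions in \<open>bidata\<close>.\<close>

lemma tab_pair_surj:
  assumes lam: "lam \<in> Pr r n" and P: "ssdt r lam P" and Q: "ssdt r lam Q"
  shows "\<exists>w. cbiword w \<and> length w = n \<and> tab_pair r w = (P, Q)"
proof -
  obtain A g where A: "chain r n A" "shape_of (A n) = lam" "labelling n A g" "P = relabel g (chain_tab A n)"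
    using ssdt_chainE[OF P lam] .
  obtain B f where B: "chain r n B" "shape_of (B n) = lam" "labelling n B f" "Q = relabel f (chain_tab B n)"
    using ssdt_chainE[OF Q lam] .
  have AB: "A n = B n" using shape_of_inject chain_balanced A B by blast
  obtain m X where sp: "signed_perm n m" and X: "grid n m (core r) X"
    and last: "\<And>k. k \<le> n \<Longrightarrow> X n k = A k" "\<And>k. k \<le> n \<Longrightarrow> X k n = B k"
    by (rule grid_surj[of A "core r" n B]) (use A(1) B(1) AB maya_core no_step_core in \<open>auto simp: chain_def\<close>)
  define \<rho> where "\<rho> i = (THE j. j < n \<and> m i j \<noteq> 0)" for i
  define \<sigma> where "\<sigma> j = (THE i. i < n \<and> m i j \<noteq> 0)" for j
  define \<beta> where "\<beta> i \<longleftrightarrow> m i (\<rho> i) = -1" for i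
  have \<rho>: "\<rho> i < n \<and> m i (\<rho> i) \<noteq> 0" if "i < n" for i
    unfolding \<rho>_def by (rule theI') (use sp that in \<open>auto simp: signed_perm_def\<close>)
  have \<sigma>: "\<sigma> j < n \<and> m (\<sigma> j) j \<noteq> 0" if "j < n" for j
    unfolding \<sigma>_def by (rule theI') (use sp that in \<open>auto simp: signed_perm_def\<close>)
  have uniq: "j = j'" if "i < n" "j < n" "j' < n" "m i j \<noteq> 0" "m i j' \<noteq> 0" for i j j'
    using sp that unfolding signed_perm_def by blast
  have uniq': "i = i'" if "i < n" "i' < n" "j < n" "m i j \<noteq> 0" "m i' j \<noteq> 0" for i i' j
    using sp that unfolding signed_perm_def by blast
  have perm: "\<rho> i < n" "\<sigma> i < n" "\<sigma> (\<rho> i) = i" "\<rho> (\<sigma> i) = i" if "i < n" for i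
    using \<rho> \<sigma> uniq uniq' that by blast+
  have m: "m i j = perm_matrix \<rho> \<beta> i j" if "i < n" "j < n" for i j
  proof (cases "m i j = 0")
    case True
    then show ?thesis using \<rho>[OF that(1)] by (auto simp: perm_matrix_def)
  next
    case False
    then have "\<rho> i = j" using uniq \<rho> that by blast
    moreover have "m i j \<in> {0,1,-1}" using sp that unfolding signed_perm_def by blast
    ultimately show ?thesis using False by (auto simp: perm_matrix_def \<beta>_def)
  qed
  have X': "grid n (perm_matrix \<rho> \<beta>) (core r) X" by (rule grid_cong[OF X m])
  have p: "inv_perms n \<rho> \<sigma>" using perm by (simp add: inv_perms_def)
  have b: "bidata n (\<lambda>i. f (Suc i)) (\<lambda>i. g (Suc i)) \<rho> \<sigma> \<beta>"
    unfolding bidata_def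
  proof (intro conjI allI impI, goal_cases)
    case 1 show ?case by (rule p)
  next
    case (6 k)
    then show ?case
      using descent_rows[OF X' p 6(1)] B(3) last(2) by (simp add: labelling_def)
  next
    case (7 k)
    then show ?case
      using descent_rows[OF grid_transpose[OF X' p] inv_perms_swap[OF p] 7(1)] A(3) last(1)
      by (simp add: labelling_def)
  qed (use A(3) B(3) in \<open>auto simp: labelling_def\<close>)
  let ?w = "biword n (\<lambda>i. f (Suc i)) (\<lambda>i. g (Suc i)) \<rho> \<beta>"
  have "tab_pair r ?w = (P, Q)"
    unfolding tab_pair_biword[OF b X'] A(4) B(4) relabel_chain_tab using last by (auto intro!: image_cong)
  moreover have "cbiword ?w" "length ?w = n" using bstd_biword(1)[OF b] by (auto simp: biword_def)
  ultimately show ?thesis by blast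
qed

theorem theorem2p3:
  fixes r n :: nat
  shows "\<exists>\<Phi> :: biletter list \<Rightarrow> dtab \<times> dtab.
    bij_betw \<Phi> {w. cbiword w \<and> length w = n}
                {(P,Q). \<exists>lam \<in> Pr r n. ssdt r lam P \<and> ssdt r lam Q} \<and>
    (\<forall>w. cbiword w \<and> length w = n \<longrightarrow>
        of_nat (tc w) = spin (fst (\<Phi> w)) + spin (snd (\<Phi> w)) \<and>
        tab_wt (fst (\<Phi> w)) = wt_bot w \<and> tab_wt (snd (\<Phi> w)) = wt_top w \<and>
        tab_std (fst (\<Phi> w)) = Pd r (map snd (bstd w)) \<and>
        tab_std (snd (\<Phi> w)) = Qd r (map snd (bstd w)))"
proof (intro exI[of _ "tab_pair r"] conjI allI impI)
  show "bij_betw (tab_pair r) {w. cbiword w \<and> length w = n}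
     {(P,Q). \<exists>lam \<in> Pr r n. ssdt r lam P \<and> ssdt r lam Q}"
    unfolding bij_betw_def
  proof (intro conjI inj_onI)
    fix w w' assume "w \<in> {w. cbiword w \<and> length w = n}" "w' \<in> {w. cbiword w \<and> length w = n}"
      "tab_pair r w = tab_pair r w'"
    then show "w = w'" using tab_pair_inject by blast
  next
    show "tab_pair r ` {w. cbiword w \<and> length w = n} = {(P,Q). \<exists>lam \<in> Pr r n. ssdt r lam P \<and> ssdt r lam Q}"
    proof (intro equalityI subsetI)
      fix z assume "z \<in> tab_pair r ` {w. cbiword w \<and> length w = n}"
      then show "z \<in> {(P,Q). \<exists>lam \<in> Pr r n. ssdt r lam P \<and> ssdt r lam Q}"
        using tab_pair_props(1) by (auto simp: case_prod_beta)
    next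
      fix z assume "z \<in> {(P,Q). \<exists>lam \<in> Pr r n. ssdt r lam P \<and> ssdt r lam Q}"
      then show "z \<in> tab_pair r ` {w. cbiword w \<and> length w = n}"
        using tab_pair_surj by (cases z) (auto simp: image_iff, metis)
    qed
  qed
qed (use tab_pair_props in auto)

end
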